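(* Let $M$ be a planar map with $\dim(\mathbf{P}_{VEF}(M)) \le 3$. Then both $M$ and its dual map $M^*$ are weakly outerplanar.
   Context: A planar map $M=(G,D)$ consists of a finite planar multigraph $G$ together with a plane drawing $D$ of $G$; it determines vertices, edges, faces and their incidences. The vertex-edge-face poset $\mathbf{P}_{VEF}(M)$ is the poset on vertices, edges and faces ordered by incidence/inclusion (vertex below its incident edges and the faces on whose boundary it lies; edge below the faces on whose boundary it lies). The dimension of a finite poset is the minimum number of linear orders on its ground set whose intersection is the poset's order. The dual map $M^*$ has a vertex $F^*$ for each face $F$ of $M$ and an edge $e^*$ for each edge $e$ of $M$ joining the dual vertices of the faces separated by $e$ (a loop if $e$ is a bridge). A planar map $M=(G,D)$ is weakly outerplanar if the graph $G$ is outerplanar. *)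

theory Defs
  imports "HOL-Analysis.Analysis" "HOL-Library.Extended_Nat"
begin

text \<open>An edge with a single end is a loop.\<close>

record ('v, 'e) multigraph =
  verts :: "'v set"
  edges :: "'e set"
  ends :: "'e \<Rightarrow> 'v set"

definition finite_multigraph :: "('v, 'e) multigraph \<Rightarrow> bool" where
  "finite_multigraph G \<longleftrightarrow> finite (verts G) \<and> finite (edges G) \<and>
     (\<forall>e\<in>edges G. ends G e \<subseteq> verts G \<and> card (ends G e) \<in> {1, 2})"

record ('v, 'e) drawing =
  point :: "'v \<Rightarrow> complex"
  curve :: "'e \<Rightarrow> real \<Rightarrow> complex"

text \<open>Library simple paths may be closed (they are injective up to the identification of the two
  end parameters), so loops are drawn as simple closed curves; the condition on the end points
  makes the curve of an edge with two distinct ends an arc.\<close>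

definition plane_drawing :: "('v, 'e) multigraph \<Rightarrow> ('v, 'e) drawing \<Rightarrow> bool" where
  "plane_drawing G D \<longleftrightarrow>
     inj_on (point D) (verts G) \<and>
     (\<forall>e\<in>edges G. simple_path (curve D e) \<and>
        {pathstart (curve D e), pathfinish (curve D e)} = point D ` ends G e \<and>
        path_image (curve D e) \<inter> point D ` verts G = point D ` ends G e) \<and>
     (\<forall>e\<in>edges G. \<forall>f\<in>edges G. e \<noteq> f \<longrightarrow>
        path_image (curve D e) \<inter> path_image (curve D f) \<subseteq> point D ` verts G)"

type_synonym ('v, 'e) map = "('v, 'e) multigraph \<times> ('v, 'e) drawing"

definition planar_map :: "('v, 'e) map \<Rightarrow> bool" where
  "planar_map M \<longleftrightarrow> finite_multigraph (fst M) \<and> plane_drawing (fst M) (snd M)"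

definition skeleton :: "('v, 'e) map \<Rightarrow> complex set" where
  "skeleton M =
     point (snd M) ` verts (fst M) \<union> (\<Union>e\<in>edges (fst M). path_image (curve (snd M) e))"

definition faces :: "('v, 'e) map \<Rightarrow> complex set set" where
  "faces M = components (- skeleton M)"

definition vertex_on_face :: "('v, 'e) map \<Rightarrow> 'v \<Rightarrow> complex set \<Rightarrow> bool" where
  "vertex_on_face M v F \<longleftrightarrow> point (snd M) v \<in> frontier F"

definition edge_on_face :: "('v, 'e) map \<Rightarrow> 'e \<Rightarrow> complex set \<Rightarrow> bool" where
  "edge_on_face M e F \<longleftrightarrow> path_image (curve (snd M) e) \<subseteq> frontier F"

datatype ('v, 'e) cell = Vertex 'v | Edge 'e | Face "complex set"

definition vef_cells :: "('v, 'e) map \<Rightarrow> ('v, 'e) cell set" where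
  "vef_cells M = Vertex ` verts (fst M) \<union> Edge ` edges (fst M) \<union> Face ` faces M"

definition vef_order :: "('v, 'e) map \<Rightarrow> (('v, 'e) cell \<times> ('v, 'e) cell) set" where
  "vef_order M = Id_on (vef_cells M) \<union>
     {(Vertex v, Edge e) | v e. e \<in> edges (fst M) \<and> v \<in> ends (fst M) e} \<union>
     {(Vertex v, Face F) | v F. v \<in> verts (fst M) \<and> F \<in> faces M \<and> vertex_on_face M v F} \<union>
     {(Edge e, Face F) | e F. e \<in> edges (fst M) \<and> F \<in> faces M \<and> edge_on_face M e F}"

lemma vef_order_partial_order:
  assumes "planar_map M"
  shows "partial_order_on (vef_cells M) (vef_order M)"
proof -
  have sub: "v \<in> verts (fst M)" if "e \<in> edges (fst M)" "v \<in> ends (fst M) e" for v e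
    using assms that by (auto simp: planar_map_def finite_multigraph_def)
  have on: "vertex_on_face M v F"
    if "e \<in> edges (fst M)" "v \<in> ends (fst M) e" "edge_on_face M e F" for v e F
  proof -
    have "path_image (curve (snd M) e) \<inter> point (snd M) ` verts (fst M) =
        point (snd M) ` ends (fst M) e"
      using assms that(1) by (simp add: planar_map_def plane_drawing_def)
    with that(2,3) show ?thesis
      by (auto simp: edge_on_face_def vertex_on_face_def)
  qed
  show ?thesis
    unfolding partial_order_on_def preorder_on_def
  proof (intro conjI)
    show "refl_on (vef_cells M) (vef_order M)"
      by (auto simp: refl_on_def vef_order_def)
    show "vef_order M \<subseteq> vef_cells M \<times> vef_cells M"
      by (auto simp: vef_order_def vef_cells_def dest: sub)
    show "antisym (vef_order M)"
      by (auto simp: antisym_def vef_order_def)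
    show "trans (vef_order M)"
      by (rule transI) (auto simp: vef_order_def dest: sub on)
  qed
qed

text \<open>The value is infinite exactly if the order is not an intersection of finitely many linear
  orders, which does not happen for a partial order on a finite set.\<close>

definition order_dim :: "'a set \<Rightarrow> ('a \<times> 'a) set \<Rightarrow> enat" where
  "order_dim A r =
     (INF L \<in> {L. finite L \<and> L \<noteq> {} \<and> (\<forall>l\<in>L. linear_order_on A l) \<and> \<Inter>L = r}. enat (card L))"

text \<open>The faces on whose boundary an edge lies are the faces it separates, and there is just
  one iff the edge is a bridge, in which case the dual edge is a loop.\<close>

definition dual_graph :: "('v, 'e) map \<Rightarrow> (complex set, 'e) multigraph" where
  "dual_graph M =
     \<lparr>verts = faces M, edges = edges (fst M), ends = (\<lambda>e. {F \<in> faces M. edge_on_face M e F})\<rparr>"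

definition outerplanar :: "('v, 'e) multigraph \<Rightarrow> bool" where
  "outerplanar G \<longleftrightarrow>
     (\<exists>D. planar_map (G, D) \<and>
        (\<exists>F\<in>faces (G, D). \<not> bounded F \<and> (\<forall>v\<in>verts G. vertex_on_face (G, D) v F)))"

definition weakly_outerplanar :: "('v, 'e) map \<Rightarrow> bool" where
  "weakly_outerplanar M \<longleftrightarrow> outerplanar (fst M)"

end

theory Submission
  imports Defs "HOL-Library.Z2" "HOL-Complex_Analysis.Contour_Integration"
begin

text \<open>
  For incomparable cells \<open>z\<close>, \<open>w\<close> of a poset realized by three linear orders, the set of indices \<open>j\<close>
  with \<open>w <\<^sub>j z\<close> is a nonempty proper subset of \<open>{1, 2, 3}\<close>. These six subsets form a hexagon under
  inclusion, and swapping \<open>z\<close> and \<open>w\<close> is the antipodal map. Counting passages through one side of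
  the hexagon gives a mod 2 winding number of a closed walk around a vertex \<open>v\<close>. It vanishes when the
  walk bounds a set of faces not incident with \<open>v\<close>, and for two disjoint walks it satisfies a
  product rule. Adding up these identities over a cycle with two crossing chords, or over
  three internally disjoint paths that all have an inner vertex, gives \<open>0 = 1\<close>. Hence neither
  configuration exists, and a longest cycle in each block provides a cyclic order of the vertices
  without crossing edges, which can be drawn.

  The only facts on the drawing that enter are that cycles are boundaries of sets of faces and that a
  function on the faces with acyclic coboundary is constant; both come from the Jordan curve theorem
  and Janiszewski's theorem. By linear algebra they imply the corresponding statements for the
  dual map, so that the same argument, with the three orders reversed, applies to the dual graph.
\<close>

section \<open>Chains modulo 2 on multigraphs\<close>

text \<open>Behind the parity count stands the Borsuk-Ulam theorem. Raising \<open>z\<close> or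
  lowering \<open>w\<close> only adds indices, so such moves are steps along the hexagon, and the
  orders give an equivariant map from pairs of incomparable cells to a circle. For a cycle with two
  crossing chords, contracted to a tetrahedron, the pairs of disjoint cells form a cuboctahedron, a
  sphere on which the exchange of entries acts freely; no equivariant map from it to a circle
  exists. One cell of each antipodal pair is summed: three squares (opposite edges) and four
  triangles (a region and the opposite vertex). The oddness comes from
  \<open>u x y + u y x = 1\<close>. The obstacle is generality. Graphs may be disconnected and have
  loops, bridges and parallel edges, so faces need not be discs. Edge-face incidences are therefore
  read as chains modulo 2, in which an edge with the same face on both sides disappears. The
  delicate point of the dual is a face that touches several components, where a potential has to be
  normalized on each component separately.\<close>

declare add_bit_eq_xor [simp del] mult_bit_eq_and [simp del]

lemma bit_add_self [simp]: "x + x = (0 :: bit)"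
  by (cases x) auto

text \<open>Once \<open>ac_simps\<close> has sorted a sum of bits, this rule and
  \<open>bit_add_self\<close> delete equal summands in pairs; the long parity computations below end
  this way.\<close>

lemma bit_add_left_self [simp]: "x + (x + y) = (y :: bit)"
  by (simp flip: add.assoc)

lemma bit_add_eq_0_iff: "x + y = 0 \<longleftrightarrow> x = (y :: bit)"
  by (cases x; cases y) auto

lemma bit_add_eq_1_iff: "x + y = 1 \<longleftrightarrow> y = x + (1 :: bit)"
  by (cases x; cases y) auto

definition joins :: "('e \<Rightarrow> 'v set) \<Rightarrow> 'e set \<Rightarrow> 'v \<Rightarrow> 'v \<Rightarrow> bool" where
  "joins en A u v \<longleftrightarrow> (u, v) \<in> {(x, y). \<exists>e\<in>A. en e = {x, y}}\<^sup>*"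

lemma joins_refl [simp]: "joins en A u u"
  by (simp add: joins_def)

lemma joins_trans: "joins en A u v \<Longrightarrow> joins en A v w \<Longrightarrow> joins en A u w"
  unfolding joins_def by (rule rtrancl_trans)

lemma joins_edge: "e \<in> A \<Longrightarrow> en e = {x, y} \<Longrightarrow> joins en A x y"
  unfolding joins_def by (rule r_into_rtrancl) auto

text \<open>A simple path from \<open>u\<close> to the last argument; its edges and vertices are the two sets.\<close>

inductive spath :: "('e \<Rightarrow> 'v set) \<Rightarrow> 'e set \<Rightarrow> 'v \<Rightarrow> 'e set \<Rightarrow> 'v set \<Rightarrow> 'v \<Rightarrow> bool"
  for en A u where
  spath_Nil: "spath en A u {} {u} u"
| spath_Step: "spath en A u B U w \<Longrightarrow> e \<in> A \<Longrightarrow> en e = {w, w'} \<Longrightarrow> w' \<notin> U \<Longrightarrow>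
    spath en A u (insert e B) (insert w' U) w'"

lemma spath_facts:
  assumes "spath en A u B U w"
  shows "B \<subseteq> A" "u \<in> U" "w \<in> U" "finite B" "finite U" "\<forall>e\<in>B. en e \<subseteq> U" "B = {} \<longleftrightarrow> u = w"
proof -
  have "B \<subseteq> A \<and> u \<in> U \<and> w \<in> U \<and> finite B \<and> finite U \<and> (\<forall>e\<in>B. en e \<subseteq> U) \<and> (B = {} \<longleftrightarrow> u = w)"
    using assms by induction auto
  then show "B \<subseteq> A" "u \<in> U" "w \<in> U" "finite B" "finite U" "\<forall>e\<in>B. en e \<subseteq> U" "B = {} \<longleftrightarrow> u = w"
    by auto
qed

lemma spath_mono: "spath en A u B U w \<Longrightarrow> A \<subseteq> A' \<Longrightarrow> spath en A' u B U w"
  by (induction rule: spath.induct) (auto intro: spath.intros)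

lemma spath_prefix:
  assumes "spath en A u B U w" "x \<in> U"
  shows "\<exists>B' U'. spath en A u B' U' x"
  using assms
proof (induction arbitrary: x)
  case spath_Nil
  then show ?case using spath.spath_Nil by fastforce
next
  case (spath_Step B U w e w')
  then show ?case using spath.spath_Step by (metis insertE)
qed

text \<open>When the walk returns to a vertex of the path built so far, the path is cut back to that
  vertex by \<open>spath_prefix\<close>.\<close>

lemma joins_imp_spath: "joins en A u v \<Longrightarrow> \<exists>B U. spath en A u B U v"
  unfolding joins_def
proof (induction rule: rtrancl_induct)
  case base
  then show ?case using spath_Nil by fast
next
  case (step y z)
  then obtain B U e where "spath en A u B U y" "e \<in> A" "en e = {y, z}" by auto
  then show ?case
    using spath_prefix[of en A u B U y z] spath_Step[of en A u B U y e z] by blast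
qed

text \<open>A loop is the case \<open>u = w\<close> with \<open>B\<close> empty, two parallel edges
  the case of a singleton \<open>B\<close>, so short cycles are covered.\<close>

definition gcycle :: "('e \<Rightarrow> 'v set) \<Rightarrow> 'e set \<Rightarrow> 'e set \<Rightarrow> 'v set \<Rightarrow> bool" where
  "gcycle en A C U \<longleftrightarrow>
     (\<exists>e u w B. e \<in> A \<and> en e = {u, w} \<and> e \<notin> B \<and> spath en A u B U w \<and> C = insert e B)"

lemma gcycleI:
  assumes "e \<in> A" "en e = {u, w}" "e \<notin> B" "spath en A u B U w"
  shows "gcycle en A (insert e B) U"
  unfolding gcycle_def
  by (intro exI[of _ e] exI[of _ u] exI[of _ w] exI[of _ B] conjI refl assms)

lemma gcycleE:
  assumes "gcycle en A C U"
  obtains e u w B where "e \<in> A" "en e = {u, w}" "e \<notin> B" "spath en A u B U w" "C = insert e B"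
  using assms unfolding gcycle_def by blast

lemma gcycle_subset: "gcycle en A C U \<Longrightarrow> C \<subseteq> A"
  by (elim gcycleE) (auto dest: spath_facts(1))

lemma gcycle_nonempty: "gcycle en A C U \<Longrightarrow> C \<noteq> {}"
  unfolding gcycle_def by blast

lemma gcycle_ends: "gcycle en A C U \<Longrightarrow> e \<in> C \<Longrightarrow> en e \<subseteq> U"
  by (elim gcycleE) (auto dest: spath_facts(2,3,6))

lemma gcycle_mono:
  assumes "gcycle en A C U" "A \<subseteq> A'" shows "gcycle en A' C U"
proof -
  obtain e u w B where "e \<in> A" "en e = {u, w}" "e \<notin> B" "spath en A u B U w" "C = insert e B"
    using assms(1) by (rule gcycleE)
  then show ?thesis using gcycleI[of e A' en u w B U] spath_mono[of en A u B U w A'] assms(2) by auto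
qed

lemma joins_imp_gcycle:
  assumes "e \<in> A" "en e = {u, w}" "joins en (A - {e}) u w"
  shows "\<exists>C U. gcycle en A C U \<and> e \<in> C"
proof -
  obtain B U where "spath en (A - {e}) u B U w" using joins_imp_spath[OF assms(3)] by blast
  then have "spath en A u B U w" "e \<notin> B"
    using spath_mono[of en "A - {e}" u B U w A] spath_facts(1)[of en "A - {e}" u B U w] by auto
  then show ?thesis
    using gcycleI[of e A en u w B U] assms by auto
qed

lemma gcycle_vertex:
  assumes "gcycle en A C U" "v \<in> U" shows "\<exists>f\<in>C. v \<in> en f"
proof -
  obtain e u w B where e: "e \<in> A" "en e = {u, w}" "e \<notin> B" "spath en A u B U w" "C = insert e B"
    using assms(1) by (rule gcycleE)
  have "v = u \<or> (\<exists>f\<in>B. v \<in> en f)" using e(4) assms(2)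
    by induction auto
  then show ?thesis using e by auto
qed

text \<open>The ends form a set, so a loop has only one. Its two equal contributions would cancel
  modulo 2, hence the value 0. With sets of faces in place of sets of vertices the same definition
  serves the dual graph, where bridges take the place of loops.\<close>

definition cobd :: "('e \<Rightarrow> 'a set) \<Rightarrow> ('a \<Rightarrow> bit) \<Rightarrow> 'e \<Rightarrow> bit" where
  "cobd en g e = (if card (en e) = 2 then sum g (en e) else 0)"

lemma cobd_pair: "en e = {x, y} \<Longrightarrow> cobd en g e = g x + g y"
  by (cases "x = y"; cases "g y") (auto simp: cobd_def)

definition incid :: "('e \<Rightarrow> 'a set) \<Rightarrow> 'a \<Rightarrow> 'e \<Rightarrow> bit" where
  "incid en v e = of_bool (v \<in> en e \<and> card (en e) = 2)"

definition bd :: "'e set \<Rightarrow> ('e \<Rightarrow> 'a set) \<Rightarrow> ('e \<Rightarrow> bit) \<Rightarrow> 'a \<Rightarrow> bit" where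
  "bd E en c v = (\<Sum>e\<in>E. incid en v e * c e)"

lemma incid_pair: "en e = {x, y} \<Longrightarrow> incid en v e = of_bool (v = x) + of_bool (v = y)"
  by (cases "x = y") (auto simp: incid_def)

lemma cobd_incid:
  assumes "finite V" "en e \<subseteq> V"
  shows "cobd en g e = (\<Sum>v\<in>V. incid en v e * g v)"
proof -
  have "(\<Sum>v\<in>V. incid en v e * g v) = (\<Sum>v\<in>en e. incid en v e * g v)"
    by (rule sum.mono_neutral_right) (use assms in \<open>auto simp: incid_def\<close>)
  also have "\<dots> = cobd en g e"
    by (auto simp: incid_def cobd_def intro!: sum.neutral)
  finally show ?thesis by simp
qed

text \<open>Stokes' formula modulo 2: boundary and coboundary are built from the same incidence
  matrix, and the two sums may be exchanged.\<close>

lemma cobd_bd: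
  assumes "finite V" "\<And>e. e \<in> E \<Longrightarrow> en e \<subseteq> V"
  shows "(\<Sum>e\<in>E. c e * cobd en g e) = (\<Sum>v\<in>V. g v * bd E en c v)"
proof -
  have "(\<Sum>e\<in>E. c e * cobd en g e) = (\<Sum>e\<in>E. \<Sum>v\<in>V. c e * (incid en v e * g v))"
    using assms by (intro sum.cong) (auto simp: cobd_incid sum_distrib_left)
  also have "\<dots> = (\<Sum>v\<in>V. \<Sum>e\<in>E. c e * (incid en v e * g v))"
    by (rule sum.swap)
  also have "\<dots> = (\<Sum>v\<in>V. g v * bd E en c v)"
    unfolding bd_def by (intro sum.cong) (auto simp: sum_distrib_left mult_ac)
  finally show ?thesis .
qed

lemma bd_add: "bd E en (\<lambda>e. c e + c' e) v = bd E en c v + bd E en c' v"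
  by (simp add: bd_def distrib_left sum.distrib)

lemma cobd_add: "cobd en (\<lambda>x. g x + g' x) e = cobd en g e + cobd en g' e"
  by (simp add: cobd_def sum.distrib)

lemma cobd_const: "cobd en (\<lambda>x. k) e = 0"
  by (simp add: cobd_def)

lemma bd_cong: "(\<And>e. e \<in> E \<Longrightarrow> c e = c' e) \<Longrightarrow> bd E en c v = bd E en c' v"
  unfolding bd_def by (intro sum.cong) auto

lemma bd_single:
  assumes "finite E" "e \<in> E" shows "bd E en (\<lambda>f. of_bool (f = e)) v = incid en v e"
proof -
  have "bd E en (\<lambda>f. of_bool (f = e)) v = (\<Sum>f\<in>E. if f = e then incid en v e else 0)"
    unfolding bd_def by (intro sum.cong) auto
  then show ?thesis using assms by simp
qed

lemma bd_spath:
  assumes "spath en E u B U w" "finite E"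
  shows "bd E en (\<lambda>e. of_bool (e \<in> B)) v = of_bool (v = u) + of_bool (v = w)"
  using assms(1)
proof induction
  case spath_Nil
  then show ?case by (simp add: bd_def)
next
  case (spath_Step B U w e w')
  have "e \<notin> B" using spath_facts(6)[OF spath_Step.hyps(1)] spath_Step.hyps by auto
  then have "(\<lambda>f. of_bool (f \<in> insert e B) :: bit) = (\<lambda>f. of_bool (f = e) + of_bool (f \<in> B))"
    by auto
  then have "bd E en (\<lambda>f. of_bool (f \<in> insert e B)) v = incid en v e + (of_bool (v = u) + of_bool (v = w))"
    using spath_Step by (simp add: bd_add bd_single[OF assms(2)])
  then show ?case by (simp add: incid_pair[of en e w w', OF spath_Step.hyps(3)] ac_simps)
qed

lemma bd_gcycle:
  assumes "gcycle en E C U" "finite E"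
  shows "bd E en (\<lambda>e. of_bool (e \<in> C)) v = 0"
proof -
  obtain e u w B where e: "e \<in> E" "en e = {u, w}" "e \<notin> B" "spath en E u B U w" "C = insert e B"
    using assms(1) by (rule gcycleE)
  have "(\<lambda>f. of_bool (f \<in> C) :: bit) = (\<lambda>f. of_bool (f = e) + of_bool (f \<in> B))"
    using e(3,5) by auto
  then show ?thesis
    by (simp add: bd_add bd_single[OF assms(2) e(1)] bd_spath[OF e(4) assms(2)]
        incid_pair[of en e u w, OF e(2)] ac_simps)
qed

section \<open>Faces of a plane drawing\<close>

locale plane_map =
  fixes M :: "('v, 'e) map"
  assumes planar: "planar_map M"
begin

abbreviation "V \<equiv> verts (fst M)"
abbreviation "E \<equiv> edges (fst M)"
abbreviation "en \<equiv> ends (fst M)"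
abbreviation "pt \<equiv> point (snd M)"
abbreviation "cur \<equiv> curve (snd M)"
abbreviation "img e \<equiv> path_image (curve (snd M) e)"

text \<open>All vertices stay when edges are deleted, so deleting an edge removes exactly its
  \<open>open_edge\<close> from the drawing.\<close>

definition drawn :: "'e set \<Rightarrow> complex set" where
  "drawn A = pt ` V \<union> (\<Union>e\<in>A. img e)"

definition open_edge :: "'e \<Rightarrow> complex set" where
  "open_edge e = img e - pt ` V"

lemma finV: "finite V" and finE: "finite E"
  using planar by (auto simp: planar_map_def finite_multigraph_def)

lemma en_sub: "e \<in> E \<Longrightarrow> en e \<subseteq> V"
  using planar by (auto simp: planar_map_def finite_multigraph_def)

lemma en_card: "e \<in> E \<Longrightarrow> card (en e) = 1 \<or> card (en e) = 2"
  using planar by (auto simp: planar_map_def finite_multigraph_def)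

lemma en_cases:
  assumes "e \<in> E" obtains u w where "en e = {u, w}"
  using en_card[OF assms] by (metis card_1_singletonE card_2_iff insert_absorb2)

lemma inj_pt: "inj_on pt V"
  using planar by (auto simp: planar_map_def plane_drawing_def)

lemma simple_path_cur: "e \<in> E \<Longrightarrow> simple_path (cur e)"
  using planar by (auto simp: planar_map_def plane_drawing_def)

lemma img_ends: "e \<in> E \<Longrightarrow> {pathstart (cur e), pathfinish (cur e)} = pt ` en e"
  using planar by (auto simp: planar_map_def plane_drawing_def)

lemma img_V: "e \<in> E \<Longrightarrow> img e \<inter> pt ` V = pt ` en e"
  using planar by (auto simp: planar_map_def plane_drawing_def)

lemma img_int: "e \<in> E \<Longrightarrow> f \<in> E \<Longrightarrow> e \<noteq> f \<Longrightarrow> img e \<inter> img f \<subseteq> pt ` V"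
  using planar by (auto simp: planar_map_def plane_drawing_def)

lemma img_eq: "e \<in> E \<Longrightarrow> img e = open_edge e \<union> pt ` en e"
  using img_V unfolding open_edge_def by blast

lemma open_edge_eq: "e \<in> E \<Longrightarrow> open_edge e = img e - {pathstart (cur e), pathfinish (cur e)}"
proof -
  assume e: "e \<in> E"
  have "img e - pt ` V = img e - (img e \<inter> pt ` V)" by blast
  then show ?thesis unfolding open_edge_def img_V[OF e] img_ends[OF e] .
qed

lemma open_edge_image:
  assumes "e \<in> E" shows "open_edge e = cur e ` {0<..<1}"
proof -
  have "cur e t \<noteq> cur e 0" "cur e t \<noteq> cur e 1" if "0 < t" "t < 1" for t
    using simple_path_cur[OF assms] that unfolding simple_path_def loop_free_def by force+
  then show ?thesis
    unfolding open_edge_eq[OF assms] path_image_def pathstart_def pathfinish_def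
    by (force simp: less_eq_real_def)
qed

lemma connected_open_edge: "e \<in> E \<Longrightarrow> connected (open_edge e)"
  unfolding open_edge_image
  by (metis connected_continuous_image connected_Ioo continuous_on_subset
      greaterThanLessThan_subseteq_atLeastAtMost_iff order_refl path_def simple_path_imp_path simple_path_cur zero_le_one)

lemma open_edge_nonempty: "e \<in> E \<Longrightarrow> open_edge e \<noteq> {}"
  by (simp add: open_edge_image)

lemma img_closure_open_edge:
  assumes "e \<in> E" shows "img e \<subseteq> closure (open_edge e)"
proof -
  have "continuous_on {0..1} (cur e)" using simple_path_cur[OF assms] by (simp add: simple_path_def path_def)
  then have "cur e ` closure {0<..<1} \<subseteq> closure (cur e ` {0<..<1})"
    by (intro continuous_image_closure_subset) (auto simp: closure_greaterThanLessThan)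
  then show ?thesis by (simp add: open_edge_image[OF assms] path_image_def)
qed

lemma compact_img: "e \<in> E \<Longrightarrow> compact (img e)"
  by (simp add: compact_simple_path_image simple_path_cur)

lemma connected_img: "e \<in> E \<Longrightarrow> connected (img e)"
  by (simp add: connected_simple_path_image simple_path_cur)

lemma compact_drawn: "A \<subseteq> E \<Longrightarrow> compact (drawn A)"
  unfolding drawn_def using finV finite_subset[OF _ finE]
  by (intro compact_Un compact_UN) (auto simp: compact_img subset_iff intro: finite_imp_compact)

lemma closed_drawn: "A \<subseteq> E \<Longrightarrow> closed (drawn A)"
  by (simp add: compact_drawn compact_imp_closed)

lemma skeleton_eq: "skeleton M = drawn E"
  by (simp add: skeleton_def drawn_def)

lemma drawn_insert: "drawn (insert e A) = drawn A \<union> img e"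
  by (auto simp: drawn_def)

lemma drawn_mono: "A \<subseteq> B \<Longrightarrow> drawn A \<subseteq> drawn B"
  by (auto simp: drawn_def)

lemma drawn_remove: "e \<in> E \<Longrightarrow> drawn E = drawn (E - {e}) \<union> open_edge e"
  using img_eq[of e] en_sub[of e] unfolding drawn_def open_edge_def by blast

lemma drawn_Int_img: "A \<subseteq> E \<Longrightarrow> e \<in> E \<Longrightarrow> e \<notin> A \<Longrightarrow> drawn A \<inter> img e = pt ` en e"
proof -
  assume *: "A \<subseteq> E" "e \<in> E" "e \<notin> A"
  have "img f \<inter> img e \<subseteq> pt ` en e" if "f \<in> A" for f
    using img_int[of f e] img_V[of e] that * by blast
  then show ?thesis
    using img_V[of e] * unfolding drawn_def by blast
qed

lemma open_edge_drawn_disjoint: "A \<subseteq> E \<Longrightarrow> e \<in> E \<Longrightarrow> e \<notin> A \<Longrightarrow> open_edge e \<inter> drawn A = {}"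
  using drawn_Int_img[of A e] en_sub[of e] unfolding open_edge_def by blast

section \<open>Paths and cycles as arcs and closed curves\<close>

lemma edge_arc:
  assumes "e \<in> E" "en e = {w, w'}" "w \<noteq> w'"
  shows "\<exists>g. arc g \<and> pathstart g = pt w \<and> pathfinish g = pt w' \<and> path_image g = img e"
proof -
  have ww: "w \<in> V" "w' \<in> V" using assms en_sub by auto
  then have "pt w \<noteq> pt w'" using inj_pt assms(3) by (auto dest: inj_onD)
  then consider "pathstart (cur e) = pt w" "pathfinish (cur e) = pt w'"
    | "pathstart (cur e) = pt w'" "pathfinish (cur e) = pt w"
    using img_ends[OF assms(1)] assms(2) by (auto simp: doubleton_eq_iff)
  then show ?thesis
  proof cases
    case 1
    then have "arc (cur e)" using simple_path_cur[OF assms(1)] \<open>pt w \<noteq> pt w'\<close> by (simp add: arc_simple_path)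
    then show ?thesis using 1 by blast
  next
    case 2
    then have "arc (reversepath (cur e))" using simple_path_cur[OF assms(1)] \<open>pt w \<noteq> pt w'\<close>
      by (simp add: arc_simple_path simple_path_reversepath)
    then show ?thesis using 2 by (metis path_image_reversepath pathfinish_reversepath pathstart_reversepath)
  qed
qed

lemma spath_img_V:
  assumes "spath en E u B U w" shows "(\<Union>e\<in>B. img e) \<inter> pt ` V \<subseteq> pt ` U"
proof -
  have "img e \<inter> pt ` V \<subseteq> pt ` U" if "e \<in> B" for e
    using spath_facts(1,6)[OF assms] that img_V[of e] by (auto simp: subset_iff)
  then show ?thesis by blast
qed

lemma spath_V:
  assumes "spath en E u B U w" "u \<in> V" shows "U \<subseteq> V"
  using assms by (induction) (use en_sub in auto)

lemma spath_arc:
  assumes "spath en E u B U w" "u \<in> V" "u \<noteq> w"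
  shows "\<exists>g. arc g \<and> pathstart g = pt u \<and> pathfinish g = pt w \<and> path_image g = (\<Union>e\<in>B. img e)"
  using assms
proof (induction)
  case (spath_Step B U w e w')
  note f = spath_facts[OF spath_Step.hyps(1)]
  have "w \<noteq> w'" using f spath_Step by blast
  obtain h where h: "arc h" "pathstart h = pt w" "pathfinish h = pt w'" "path_image h = img e"
    using edge_arc[OF spath_Step.hyps(2,3) \<open>w \<noteq> w'\<close>] by blast
  show ?case
  proof (cases "u = w")
    case True
    then have "B = {}" using f by simp
    then show ?thesis using h True by auto
  next
    case False
    then obtain g where g: "arc g" "pathstart g = pt u" "pathfinish g = pt w"
      "path_image g = (\<Union>e\<in>B. img e)" using spath_Step by blast
    have UV: "U \<subseteq> V" using spath_V[OF spath_Step.hyps(1)] spath_Step.prems by blast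
    have eV: "w' \<in> V" using en_sub spath_Step.hyps by blast
    have "e \<notin> B" using f spath_Step.hyps by blast
    have "pt w' \<notin> path_image g"
    proof
      assume "pt w' \<in> path_image g"
      then have "pt w' \<in> pt ` U" using spath_img_V[OF spath_Step.hyps(1)] eV g by blast
      then show False using UV eV inj_pt spath_Step.hyps(4) by (metis inj_on_image_mem_iff)
    qed
    moreover have "path_image g \<inter> path_image h \<subseteq> pt ` {w, w'}"
    proof -
      have "path_image g \<subseteq> drawn (E - {e})" using f \<open>e \<notin> B\<close> unfolding g drawn_def by blast
      then show ?thesis using drawn_Int_img[of "E - {e}" e] spath_Step.hyps unfolding h by auto
    qed
    ultimately have "path_image g \<inter> path_image h \<subseteq> {pathstart h}" using h by auto
    then have "arc (g +++ h)" using g h by (simp add: arc_join)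
    moreover have "path_image (g +++ h) = (\<Union>e\<in>insert e B. img e)"
      using g h by (auto simp: path_image_join)
    ultimately show ?thesis using g h by (metis pathfinish_join pathstart_join)
  qed
qed simp

lemma gcycle_V: "gcycle en E C U \<Longrightarrow> U \<subseteq> V"
proof -
  assume "gcycle en E C U"
  then obtain e u w B where e: "e \<in> E" "en e = {u, w}" "e \<notin> B" "spath en E u B U w" "C = insert e B"
    by (rule gcycleE)
  then show "U \<subseteq> V" using spath_V[OF e(4)] en_sub[OF e(1)] by auto
qed

text \<open>A loop is already a closed curve. Otherwise the path is an arc that meets the closing
  edge exactly in its two ends, since distinct edges meet only in vertices.\<close>

lemma cycle_curve:
  assumes "gcycle en E C U"
  shows "\<exists>J. simple_path J \<and> pathfinish J = pathstart J \<and> path_image J = (\<Union>e\<in>C. img e)"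
proof -
  obtain e u w B where e: "e \<in> E" "en e = {u, w}" "e \<notin> B" "spath en E u B U w" "C = insert e B"
    using assms(1) by (rule gcycleE)
  note f = spath_facts[OF e(4)]
  show ?thesis
  proof (cases "u = w")
    case True
    then have "pathfinish (cur e) = pathstart (cur e)" using img_ends[OF e(1)] e(2) by auto
    then show ?thesis using True e f simple_path_cur[OF e(1)] by auto
  next
    case False
    have "u \<in> V" using e en_sub by blast
    then obtain g where g: "arc g" "pathstart g = pt u" "pathfinish g = pt w"
      "path_image g = (\<Union>e\<in>B. img e)" using spath_arc[OF e(4)] False by blast
    obtain h where h: "arc h" "pathstart h = pt w" "pathfinish h = pt u" "path_image h = img e"
      using edge_arc[OF e(1), of w u] e(2) False by (metis insert_commute)
    have "path_image g \<subseteq> drawn (E - {e})" using f e unfolding g drawn_def by blast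
    then have "path_image g \<inter> path_image h \<subseteq> {pathstart g, pathstart h}"
      using drawn_Int_img[of "E - {e}" e] e unfolding h g by auto
    then have "simple_path (g +++ h)" using g h by (simp add: simple_path_join_loop)
    moreover have "path_image (g +++ h) = (\<Union>e\<in>C. img e)"
      using g h e by (auto simp: path_image_join)
    ultimately show ?thesis using g h by (metis pathfinish_join pathstart_join)
  qed
qed

text \<open>Unlike in \<open>drawn\<close>, only chosen vertices are included, so that a path, or a
  cycle minus an edge, has a connected image.\<close>

definition subdrawing :: "'e set \<Rightarrow> 'v set \<Rightarrow> complex set" where
  "subdrawing A U = pt ` U \<union> (\<Union>e\<in>A. img e)"

lemma pt_end_img: "e \<in> E \<Longrightarrow> v \<in> en e \<Longrightarrow> pt v \<in> img e"
  using img_V by blast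

lemma connected_subdrawing_insert:
  assumes "connected (subdrawing A U)" "w \<in> U" "w \<in> en e" "e \<in> E" "en e = {w, w'}"
  shows "connected (subdrawing (insert e A) (insert w' U))"
proof -
  have "subdrawing (insert e A) (insert w' U) = subdrawing A U \<union> img e"
    using pt_end_img[OF assms(4), of w'] assms unfolding subdrawing_def by auto
  moreover have "pt w \<in> subdrawing A U \<inter> img e"
    using assms pt_end_img unfolding subdrawing_def by blast
  ultimately show ?thesis
    using connected_Un[OF assms(1) connected_img[OF assms(4)]] by auto
qed

lemma connected_spath: "spath en E u B U w \<Longrightarrow> connected (subdrawing B U)"
proof (induction rule: spath.induct)
  case spath_Nil
  then show ?case by (simp add: subdrawing_def)
next
  case (spath_Step B U w e w')
  then show ?case using connected_subdrawing_insert spath_facts(3)[OF spath_Step.hyps(1)] by blast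
qed

lemma spath_split:
  assumes "spath en E u B U w" "f \<in> B"
  shows "\<exists>A1 U1 A2 U2. connected (subdrawing A1 U1) \<and> connected (subdrawing A2 U2) \<and> u \<in> U1 \<and> w \<in> U2 \<and>
     U1 \<union> U2 = U \<and> A1 \<union> A2 = B - {f}"
  using assms
proof (induction)
  case (spath_Step B U w e w')
  note f = spath_facts[OF spath_Step.hyps(1)]
  have eB: "e \<notin> B" using f spath_Step.hyps by blast
  show ?case
  proof (cases "f = e")
    case True
    have "connected (subdrawing B U)" "connected (subdrawing {} {w'})"
      using connected_spath[OF spath_Step.hyps(1)] by (auto simp: subdrawing_def)
    then show ?thesis using True eB f(2) by (intro exI[of _ B] exI[of _ U] exI[of _ "{}"] exI[of _ "{w'}"]) auto
  next
    case False
    then obtain A1 U1 A2 U2 where *: "connected (subdrawing A1 U1)" "connected (subdrawing A2 U2)" "u \<in> U1" "w \<in> U2"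
      "U1 \<union> U2 = U" "A1 \<union> A2 = B - {f}" using spath_Step by blast
    have "connected (subdrawing (insert e A2) (insert w' U2))"
      using connected_subdrawing_insert * spath_Step.hyps by blast
    moreover have "U1 \<union> insert w' U2 = insert w' U" using *(5) by auto
    moreover have "A1 \<union> insert e A2 = insert e B - {f}" using *(6) False by auto
    ultimately show ?thesis using *(1,3)
      by (intro exI[of _ A1] exI[of _ U1] exI[of _ "insert e A2"] exI[of _ "insert w' U2"] conjI) simp_all
  qed
qed simp

text \<open>Deleting the closing edge leaves the path. Deleting another edge splits the path into
  two connected pieces (\<open>spath_split\<close>), which the closing edge links. Janiszewski's
  theorem asks for this connected intersection in \<open>cycle_face_unique\<close>.\<close>

lemma cycle_minus_connected:
  assumes "gcycle en E C U" "f \<in> C"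
  shows "connected (subdrawing (C - {f}) U)"
proof -
  obtain e u w B where e: "e \<in> E" "en e = {u, w}" "e \<notin> B" "spath en E u B U w" "C = insert e B"
    using assms(1) by (rule gcycleE)
  note f = spath_facts[OF e(4)]
  show ?thesis
  proof (cases "f = e")
    case True
    then have "C - {f} = B" using e(3,5) by auto
    then show ?thesis using connected_spath[OF e(4)] by simp
  next
    case False
    then have "f \<in> B" using e(5) assms(2) by simp
    from spath_split[OF e(4) this]
    obtain A1 U1 A2 U2 where *: "connected (subdrawing A1 U1)" "connected (subdrawing A2 U2)" "u \<in> U1" "w \<in> U2"
      "U1 \<union> U2 = U" "A1 \<union> A2 = B - {f}" by (elim exE conjE)
    have 1: "connected (subdrawing (insert e A2) (insert u U2))"
      using connected_subdrawing_insert[OF *(2) *(4), of e u] e(1,2) by (simp add: insert_commute)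
    have "subdrawing A1 U1 \<inter> subdrawing (insert e A2) (insert u U2) \<noteq> {}"
      using *(3) unfolding subdrawing_def by auto
    from connected_Un[OF *(1) 1 this]
    have "connected (subdrawing (insert e (A1 \<union> A2)) (insert u (U1 \<union> U2)))"
      unfolding subdrawing_def by (simp add: Un_ac image_Un)
    moreover have "insert e (A1 \<union> A2) = C - {f}" "insert u (U1 \<union> U2) = U"
      unfolding *(5,6) e(5) using False f(2) by auto
    ultimately show ?thesis by simp
  qed
qed

section \<open>Faces and the edges on their frontier\<close>

lemma face_props:
  assumes "F \<in> faces M"
  shows "open F" "connected F" "F \<noteq> {}" "F \<inter> drawn E = {}" "frontier F \<subseteq> drawn E"
proof -
  have c: "closed (drawn E)" by (simp add: closed_drawn)
  have F: "F \<in> components (- drawn E)" using assms by (simp add: faces_def skeleton_eq)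
  show "open F" using F c open_components by blast
  show "connected F" using F in_components_connected by blast
  show "F \<noteq> {}" using F in_components_nonempty by blast
  show "F \<inter> drawn E = {}" using F in_components_subset by blast
  show "frontier F \<subseteq> drawn E" using frontier_of_components_closed_complement[OF c F] .
qed

lemma face_maximal:
  assumes "F \<in> faces M" "connected T" "T \<inter> drawn E = {}" "T \<inter> F \<noteq> {}" shows "T \<subseteq> F"
proof -
  have "F \<in> components (- drawn E)" using assms by (simp add: faces_def skeleton_eq)
  then show ?thesis using components_maximal[of F "- drawn E" T] assms by blast
qed

lemma face_exists: "x \<notin> drawn E \<Longrightarrow> \<exists>F\<in>faces M. x \<in> F"
  by (metis (no_types, lifting) Compl_iff UnionE Union_components faces_def skeleton_eq)

lemma face_eqI:
  assumes "F \<in> faces M" "F' \<in> faces M" "x \<in> F" "y \<in> F'" "connected_component (- drawn E) x y"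
  shows "F = F'"
proof -
  obtain T where T: "connected T" "T \<subseteq> - drawn E" "x \<in> T" "y \<in> T"
    using assms(5) unfolding connected_component_def by blast
  have "T \<subseteq> F" using face_maximal[OF assms(1) T(1)] T assms(3) by blast
  then have "F' \<inter> F \<noteq> {}" using T assms by blast
  then show ?thesis
    using face_maximal[OF assms(1), of F'] face_maximal[OF assms(2), of F]
      face_props(2,4)[OF assms(1)] face_props(2,4)[OF assms(2)] by blast
qed

text \<open>The face through which \<open>e\<close> runs in the drawing without \<open>e\<close>.
  The faces of \<open>M\<close> contained in it turn out to be exactly those with \<open>e\<close>
  on their boundary. The base point only has to lie on the open edge, which is connected and misses
  the rest of the drawing.\<close>

definition edge_region :: "'e \<Rightarrow> complex set" where
  "edge_region e = connected_component_set (- drawn (E - {e})) (SOME p. p \<in> open_edge e)"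

lemma edge_region_props:
  assumes "e \<in> E"
  shows "open (edge_region e)" "connected (edge_region e)" "open_edge e \<subseteq> edge_region e" "edge_region e \<inter> drawn (E - {e}) = {}"
    "\<And>T. connected T \<Longrightarrow> T \<inter> drawn (E - {e}) = {} \<Longrightarrow> T \<inter> edge_region e \<noteq> {} \<Longrightarrow> T \<subseteq> edge_region e"
    "\<And>x y. x \<in> edge_region e \<Longrightarrow> y \<in> edge_region e \<Longrightarrow> connected_component (- drawn (E - {e})) x y"
proof -
  define p where "p = (SOME p. p \<in> open_edge e)"
  have p: "p \<in> open_edge e" unfolding p_def using open_edge_nonempty[OF assms] by (simp add: some_in_eq)
  have U: "edge_region e = connected_component_set (- drawn (E - {e})) p" by (simp add: edge_region_def p_def)
  have dis: "open_edge e \<subseteq> - drawn (E - {e})" using open_edge_drawn_disjoint[of "E - {e}" e] assms by blast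
  show "open (edge_region e)" unfolding U by (simp add: open_connected_component closed_drawn open_Compl)
  show "connected (edge_region e)" unfolding U by simp
  show "open_edge e \<subseteq> edge_region e" unfolding U
    using connected_component_maximal[OF p connected_open_edge[OF assms] dis] .
  show "edge_region e \<inter> drawn (E - {e}) = {}" unfolding U using connected_component_subset by fastforce
  show "x \<in> edge_region e \<Longrightarrow> y \<in> edge_region e \<Longrightarrow> connected_component (- drawn (E - {e})) x y" for x y
    unfolding U by (metis connected_component_sym connected_component_trans mem_Collect_eq)
  show "T \<subseteq> edge_region e" if T: "connected T" "T \<inter> drawn (E - {e}) = {}" "T \<inter> edge_region e \<noteq> {}" for T
  proof -
    obtain z where z: "z \<in> T" "z \<in> edge_region e" using T(3) by blast
    have "edge_region e = connected_component_set (- drawn (E - {e})) z"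
      unfolding U using connected_component_eq[OF z(2)[unfolded U]] by (rule sym)
    moreover have "T \<subseteq> - drawn (E - {e})" using T(2) by blast
    ultimately show ?thesis using connected_component_maximal[OF z(1) T(1)] by simp
  qed
qed

lemma cur_inj:
  assumes "e \<in> E" "a \<in> {0..1}" "b \<in> {0..1}" "cur e a = cur e b"
  shows "a = b \<or> a = 0 \<and> b = 1 \<or> a = 1 \<and> b = 0"
  using simple_path_cur[OF assms(1)] assms(2-4) unfolding simple_path_def loop_free_def by blast

text \<open>The region also contains points of \<open>e\<close>, which lie outside \<open>F\<close>.
  Being connected, it meets the frontier of \<open>F\<close>, and the open edge is the only part of
  the drawing inside the region.\<close>

lemma face_meets_edge_region:
  assumes "F \<in> faces M" "e \<in> E" "F \<inter> edge_region e \<noteq> {}"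
  shows "F \<subseteq> edge_region e" "closure F \<inter> open_edge e \<noteq> {}"
proof -
  note F = face_props[OF assms(1)] and U = edge_region_props[OF assms(2)]
  have "F \<inter> drawn (E - {e}) = {}" using F(4) drawn_mono[of "E - {e}" E] by blast
  then show FU: "F \<subseteq> edge_region e" using U(5) F assms(3) by blast
  have "\<not> edge_region e \<subseteq> F" using U(3) open_edge_nonempty[OF assms(2)] F(4) drawn_remove[OF assms(2)] by blast
  then have "edge_region e \<inter> frontier F \<noteq> {}" using connected_Int_frontier[OF U(2)] assms(3) by blast
  then show "closure F \<inter> open_edge e \<noteq> {}"
    using F(5) drawn_remove[OF assms(2)] U(4) unfolding frontier_def by blast
qed

text \<open>Otherwise part of the edge can be removed without touching the closure of \<open>F\<close>; what remains is two
  hairs, which separate nothing by Janiszewski's theorem.\<close>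

lemma edge_frontier:
  assumes "F \<in> faces M" "e \<in> E" "closure F \<inter> open_edge e \<noteq> {}"
  shows "img e \<subseteq> frontier F" "F \<subseteq> edge_region e"
proof -
  note F = face_props[OF assms(1)] and U = edge_region_props[OF assms(2)]
  let ?X = "drawn (E - {e})" and ?c = "cur e"
  have XE: "drawn E = ?X \<union> open_edge e" using drawn_remove[OF assms(2)] .
  have meets: "F \<inter> edge_region e \<noteq> {}"
    using assms(3) U(1,3) open_Int_closure_eq_empty[of "edge_region e" F] by blast
  show "F \<subseteq> edge_region e" using face_meets_edge_region(1)[OF assms(1,2) meets] .
  obtain x where x: "x \<in> F" "x \<in> edge_region e" using meets by blast
  have sub: "open_edge e \<subseteq> closure F"
  proof (rule ccontr)
    assume "\<not> open_edge e \<subseteq> closure F"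
    then obtain z0 where "z0 \<in> ?c ` {0<..<1}" "z0 \<notin> closure F"
      unfolding open_edge_image[OF assms(2)] by blast
    then obtain t0 where t0: "0 < t0" "t0 < 1" "?c t0 \<notin> closure F" by force
    have cont: "continuous_on {0..1} ?c" using simple_path_cur[OF assms(2)] by (simp add: simple_path_def path_def)
    have "open (- closure F)" by (simp add: open_Compl)
    obtain d where d: "d > 0"
      "\<And>t. t \<in> {0..1} \<Longrightarrow> \<bar>t - t0\<bar> < d \<Longrightarrow> ?c t \<in> - closure F"
    proof -
      obtain r where r: "r > 0" "ball (?c t0) r \<subseteq> - closure F"
        using \<open>open (- closure F)\<close> t0(3) unfolding open_contains_ball by blast
      obtain d where "d > 0" "\<And>t. t \<in> {0..1} \<Longrightarrow> dist t t0 < d \<Longrightarrow> dist (?c t) (?c t0) < r"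
        using cont t0 r(1) unfolding continuous_on_iff
        by (metis atLeastAtMost_iff less_eq_real_def)
      then show ?thesis using r that by (auto simp: dist_real_def subset_iff dist_commute)
    qed
    \<comment> \<open>Halving each bound keeps \<open>s\<close> and \<open>t\<close> strictly inside
      the unit interval and closer than \<open>d\<close> to \<open>t0\<close>, so the curve between
      them misses \<open>closure F\<close>.\<close>
    define \<delta> where "\<delta> = min (d/2) (min (t0/2) ((1-t0)/2))"
    define s where "s = t0 - \<delta>"
    define t where "t = t0 + \<delta>"
    have st: "0 < s" "s < t0" "t0 < t" "t < 1" and dist: "\<bar>s - t0\<bar> < d" "\<bar>t - t0\<bar> < d"
      using t0 d(1) by (auto simp: s_def t_def \<delta>_def min_def field_simps)
    have mid: "?c r \<notin> closure F" if "s \<le> r" "r \<le> t" for r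
      using d(2)[of r] that st dist by auto
    let ?e1 = "path_image (subpath 0 s ?c)" and ?e2 = "path_image (subpath t 1 ?c)"
    have e1: "?e1 = ?c ` {0..s}" and e2: "?e2 = ?c ` {t..1}"
      using st by (simp_all add: path_image_subpath)
    have a1: "arc (subpath 0 s ?c)"
      by (rule arc_simple_path_subpath) (use simple_path_cur[OF assms(2)] st cur_inj[OF assms(2), of 0 s] in auto)
    have a2: "arc (subpath t 1 ?c)"
      by (rule arc_simple_path_subpath) (use simple_path_cur[OF assms(2)] st cur_inj[OF assms(2), of t 1] in auto)
    have q: "?c t0 \<in> open_edge e" using t0 open_edge_image[OF assms(2)] by auto
    have "?c t0 \<noteq> ?c r" if "r \<in> {0..s} \<or> r \<in> {t..1}" for r
      using cur_inj[OF assms(2), of t0 r] that st by auto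
    then have q12: "?c t0 \<notin> ?e1" "?c t0 \<notin> ?e2" unfolding e1 e2 by blast+
    have ie: "img e = ?c ` {0..1}" by (simp add: path_image_def)
    have img: "?e1 \<subseteq> img e" "?e2 \<subseteq> img e" unfolding e1 e2 ie using st by (auto intro!: image_mono)
    have x12: "x \<notin> ?e1" "x \<notin> ?e2"
      using x(1) F(4) img assms(2) unfolding drawn_def by blast+
    have Xe: "?X \<inter> img e = {?c 0, ?c 1}"
      using drawn_Int_img[of "E - {e}" e] img_ends[OF assms(2)] assms(2)
      by (auto simp: pathstart_def pathfinish_def)
    \<comment> \<open>Only for a loop do the end points of the curve coincide; \<open>c1\<close> and
      \<open>c0\<close> say that otherwise each remaining piece contains just its own end
      point.\<close>
    have c1: "?c 1 = ?c 0" if h: "?c 1 \<in> ?e1"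
    proof -
      obtain r where "r \<in> {0..s}" "?c 1 = ?c r" using h unfolding e1 by blast
      then show ?thesis using st cur_inj[OF assms(2), of 1 r] by auto
    qed
    have c0: "?c 0 = ?c 1" if h: "?c 0 \<in> ?e2"
    proof -
      obtain r where "r \<in> {t..1}" "?c 0 = ?c r" using h unfolding e2 by blast
      then show ?thesis using st cur_inj[OF assms(2), of 0 r] by auto
    qed
    have in1: "?c 0 \<in> ?e1" "?c 1 \<in> ?e2" unfolding e1 e2 using st by auto
    have e12: "?e2 \<inter> ?e1 \<subseteq> {?c 1}"
    proof
      fix z assume "z \<in> ?e2 \<inter> ?e1"
      then obtain a b where "a \<in> {0..s}" "b \<in> {t..1}" "z = ?c a" "z = ?c b"
        unfolding e1 e2 by auto
      then show "z \<in> {?c 1}" using cur_inj[OF assms(2), of a b] st by auto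
    qed
    have I1: "?e1 \<inter> ?X = {?c 0}"
    proof
      show "?e1 \<inter> ?X \<subseteq> {?c 0}"
      proof
        fix z assume z: "z \<in> ?e1 \<inter> ?X"
        then have "z \<in> {?c 0, ?c 1}" using Xe img by blast
        then show "z \<in> {?c 0}" using c1 z by auto
      qed
      show "{?c 0} \<subseteq> ?e1 \<inter> ?X" using in1(1) Xe by blast
    qed
    have I2: "?e2 \<inter> (?e1 \<union> ?X) = {?c 1}"
    proof
      show "?e2 \<inter> (?e1 \<union> ?X) \<subseteq> {?c 1}"
      proof
        fix z assume z: "z \<in> ?e2 \<inter> (?e1 \<union> ?X)"
        show "z \<in> {?c 1}"
        proof (cases "z \<in> ?e1")
          case True
          then show ?thesis using z e12 by blast
        next
          case False
          then have "z \<in> {?c 0, ?c 1}" using Xe img z by blast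
          then show ?thesis using c0 z by auto
        qed
      qed
      show "{?c 1} \<subseteq> ?e2 \<inter> (?e1 \<union> ?X)" using in1(2) Xe by blast
    qed
    have n1: "connected (- ?e1)" "connected (- ?e2)"
      using connected_arc_complement[OF a1] connected_arc_complement[OF a2] by simp_all
    \<comment> \<open>Without \<open>e\<close> the two points are joined. The hairs are put back one
      at a time, each meeting what is already present in a single point.\<close>
    have k0: "connected_component (- ?X) x (?c t0)" using U(6) x(2) q U(3) by blast
    have "connected_component (- (?e1 \<union> ?X)) x (?c t0)"
    proof (rule Janiszewski)
      show "compact ?e1" using a1 by (simp add: compact_arc_image)
      show "connected_component (- ?e1) x (?c t0)"
        using n1(1) q12(1) x12(1) unfolding connected_component_def by blast
    qed (use k0 closed_drawn I1 in auto)
    then have "connected_component (- (?e2 \<union> (?e1 \<union> ?X))) x (?c t0)"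
    proof (rule Janiszewski[rotated 4])
      show "compact ?e2" using a2 by (simp add: compact_arc_image)
      show "closed (?e1 \<union> ?X)" using closed_arc_image[OF a1] closed_drawn by blast
      show "connected_component (- ?e2) x (?c t0)"
        using n1(2) q12(2) x12(2) unfolding connected_component_def by blast
      show "connected (?e2 \<inter> (?e1 \<union> ?X))" by (simp add: I2)
    qed
    then obtain T where T: "connected T" "T \<subseteq> - (?e2 \<union> (?e1 \<union> ?X))" "x \<in> T" "?c t0 \<in> T"
      unfolding connected_component_def by blast
    \<comment> \<open>\<open>T\<close> leaves \<open>F\<close> and so meets its frontier. That point
      lies in the drawing but off the other edges and both hairs, hence on the removed piece, which
      avoids \<open>closure F\<close>.\<close>
    have "T \<inter> F \<noteq> {}" "\<not> T \<subseteq> F" using T x t0(3) closure_subset[of F] by auto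
    then have "T \<inter> frontier F \<noteq> {}" using connected_Int_frontier[OF T(1)] by blast
    then obtain z where z: "z \<in> T" "z \<in> frontier F" by blast
    then have "z \<in> open_edge e" using F(5) XE T(2) by blast
    then obtain r where r: "0 < r" "r < 1" "z = ?c r" unfolding open_edge_image[OF assms(2)] by auto
    have "r > s" "r < t"
    proof -
      have "z \<notin> ?e1" "z \<notin> ?e2" using z T by auto
      then show "r > s" "r < t" unfolding e1 e2 using r by (auto simp: image_iff not_less)
    qed
    then have "z \<notin> closure F" using mid r by auto
    then show False using z by (simp add: frontier_def)
  qed
  have "img e \<subseteq> closure F"
    using img_closure_open_edge[OF assms(2)] closure_mono[OF sub] by auto
  moreover have "img e \<inter> F = {}" using F(4) assms(2) unfolding drawn_def by blast
  ultimately show "img e \<subseteq> frontier F" using F(1) by (auto simp: frontier_def interior_open)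
qed

lemma edge_on_face_iff:
  assumes "F \<in> faces M" "e \<in> E"
  shows "edge_on_face M e F \<longleftrightarrow> closure F \<inter> open_edge e \<noteq> {}"
proof
  assume "edge_on_face M e F"
  then have "open_edge e \<subseteq> closure F" unfolding edge_on_face_def open_edge_def frontier_def by blast
  then show "closure F \<inter> open_edge e \<noteq> {}" using open_edge_nonempty[OF assms(2)] by blast
qed (use edge_frontier[OF assms] in \<open>simp add: edge_on_face_def\<close>)

lemma edge_on_face_edge_region:
  assumes "F \<in> faces M" "e \<in> E"
  shows "edge_on_face M e F \<longleftrightarrow> F \<inter> edge_region e \<noteq> {}"
  using edge_on_face_iff[OF assms] face_meets_edge_region[OF assms] edge_frontier[OF assms]
    face_props(3)[OF assms(1)] by blast

lemma face_on_edge_exists: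
  assumes "e \<in> E" "x \<in> edge_region e" "x \<notin> img e"
  shows "\<exists>F\<in>faces M. x \<in> F \<and> edge_on_face M e F"
proof -
  have "x \<notin> drawn E" using edge_region_props(4)[OF assms(1)] assms drawn_remove[OF assms(1)] unfolding open_edge_def by blast
  then obtain F where "F \<in> faces M" "x \<in> F" using face_exists by blast
  then show ?thesis using edge_on_face_edge_region[of F e] assms by blast
qed

lemma connected_component_edge_region:
  assumes "e \<in> E" "F \<in> faces M" "F' \<in> faces M" "edge_on_face M e F" "edge_on_face M e F'" "x \<in> F" "y \<in> F'"
  shows "connected_component (- drawn (E - {e})) x y"
  using assms edge_region_props(6)[OF assms(1), of x y] edge_on_face_edge_region face_meets_edge_region(1) by blast

section \<open>Bridges do not separate\<close>

lemma subdrawing_disjoint: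
  assumes "A1 \<subseteq> E" "A2 \<subseteq> E" "V1 \<subseteq> V" "V2 \<subseteq> V" "V1 \<inter> V2 = {}"
    "\<And>f. f \<in> A1 \<Longrightarrow> en f \<subseteq> V1" "\<And>f. f \<in> A2 \<Longrightarrow> en f \<subseteq> V2"
  shows "subdrawing A1 V1 \<inter> subdrawing A2 V2 = {}"
proof -
  have D1: "subdrawing A1 V1 \<inter> pt ` V \<subseteq> pt ` V1"
    using img_V assms(1,3,6) unfolding subdrawing_def by blast
  have D2: "subdrawing A2 V2 \<inter> pt ` V \<subseteq> pt ` V2"
    using img_V assms(2,4,7) unfolding subdrawing_def by blast
  have dis: "pt ` V1 \<inter> pt ` V2 = {}"
    using inj_pt assms(3-5) by (metis image_empty inj_on_image_Int)
  have "subdrawing A1 V1 \<inter> subdrawing A2 V2 \<subseteq> pt ` V"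
  proof
    fix z assume z: "z \<in> subdrawing A1 V1 \<inter> subdrawing A2 V2"
    show "z \<in> pt ` V"
    proof (rule ccontr)
      assume n: "z \<notin> pt ` V"
      then obtain f g where fg: "f \<in> A1" "z \<in> img f" "g \<in> A2" "z \<in> img g"
        using z assms(3,4) unfolding subdrawing_def by blast
      have "f \<noteq> g"
      proof
        assume "f = g"
        then have "en f \<subseteq> {}" using assms(5-7) fg by blast
        then show False using en_card[of f] fg assms(1) by auto
      qed
      then show False using img_int[of f g] fg assms(1,2) n by blast
    qed
  qed
  then show ?thesis using D1 D2 dis by blast
qed

text \<open>The drawing of \<open>A\<close> splits into the component of \<open>u\<close> and the
  rest, disjoint compact sets that the arc \<open>e\<close> meets in one point each. An arc does not
  separate the plane, so Janiszewski's theorem applies first to the component of \<open>u\<close>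
  and \<open>e\<close>, then to their union and the rest.\<close>

lemma bridge_connected:
  assumes A: "A \<subseteq> E" and e: "e \<in> E" "e \<notin> A" "en e = {u, w}" and nj: "\<not> joins en A u w"
    and cc: "connected_component (- drawn A) x y" and xy: "x \<notin> img e" "y \<notin> img e"
  shows "connected_component (- drawn (insert e A)) x y"
proof -
  define V1 where "V1 = {v \<in> V. joins en A u v}"
  define A1 where "A1 = {f \<in> A. en f \<subseteq> V1}"
  let ?Y1 = "subdrawing A1 V1" and ?Y2 = "subdrawing (A - A1) (V - V1)"
  have uw: "u \<in> V" "w \<in> V" using en_sub[OF e(1)] e(3) by auto
  have ne: "u \<noteq> w" using nj by auto
  have u1: "u \<in> V1" "w \<notin> V1" using uw nj by (auto simp: V1_def)
  have A2: "en f \<subseteq> V - V1" if "f \<in> A - A1" for f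
  proof -
    have f: "f \<in> A" "f \<in> E" using that A by auto
    obtain a b where ab: "en f = {a, b}" using en_cases[OF f(2)] .
    have "joins en A a b" "joins en A b a" using joins_edge[of f A en a b] joins_edge[of f A en b a] f(1) ab by auto
    moreover have "{a, b} \<subseteq> V" using en_sub[OF f(2)] ab by simp
    ultimately have "a \<in> V1 \<longleftrightarrow> b \<in> V1" 
      using joins_trans[of en A u a b] joins_trans[of en A u b a] by (auto simp: V1_def)
    then show ?thesis using that ab \<open>{a, b} \<subseteq> V\<close> unfolding A1_def by auto
  qed
  have A1: "A1 \<subseteq> A" and A1V: "\<And>f. f \<in> A1 \<Longrightarrow> en f \<subseteq> V1" and V1: "V1 \<subseteq> V"
    unfolding A1_def V1_def by auto
  have DA: "drawn A = ?Y1 \<union> ?Y2" using A1 V1 unfolding drawn_def subdrawing_def by blast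
  have dis: "?Y1 \<inter> ?Y2 = {}"
    by (rule subdrawing_disjoint) (use A A1 V1 A1V A2 in auto)
  have DI: "drawn A \<inter> img e = {pt u, pt w}" using drawn_Int_img[OF A e(1,2)] e(3) by simp
  have Y: "pt u \<in> ?Y1" "pt w \<in> ?Y2" using u1 uw unfolding subdrawing_def by auto
  then have Y': "pt w \<notin> ?Y1" "pt u \<notin> ?Y2" using dis by auto
  have ie: "pt u \<in> img e" "pt w \<in> img e" using DI by auto
  have "?Y1 \<inter> img e \<subseteq> {pt u, pt w}" "?Y2 \<inter> img e \<subseteq> {pt u, pt w}" using DI DA by auto
  then have I1: "?Y1 \<inter> img e = {pt u}" and I2': "?Y2 \<inter> img e = {pt w}" using Y Y' ie by auto
  have I2: "?Y2 \<inter> (?Y1 \<union> img e) = {pt w}" 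
  proof -
    have "?Y2 \<inter> (?Y1 \<union> img e) = (?Y1 \<inter> ?Y2) \<union> (?Y2 \<inter> img e)" by auto
    then show ?thesis by (simp add: dis I2')
  qed
  have fin: "finite A" using finE A finite_subset by blast
  have comp: "compact (subdrawing B W)" if "B \<subseteq> A" "W \<subseteq> V" for B W
    unfolding subdrawing_def using that finite_subset[OF that(1) fin] finite_subset[OF that(2) finV] A
    by (intro compact_Un compact_UN) (auto intro: finite_imp_compact compact_img)
  obtain g where g: "arc g" "path_image g = img e" using edge_arc[OF e(1,3) ne] by blast
  have ac: "connected (- img e)" using connected_arc_complement[OF g(1)] g(2) by simp
  have cY: "connected_component (- ?Y1) x y" "connected_component (- ?Y2) x y"
    using cc connected_component_of_subset[of "- drawn A"] unfolding DA by blast+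
  have "connected_component (- (?Y1 \<union> img e)) x y"
  proof (rule Janiszewski)
    show "compact ?Y1" using comp A1 V1 by blast
    show "closed (img e)" using compact_img[OF e(1)] compact_imp_closed by blast
    show "connected_component (- img e) x y" using ac xy unfolding connected_component_def by blast
  qed (use I1 cY in auto)
  then have "connected_component (- (?Y2 \<union> (?Y1 \<union> img e))) x y"
  proof (rule Janiszewski[rotated 4])
    show "compact ?Y2" using comp by blast
    show "closed (?Y1 \<union> img e)"
      using compact_img[OF e(1)] comp[OF A1 V1] by (simp add: compact_imp_closed closed_Un)
  qed (use I2 cY in auto)
  moreover have "?Y2 \<union> (?Y1 \<union> img e) = drawn (insert e A)" unfolding drawn_insert DA by blast
  ultimately show ?thesis by simp
qed

lemma bridge_face_unique:
  assumes "e \<in> E" "en e = {u, w}" "\<not> joins en (E - {e}) u w"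
    "F \<in> faces M" "F' \<in> faces M" "edge_on_face M e F" "edge_on_face M e F'"
  shows "F = F'"
proof -
  obtain x y where xy: "x \<in> F" "y \<in> F'" using face_props(3) assms(4,5) by blast
  have "x \<notin> img e" "y \<notin> img e"
    using xy face_props(4)[OF assms(4)] face_props(4)[OF assms(5)] assms(1) unfolding drawn_def by blast+
  then have "connected_component (- drawn (insert e (E - {e}))) x y"
    using bridge_connected[of "E - {e}" e u w x y] assms(1-3)
      connected_component_edge_region[OF assms(1,4-7) xy] by blast
  then show ?thesis
    using face_eqI[OF assms(4,5) xy] assms(1) by (simp add: insert_absorb)
qed

section \<open>The two sides of a cycle\<close>

definition cycle_image :: "'e set \<Rightarrow> complex set" where
  "cycle_image C = (\<Union>e\<in>C. img e)"

lemma cycle_image_props: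
  assumes "gcycle en E C U"
  shows "open (inside (cycle_image C))" "open (outside (cycle_image C))" "connected (inside (cycle_image C))" "connected (outside (cycle_image C))"
    "frontier (inside (cycle_image C)) = cycle_image C" "frontier (outside (cycle_image C)) = cycle_image C"
    "inside (cycle_image C) \<inter> outside (cycle_image C) = {}" "inside (cycle_image C) \<union> outside (cycle_image C) = - cycle_image C" "compact (cycle_image C)"
    "cycle_image C \<subseteq> drawn E"
proof -
  obtain J where J: "simple_path J" "pathfinish J = pathstart J" "path_image J = cycle_image C"
    using cycle_curve[OF assms] unfolding cycle_image_def by blast
  show "open (inside (cycle_image C))" "open (outside (cycle_image C))" "connected (inside (cycle_image C))" "connected (outside (cycle_image C))"
    "frontier (inside (cycle_image C)) = cycle_image C" "frontier (outside (cycle_image C)) = cycle_image C"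
    "inside (cycle_image C) \<inter> outside (cycle_image C) = {}" "inside (cycle_image C) \<union> outside (cycle_image C) = - cycle_image C"
    using Jordan_inside_outside[OF J(1,2)] unfolding J(3) by auto
  show "compact (cycle_image C)" using compact_simple_path_image[OF J(1)] J(3) by simp
  show "cycle_image C \<subseteq> drawn E" using gcycle_subset[OF assms] unfolding cycle_image_def drawn_def by blast
qed

lemma connected_side:
  assumes "gcycle en E C U" "connected T" "T \<inter> cycle_image C = {}"
  shows "T \<subseteq> inside (cycle_image C) \<or> T \<subseteq> outside (cycle_image C)"
proof -
  have sub: "T \<subseteq> inside (cycle_image C) \<union> outside (cycle_image C)" using cycle_image_props(8)[OF assms(1)] assms(3) by auto
  have "inside (cycle_image C) \<inter> T = {} \<or> outside (cycle_image C) \<inter> T = {}"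
    by (rule connectedD[OF assms(2) cycle_image_props(1,2)[OF assms(1)] _ sub]) (simp add: cycle_image_props(7)[OF assms(1)])
  then show ?thesis using sub by blast
qed

lemma face_side:
  assumes "gcycle en E C U" "F \<in> faces M"
  shows "F \<subseteq> inside (cycle_image C) \<or> F \<subseteq> outside (cycle_image C)"
  using connected_side[OF assms(1)] face_props(2,4)[OF assms(2)] cycle_image_props(10)[OF assms(1)] by blast

lemma side_closure:
  assumes "gcycle en E C U" "F \<in> faces M" "z \<in> closure F" "S = inside (cycle_image C) \<or> S = outside (cycle_image C)" "z \<in> S"
  shows "F \<subseteq> S"
proof -
  have "open S" using cycle_image_props(1,2)[OF assms(1)] assms(4) by auto
  then have "F \<inter> S \<noteq> {}" using open_Int_closure_eq_empty[of S F] assms(3,5) by blast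
  then show ?thesis using face_side[OF assms(1,2)] cycle_image_props(7)[OF assms(1)] assms(4) by blast
qed

lemma cycle_image_Int:
  assumes "gcycle en E C U" "e \<in> C"
  shows "cycle_image C \<inter> drawn (E - {e}) = subdrawing (C - {e}) U"
proof -
  have CE: "C \<subseteq> E" using gcycle_subset[OF assms(1)] .
  have UV: "U \<subseteq> V" using gcycle_V[OF assms(1)] .
  have eU: "en f \<subseteq> U" if "f \<in> C" for f using gcycle_ends[OF assms(1) that] .
  have "drawn (E - {e}) \<inter> img e = pt ` en e" using drawn_Int_img[of "E - {e}" e] CE assms(2) by blast
  moreover have "pt ` en e \<subseteq> pt ` U" using eU[OF assms(2)] by blast
  ultimately have 1: "cycle_image C \<inter> drawn (E - {e}) \<subseteq> subdrawing (C - {e}) U"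
    unfolding cycle_image_def subdrawing_def by blast
  have "pt ` U \<subseteq> cycle_image C"
  proof -
    have "\<exists>f\<in>C. v \<in> en f" if "v \<in> U" for v using gcycle_vertex[OF assms(1) that] .
    then show ?thesis using pt_end_img CE unfolding cycle_image_def by blast
  qed
  moreover have "(\<Union>f\<in>C - {e}. img f) \<subseteq> cycle_image C \<inter> drawn (E - {e})" "pt ` U \<subseteq> drawn (E - {e})"
    using CE UV unfolding cycle_image_def drawn_def by blast+
  ultimately have "subdrawing (C - {e}) U \<subseteq> cycle_image C \<inter> drawn (E - {e})" unfolding subdrawing_def by blast
  with 1 show ?thesis by blast
qed

text \<open>Existence: \<open>e\<close> lies in the frontier of \<open>S\<close>, so its region
  reaches into \<open>S\<close>. Uniqueness: points of two such faces are joined off the cycle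
  (within \<open>S\<close>) and off all edges but \<open>e\<close> (within the region of
  \<open>e\<close>). The cycle meets the drawing without \<open>e\<close> in the cycle minus
  \<open>e\<close>, which is connected, so by Janiszewski's theorem they are joined off the whole
  drawing.\<close>

lemma cycle_face_unique:
  assumes "gcycle en E C U" "e \<in> C" "S = inside (cycle_image C) \<or> S = outside (cycle_image C)"
  shows "\<exists>!F. F \<in> faces M \<and> edge_on_face M e F \<and> F \<subseteq> S"
proof -
  have e: "e \<in> E" using gcycle_subset[OF assms(1)] assms(2) by blast
  note J = cycle_image_props[OF assms(1)] and U = edge_region_props[OF e]
  have S: "open S" "connected S" "frontier S = cycle_image C" using J(1-6) assms(3) by auto
  have S4: "S \<subseteq> - cycle_image C" using J(8) assms(3) by blast
  have eJ: "img e \<subseteq> cycle_image C" using assms(2) unfolding cycle_image_def by blast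
  have "closure S \<inter> edge_region e \<noteq> {}"
    using S(3) eJ open_edge_nonempty[OF e] U(3) unfolding open_edge_def frontier_def by blast
  then obtain x where x: "x \<in> S" "x \<in> edge_region e"
    using open_Int_closure_eq_empty[OF U(1), of S] by blast
  have "x \<notin> img e" using x S4 eJ by blast
  then obtain F where F: "F \<in> faces M" "x \<in> F" "edge_on_face M e F"
    using face_on_edge_exists[OF e x(2)] by blast
  have FS: "F \<subseteq> S" using side_closure[OF assms(1) F(1), of x S] closure_subset[of F] F(2) assms(3) x(1) by blast
  have uniq: "F' = F" if F': "F' \<in> faces M" "edge_on_face M e F'" "F' \<subseteq> S" for F'
  proof -
    obtain y where y: "y \<in> F'" using face_props(3)[OF F'(1)] by blast
    have "connected_component (- (cycle_image C \<union> drawn (E - {e}))) x y"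
    proof (rule Janiszewski)
      show "compact (cycle_image C)" using J(9) .
      show "closed (drawn (E - {e}))" by (simp add: closed_drawn)
      show "connected (cycle_image C \<inter> drawn (E - {e}))"
        using cycle_image_Int[OF assms(1,2)] cycle_minus_connected[OF assms(1,2)] by simp
      show "connected_component (- cycle_image C) x y"
        using S(2) S4 x(1) y F'(3) unfolding connected_component_def by blast
      show "connected_component (- drawn (E - {e})) x y"
        using connected_component_edge_region[OF e F(1) F'(1) F(3) F'(2) F(2) y] .
    qed
    moreover have "cycle_image C \<union> drawn (E - {e}) = drawn E"
      using J(10) drawn_remove[OF e] eJ unfolding open_edge_def by blast
    ultimately show ?thesis using face_eqI[OF F(1) F'(1) F(2) y] by simp
  qed
  show ?thesis
  proof (rule ex1I)
    show "F \<in> faces M \<and> edge_on_face M e F \<and> F \<subseteq> S" using F FS by simp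
  qed (use uniq in simp)
qed

section \<open>The one or two faces at an edge\<close>

definition co :: "'e \<Rightarrow> complex set set" where
  "co e = {F \<in> faces M. edge_on_face M e F}"

lemma connected_minus_pts: "connected (- pt ` V)"
  using connected_open_delete_finite[of "UNIV :: complex set" "pt ` V"] finV connected_UNIV
  by (simp add: Compl_eq_Diff_UNIV)

text \<open>Otherwise the open edge would be an open set with frontier among the finitely many
  vertices. The plane minus these is connected, so the edge would fill it, but the edge is
  bounded.\<close>

lemma edge_region_not_sub:
  assumes "e \<in> E" shows "\<exists>x\<in>edge_region e. x \<notin> img e"
proof (rule ccontr)
  assume n: "\<not> (\<exists>x\<in>edge_region e. x \<notin> img e)"
  note U = edge_region_props[OF assms]
  have "edge_region e \<subseteq> img e" using n by blast
  moreover have "pt ` V \<subseteq> drawn (E - {e})" by (auto simp: drawn_def)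
  ultimately have "edge_region e = open_edge e" using U(3,4) unfolding open_edge_def by blast
  then have op: "open (open_edge e)" using U(1) by simp
  have "closure (open_edge e) \<subseteq> img e"
    by (rule closure_minimal) (auto simp: open_edge_def compact_imp_closed compact_img[OF assms])
  then have fr: "frontier (open_edge e) \<subseteq> pt ` V"
    using op unfolding frontier_def by (auto simp: interior_open open_edge_def)
  have "bounded (open_edge e \<union> pt ` V)"
    using compact_imp_bounded[OF compact_img[OF assms]] finite_imp_bounded[of "pt ` V"] finV
    by (auto simp: open_edge_def intro: bounded_subset)
  then obtain z where "z \<notin> open_edge e \<union> pt ` V"
    using not_bounded_UNIV by (metis UNIV_I bounded_subset subsetI)
  then have "- pt ` V - open_edge e \<noteq> {}" by blast
  moreover have "- pt ` V \<inter> open_edge e \<noteq> {}" using open_edge_nonempty[OF assms] by (auto simp: open_edge_def)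
  ultimately have "- pt ` V \<inter> frontier (open_edge e) \<noteq> {}"
    using connected_Int_frontier[OF connected_minus_pts] by blast
  then show False using fr by blast
qed

lemma co_nonempty: "e \<in> E \<Longrightarrow> co e \<noteq> {}"
  using edge_region_not_sub[of e] face_on_edge_exists[of e] unfolding co_def by blast

lemma co_cycle:
  assumes "gcycle en E C U" "e \<in> C"
  obtains F1 F2 where "co e = {F1, F2}" "F1 \<subseteq> inside (cycle_image C)" "F2 \<subseteq> outside (cycle_image C)" "F1 \<noteq> F2"
proof -
  obtain F1 where F1: "F1 \<in> faces M" "edge_on_face M e F1" "F1 \<subseteq> inside (cycle_image C)"
    "\<And>F. F \<in> faces M \<Longrightarrow> edge_on_face M e F \<Longrightarrow> F \<subseteq> inside (cycle_image C) \<Longrightarrow> F = F1"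
    using cycle_face_unique[OF assms, of "inside (cycle_image C)"] by blast
  obtain F2 where F2: "F2 \<in> faces M" "edge_on_face M e F2" "F2 \<subseteq> outside (cycle_image C)"
    "\<And>F. F \<in> faces M \<Longrightarrow> edge_on_face M e F \<Longrightarrow> F \<subseteq> outside (cycle_image C) \<Longrightarrow> F = F2"
    using cycle_face_unique[OF assms, of "outside (cycle_image C)"] by blast
  have ne: "F1 \<noteq> F2" using F1(1,3) F2(3) face_props(3)[OF F1(1)] cycle_image_props(7)[OF assms(1)] by blast
  have ce: "co e = {F1, F2}"
  proof
    show "co e \<subseteq> {F1, F2}"
    proof
      fix F assume "F \<in> co e"
      then have F: "F \<in> faces M" "edge_on_face M e F" by (auto simp: co_def)
      then show "F \<in> {F1, F2}" using face_side[OF assms(1) F(1)] F1(4)[OF F] F2(4)[OF F] by auto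
    qed
    show "{F1, F2} \<subseteq> co e" using F1(1,2) F2(1,2) by (simp add: co_def)
  qed
  show ?thesis by (rule that[of F1 F2, OF ce F1(3) F2(3) ne])
qed

text \<open>An edge on a cycle has one face on either side; an edge on no cycle is a bridge and has
  a single face.\<close>

lemma co_card:
  assumes "e \<in> E" shows "card (co e) = 1 \<or> card (co e) = 2"
proof -
  obtain u w where uw: "en e = {u, w}" using en_cases[OF assms] .
  show ?thesis
  proof (cases "joins en (E - {e}) u w")
    case True
    then obtain C U where "gcycle en E C U" "e \<in> C" using joins_imp_gcycle[OF assms uw True] by blast
    then obtain F1 F2 where "co e = {F1, F2}" "F1 \<noteq> F2" by (rule co_cycle)
    then show ?thesis by simp
  next
    case False
    obtain F where F: "F \<in> co e" using co_nonempty[OF assms] by blast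
    have "F' = F" if "F' \<in> co e" for F'
      using bridge_face_unique[OF assms uw False] that F by (simp add: co_def)
    then have "co e = {F}" using F by blast
    then show ?thesis by simp
  qed
qed

text \<open>A face bordered by no edge has its frontier among the vertices and is therefore the
  plane minus the vertices. All other faces belong to one of the finite sets
  \<open>co e\<close>.\<close>

lemma finite_faces: "finite (faces M)"
proof -
  have "F = - pt ` V" if F: "F \<in> faces M" "\<And>e. e \<in> E \<Longrightarrow> F \<notin> co e" for F
  proof -
    have fr: "frontier F \<subseteq> pt ` V"
    proof
      fix z assume z: "z \<in> frontier F"
      show "z \<in> pt ` V"
      proof (rule ccontr)
        assume n: "z \<notin> pt ` V"
        then obtain e where e: "e \<in> E" "z \<in> img e"
          using face_props(5)[OF F(1)] z unfolding drawn_def by blast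
        then have "z \<in> closure F \<inter> open_edge e" using z n by (simp add: open_edge_def frontier_def)
        then have "F \<in> co e" using edge_on_face_iff[OF F(1) e(1)] F(1) by (auto simp: co_def)
        then show False using F(2) e by blast
      qed
    qed
    have sub: "F \<subseteq> - pt ` V" using face_props(4)[OF F(1)] unfolding drawn_def by blast
    have "- pt ` V \<inter> F \<noteq> {}" using sub face_props(3)[OF F(1)] by blast
    then have "- pt ` V - F = {}"
      using connected_Int_frontier[OF connected_minus_pts, of F] fr by blast
    then show ?thesis using sub by blast
  qed
  then have "faces M \<subseteq> insert (- pt ` V) (\<Union>e\<in>E. co e)" by blast
  moreover have "finite (co e)" if "e \<in> E" for e using co_card[OF that] card.infinite by fastforce
  ultimately show ?thesis using finE by (meson finite_UN finite_insert finite_subset)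
qed

text \<open>Take the indicator of the faces inside the Jordan curve. It jumps exactly across the
  edges of the cycle, because a point off the curve lies on one side together with all faces
  touching it.\<close>

lemma cycle_chain:
  assumes "gcycle en E C U"
  shows "\<exists>g. (\<forall>e\<in>E. cobd co g e = of_bool (e \<in> C)) \<and>
    (\<forall>v\<in>V - U. \<exists>k. \<forall>F\<in>faces M. vertex_on_face M v F \<longrightarrow> g F = k)"
proof -
  define g :: "complex set \<Rightarrow> bit" where "g F = of_bool (F \<subseteq> inside (cycle_image C))" for F
  note J = cycle_image_props[OF assms]
  have out: "g F = 0" if "F \<in> faces M" "F \<subseteq> outside (cycle_image C)" for F
  proof -
    have "\<not> F \<subseteq> inside (cycle_image C)" using J(7) that(2) face_props(3)[OF that(1)] by blast
    then show ?thesis by (simp add: g_def)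
  qed
  have same: "\<exists>k. \<forall>F\<in>faces M. z \<in> closure F \<longrightarrow> g F = k" if "z \<notin> cycle_image C" for z
  proof -
    have "z \<in> inside (cycle_image C) \<or> z \<in> outside (cycle_image C)" using J(8) that by blast
    then show ?thesis
    proof
      assume z: "z \<in> inside (cycle_image C)"
      have "g F = 1" if "F \<in> faces M" "z \<in> closure F" for F
        using side_closure[OF assms that, of "inside (cycle_image C)"] z unfolding g_def by simp
      then show ?thesis by blast
    next
      assume z: "z \<in> outside (cycle_image C)"
      have "g F = 0" if "F \<in> faces M" "z \<in> closure F" for F
        using side_closure[OF assms that, of "outside (cycle_image C)"] z out that by simp
      then show ?thesis by blast
    qed
  qed
  have "cobd co g e = of_bool (e \<in> C)" if e: "e \<in> E" for e
  proof (cases "e \<in> C")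
    case True
    then obtain F1 F2 where F: "co e = {F1, F2}" "F1 \<subseteq> inside (cycle_image C)" "F2 \<subseteq> outside (cycle_image C)" "F1 \<noteq> F2"
      by (rule co_cycle[OF assms])
    then have "F2 \<in> faces M" by (auto simp: co_def)
    then show ?thesis using True out[OF _ F(3)] F(2) by (simp add: cobd_pair[of co e F1 F2, OF F(1)] g_def)
  next
    case False
    obtain z where z: "z \<in> open_edge e" using open_edge_nonempty[OF e] by blast
    have "cycle_image C \<subseteq> drawn (E - {e})" using False gcycle_subset[OF assms] unfolding cycle_image_def drawn_def by blast
    then have "z \<notin> cycle_image C" using open_edge_drawn_disjoint[of "E - {e}" e] e z by blast
    then obtain k where k: "\<And>F. F \<in> faces M \<Longrightarrow> z \<in> closure F \<Longrightarrow> g F = k" using same by blast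
    have "g F = k" if "F \<in> co e" for F
    proof -
      have "z \<in> closure F" using that z unfolding co_def edge_on_face_def open_edge_def frontier_def by blast
      then show ?thesis using k that by (simp add: co_def)
    qed
    then have "sum g (co e) = sum (\<lambda>_. k) (co e)" by (rule sum.cong[OF refl])
    then show ?thesis using False by (simp add: cobd_def)
  qed
  moreover have "\<exists>k. \<forall>F\<in>faces M. vertex_on_face M v F \<longrightarrow> g F = k" if v: "v \<in> V - U" for v
  proof -
    have "pt v \<notin> cycle_image C"
    proof
      assume "pt v \<in> cycle_image C"
      then obtain e where e: "e \<in> C" "pt v \<in> img e" unfolding cycle_image_def by blast
      then have "pt v \<in> pt ` en e" using img_V[of e] gcycle_subset[OF assms] v by blast
      then have "pt v \<in> pt ` U" using gcycle_ends[OF assms e(1)] by blast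
      then show False using v gcycle_V[OF assms] inj_pt by (metis DiffD1 DiffD2 inj_on_image_mem_iff)
    qed
    from same[OF this] show ?thesis unfolding vertex_on_face_def frontier_def by blast
  qed
  ultimately show ?thesis by blast
qed

text \<open>In an acyclic set each added edge links two vertices that were not joined before, so
  \<open>bridge_connected\<close> carries connectedness along.\<close>

lemma acyclic_connected:
  assumes "A \<subseteq> E" "\<And>C U. \<not> gcycle en A C U"
  shows "connected (- drawn A)"
proof -
  have "finite A" using assms(1) finE finite_subset by blast
  then show ?thesis using assms
  proof (induction A)
    case empty
    then show ?case using connected_minus_pts by (simp add: drawn_def)
  next
    case (insert e A)
    have e: "e \<in> E" and A: "A \<subseteq> E" using insert.prems by auto
    obtain u w where uw: "en e = {u, w}" using en_cases[OF e] .
    have nj: "\<not> joins en A u w"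
    proof
      assume "joins en A u w"
      then have "joins en (insert e A - {e}) u w" using insert.hyps by simp
      from joins_imp_gcycle[OF _ uw this] show False using insert.prems(2) by blast
    qed
    have con: "connected (- drawn A)" using insert.IH A insert.prems(2) gcycle_mono[of en A _ _ "insert e A"] by blast
    show ?case
      unfolding connected_iff_connected_component
    proof (intro ballI)
      fix x y assume "x \<in> - drawn (insert e A)" "y \<in> - drawn (insert e A)"
      then have xy: "x \<in> - drawn A" "y \<in> - drawn A" "x \<notin> img e" "y \<notin> img e" unfolding drawn_insert by auto
      then have "connected_component (- drawn A) x y" using con unfolding connected_iff_connected_component by blast
      then show "connected_component (- drawn (insert e A)) x y"
        using bridge_connected[OF A e insert.hyps(2) uw nj] xy by blast
    qed
  qed
qed

lemma acyclic_chain_const: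
  assumes "\<And>C U. gcycle en E C U \<Longrightarrow> \<not> C \<subseteq> {e \<in> E. cobd co g e = 1}"
  shows "\<exists>k. \<forall>F\<in>faces M. g F = k"
proof -
  define X where "X = {e \<in> E. cobd co g e = 1}"
  have XE: "X \<subseteq> E" by (auto simp: X_def)
  have "\<not> gcycle en X C U" for C U
    using gcycle_mono[of en X C U E] XE gcycle_subset[of en X C U] assms unfolding X_def by blast
  then have con: "connected (- drawn X)" using acyclic_connected[OF XE] by blast
  \<comment> \<open>\<open>X\<close> consists of the edges across which \<open>g\<close> jumps. At a
    point off \<open>X\<close>, all faces touching it have one common value. The open sets
    \<open>W 0\<close> and \<open>W 1\<close> thus partition the connected complement of
    \<open>drawn X\<close>, and one of them is empty there.\<close>
  define W where "W k = - (\<Union>F\<in>{F \<in> faces M. g F \<noteq> k}. closure F)" for k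
  have op: "open (W k)" for k
    unfolding W_def using finite_faces by (intro open_Compl closed_UN) auto
  have cl: "\<exists>k. \<forall>F\<in>faces M. x \<in> closure F \<longrightarrow> g F = k" "\<exists>F\<in>faces M. x \<in> closure F" if x: "x \<in> - drawn X" for x
  proof -
    have "(\<exists>k. \<forall>F\<in>faces M. x \<in> closure F \<longrightarrow> g F = k) \<and> (\<exists>F\<in>faces M. x \<in> closure F)"
    proof (cases "x \<in> drawn E")
      case False
      then obtain F where F: "F \<in> faces M" "x \<in> F" using face_exists by blast
      have "F' = F" if F': "F' \<in> faces M" "x \<in> closure F'" for F'
      proof -
        have "F \<inter> F' \<noteq> {}" using open_Int_closure_eq_empty[of F F'] face_props(1)[OF F(1)] F(2) F'(2) by blast
        then show ?thesis using face_maximal[OF F(1), of F'] face_maximal[OF F'(1), of F]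
          face_props(2,4)[OF F(1)] face_props(2,4)[OF F'(1)] by blast
      qed
      then show ?thesis using F closure_subset by blast
    next
      case True
      then obtain e where e: "e \<in> E" "x \<in> img e" "e \<notin> X" using x unfolding drawn_def by blast
      have xo: "x \<in> open_edge e" using e x unfolding open_edge_def drawn_def by blast
      have sub: "F \<in> co e" if "F \<in> faces M" "x \<in> closure F" for F
        using edge_on_face_iff[OF that(1) e(1)] that xo unfolding co_def by blast
      have "cobd co g e = 0" using e unfolding X_def by auto
      obtain F1 F2 where F12: "co e = {F1, F2}"
        using co_card[OF e(1)] by (metis card_1_singletonE card_2_iff insert_absorb2)
      then have "g F1 + g F2 = 0" using \<open>cobd co g e = 0\<close> cobd_pair by metis
      then have "g F1 = g F2" by (cases "g F1"; cases "g F2") auto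
      then have "\<forall>F\<in>faces M. x \<in> closure F \<longrightarrow> g F = g F1" using sub F12 by auto
      moreover have "F1 \<in> faces M" "x \<in> closure F1"
        using F12 xo unfolding co_def edge_on_face_def open_edge_def frontier_def by blast+
      ultimately show ?thesis by blast
    qed
    then show "\<exists>k. \<forall>F\<in>faces M. x \<in> closure F \<longrightarrow> g F = k" "\<exists>F\<in>faces M. x \<in> closure F" by auto
  qed
  have cover: "- drawn X \<subseteq> W 0 \<union> W 1"
  proof
    fix x assume "x \<in> - drawn X"
    from cl(1)[OF this] obtain k where "\<forall>F\<in>faces M. x \<in> closure F \<longrightarrow> g F = k" by blast
    then have "x \<in> W k" unfolding W_def by blast
    then show "x \<in> W 0 \<union> W 1" by (cases k) auto
  qed
  have disj: "W 0 \<inter> W 1 \<inter> - drawn X = {}"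
  proof -
    have False if x: "x \<in> W 0" "x \<in> W 1" "x \<in> - drawn X" for x
    proof -
      obtain F where F: "F \<in> faces M" "x \<in> closure F" using cl(2)[OF x(3)] by blast
      then show False using x(1,2) unfolding W_def by (cases "g F") auto
    qed
    then show ?thesis by blast
  qed
  have mem: "g F = 1 - k" if F: "F \<in> faces M" and k: "W k \<inter> - drawn X = {}" for F k
  proof -
    obtain x where x: "x \<in> F" using face_props(3)[OF F] by blast
    have "x \<in> - drawn X" using x face_props(4)[OF F] drawn_mono[OF XE] by blast
    moreover obtain k' where k': "\<forall>F\<in>faces M. x \<in> closure F \<longrightarrow> g F = k'" using cl(1)[OF calculation] by blast
    moreover have "x \<in> W k'" using k' unfolding W_def by blast
    ultimately have "k' \<noteq> k" using k by blast
    moreover have "g F = k'" using k' F x closure_subset by blast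
    ultimately show ?thesis by (cases k; cases k') auto
  qed
  have "W 0 \<inter> - drawn X = {} \<or> W 1 \<inter> - drawn X = {}"
    by (rule connectedD[OF con op op disj cover])
  then show ?thesis using mem by blast
qed

end

section \<open>Homology of the sphere\<close>

lemma card_Diff_less: "finite X \<Longrightarrow> C \<subseteq> X \<Longrightarrow> C \<noteq> {} \<Longrightarrow> card (X - C) < card X"
  by (rule psubset_card_mono) auto

text \<open>From here on the plane is forgotten. The second half of \<open>cycle_chain\<close> keeps
  the local geometry: the faces around a vertex off the cycle lie on the same side.\<close>

locale sphere_map =
  fixes V :: "'v set" and E :: "'e set" and Fs :: "'f set"
    and en :: "'e \<Rightarrow> 'v set" and co :: "'e \<Rightarrow> 'f set" and inc :: "'v \<Rightarrow> 'f \<Rightarrow> bool"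
  assumes finV: "finite V" and finE: "finite E" and finF: "finite Fs"
    and en_sub: "e \<in> E \<Longrightarrow> en e \<subseteq> V" and en_card: "e \<in> E \<Longrightarrow> card (en e) = 1 \<or> card (en e) = 2"
    and co_sub: "e \<in> E \<Longrightarrow> co e \<subseteq> Fs" and co_card: "e \<in> E \<Longrightarrow> card (co e) = 1 \<or> card (co e) = 2"
    and inc_edge: "e \<in> E \<Longrightarrow> v \<in> en e \<Longrightarrow> F \<in> co e \<Longrightarrow> inc v F"
    and cycle_chain: "gcycle en E C U \<Longrightarrow> \<exists>g. (\<forall>e\<in>E. cobd co g e = of_bool (e \<in> C)) \<and>
      (\<forall>v\<in>V - U. \<exists>k. \<forall>F\<in>Fs. inc v F \<longrightarrow> g F = k)"
    and acyclic_const: "(\<And>C U. gcycle en E C U \<Longrightarrow> \<not> C \<subseteq> {e \<in> E. cobd co g e = 1}) \<Longrightarrow>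
      \<exists>k. \<forall>F\<in>Fs. g F = k"
begin

section \<open>Even chains and the faces around a vertex\<close>

lemma en_cases: assumes "e \<in> E" obtains u w where "en e = {u, w}"
  using en_card[OF assms] by (metis card_1_singletonE card_2_iff insert_absorb2)

lemma cobd_joined:
  assumes "A \<subseteq> E" "e \<in> A"
  shows "cobd en (\<lambda>v. of_bool (joins en A u v)) e = 0"
proof -
  obtain x y where xy: "en e = {x, y}" using en_cases assms by blast
  have "joins en A u x = joins en A u y"
    using joins_edge[of e A en x y] joins_edge[of e A en y x] assms(2) xy
      joins_trans[of en A u x y] joins_trans[of en A u y x] by auto
  then show ?thesis by (simp add: cobd_pair[of en e x y, OF xy])
qed

text \<open>If \<open>e\<close> were a bridge of the support, take the indicator of the component of
  one end in the support without \<open>e\<close>. Its coboundary meets the chain in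
  \<open>e\<close> alone, so their pairing is 1, whereas adjointness and evenness give 0.\<close>

lemma even_contains_cycle:
  assumes even: "\<And>v. v \<in> V \<Longrightarrow> bd E en c v = 0" and e: "e \<in> E" "c e = 1"
  shows "\<exists>C U. gcycle en E C U \<and> C \<subseteq> {e \<in> E. c e = 1}"
proof -
  define X where "X = {e \<in> E. c e = 1}"
  have XE: "X \<subseteq> E" and eX: "e \<in> X" using e by (auto simp: X_def)
  obtain u w where uw: "en e = {u, w}" using en_cases[OF e(1)] .
  have "joins en (X - {e}) u w"
  proof (rule ccontr)
    assume nj: "\<not> joins en (X - {e}) u w"
    let ?g = "\<lambda>v. of_bool (joins en (X - {e}) u v) :: bit"
    have "c f * cobd en ?g f = (if f = e then 1 else 0)" if "f \<in> E" for f
    proof (cases "f \<in> X - {e}")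
      case True
      then show ?thesis using cobd_joined[of "X - {e}" f u] XE by auto
    next
      case False
      then show ?thesis using that nj e(2) cobd_pair[of en e u w, OF uw] by (auto simp: X_def)
    qed
    then have "(\<Sum>f\<in>E. c f * cobd en ?g f) = 1" using finE e(1) by simp
    moreover have "(\<Sum>f\<in>E. c f * cobd en ?g f) = 0"
      using cobd_bd[of V E en c ?g, OF finV en_sub] even by simp
    ultimately show False by simp
  qed
  from joins_imp_gcycle[OF eX uw this] obtain C U where "gcycle en X C U" by blast
  then show ?thesis
    using gcycle_mono[of en X C U E] XE gcycle_subset[of en X C U] unfolding X_def by blast
qed

text \<open>Split off one cycle after another and add up the face functions from
  \<open>cycle_chain\<close>. A vertex off the support is off every cycle split off, so constancy
  around it survives.\<close>

lemma even_chain: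
  assumes "\<And>v. v \<in> V \<Longrightarrow> bd E en c v = 0"
  shows "\<exists>g. (\<forall>e\<in>E. cobd co g e = c e) \<and>
    (\<forall>v\<in>V. (\<forall>e\<in>E. v \<in> en e \<longrightarrow> c e = 0) \<longrightarrow> (\<exists>k. \<forall>F\<in>Fs. inc v F \<longrightarrow> g F = k))"
  using assms
proof (induction "card {e \<in> E. c e = 1}" arbitrary: c rule: less_induct)
  case less
  show ?case
  proof (cases "\<exists>e\<in>E. c e = 1")
    case False
    then have "c e = 0" if "e \<in> E" for e using that by auto
    then have "\<forall>e\<in>E. cobd co (\<lambda>F. 0) e = c e" by (simp add: cobd_const)
    then show ?thesis by blast
  next
    case True
    then obtain C U where C: "gcycle en E C U" "C \<subseteq> {e \<in> E. c e = 1}"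
      using even_contains_cycle[OF less.prems] by blast
    define c' where "c' e = c e + of_bool (e \<in> C)" for e
    have "{e \<in> E. c' e = 1} = {e \<in> E. c e = 1} - C"
      using C(2) by (auto simp: c'_def)
    moreover have "finite {e \<in> E. c e = 1}" using finE by simp
    ultimately have "card {e \<in> E. c' e = 1} < card {e \<in> E. c e = 1}"
      using card_Diff_less[OF _ C(2) gcycle_nonempty[OF C(1)]] by simp
    moreover have "bd E en c' v = 0" if "v \<in> V" for v
      using less.prems[OF that] bd_gcycle[OF C(1) finE] unfolding c'_def by (simp add: bd_add)
    ultimately obtain g' where g': "\<And>e. e \<in> E \<Longrightarrow> cobd co g' e = c' e"
      "\<And>v. v \<in> V \<Longrightarrow> (\<forall>e\<in>E. v \<in> en e \<longrightarrow> c' e = 0) \<Longrightarrow> (\<exists>k. \<forall>F\<in>Fs. inc v F \<longrightarrow> g' F = k)"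
      using less.hyps[of c'] by blast
    obtain h where h: "\<And>e. e \<in> E \<Longrightarrow> cobd co h e = of_bool (e \<in> C)"
      "\<And>v. v \<in> V - U \<Longrightarrow> \<exists>k. \<forall>F\<in>Fs. inc v F \<longrightarrow> h F = k"
      using cycle_chain[OF C(1)] by blast
    let ?g = "\<lambda>F. g' F + h F"
    have "cobd co ?g e = c e" if "e \<in> E" for e
      using g'(1)[OF that] h(1)[OF that] by (simp add: cobd_add c'_def add.assoc)
    moreover have "\<exists>k. \<forall>F\<in>Fs. inc v F \<longrightarrow> ?g F = k" if v: "v \<in> V" "\<forall>e\<in>E. v \<in> en e \<longrightarrow> c e = 0" for v
    proof -
      have nC: "v \<notin> en e" if "e \<in> C" for e using C(2) v(2) that by auto
      then have "v \<notin> U" using gcycle_vertex[OF C(1)] by blast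
      then obtain k1 where k1: "\<forall>F\<in>Fs. inc v F \<longrightarrow> h F = k1" using h(2) v(1) by blast
      have "\<forall>e\<in>E. v \<in> en e \<longrightarrow> c' e = 0" using v(2) nC by (auto simp: c'_def)
      then obtain k2 where "\<forall>F\<in>Fs. inc v F \<longrightarrow> g' F = k2" using g'(2)[OF v(1)] by blast
      then show ?thesis using k1 by (intro exI[of _ "k2 + k1"]) auto
    qed
    ultimately show ?thesis by (intro exI[of _ ?g]) blast
  qed
qed

text \<open>Cycles are removed from the coboundary of \<open>g\<close> by adding their face
  functions to \<open>g\<close>. Cycles are even, so the boundary does not change; once the support
  contains no cycle, \<open>g\<close> is constant and nothing is left.\<close>

lemma bd_cobd_zero:
  assumes "v \<in> V" shows "bd E en (cobd co g) v = 0"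
proof (induction "card {e \<in> E. cobd co g e = 1}" arbitrary: g rule: less_induct)
  case less
  show ?case
  proof (cases "\<exists>C U. gcycle en E C U \<and> C \<subseteq> {e \<in> E. cobd co g e = 1}")
    case False
    then obtain k where k: "\<forall>F\<in>Fs. g F = k" using acyclic_const[of g] by blast
    have "cobd co g e = 0" if "e \<in> E" for e
    proof -
      have "sum g (co e) = sum (\<lambda>_. k) (co e)" using co_sub[OF that] k by (intro sum.cong) auto
      then show ?thesis by (simp add: cobd_def)
    qed
    then show ?thesis by (simp add: bd_def)
  next
    case True
    then obtain C U where C: "gcycle en E C U" "C \<subseteq> {e \<in> E. cobd co g e = 1}" by blast
    obtain h where h: "\<And>e. e \<in> E \<Longrightarrow> cobd co h e = of_bool (e \<in> C)"
      using cycle_chain[OF C(1)] by blast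
    let ?g = "\<lambda>F. g F + h F"
    have "{e \<in> E. cobd co ?g e = 1} = {e \<in> E. cobd co g e = 1} - C"
      using C(2) by (auto simp: cobd_add h of_bool_def split: if_splits)
    moreover have "finite {e \<in> E. cobd co g e = 1}" using finE by simp
    ultimately have "card {e \<in> E. cobd co ?g e = 1} < card {e \<in> E. cobd co g e = 1}"
      using card_Diff_less[OF _ C(2) gcycle_nonempty[OF C(1)]] by simp
    then have "bd E en (cobd co ?g) v = 0" by (rule less.hyps)
    moreover have "bd E en (cobd co ?g) v = bd E en (\<lambda>e. cobd co g e + of_bool (e \<in> C)) v"
      by (intro bd_cong) (simp add: cobd_add h)
    ultimately show ?thesis using bd_gcycle[OF C(1) finE] by (simp add: bd_add)
  qed
qed

text \<open>The coboundary of \<open>g\<close> is even, so \<open>even_chain\<close> supplies a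
  \<open>g'\<close> with the same coboundary that is constant around \<open>v\<close>; the two
  differ by a global constant. Geometrically, the faces around \<open>v\<close> are linked through
  the edges at \<open>v\<close>.\<close>

lemma faces_linked:
  assumes "v \<in> V" "\<And>e. e \<in> E \<Longrightarrow> v \<in> en e \<Longrightarrow> cobd co g e = 0"
  shows "\<exists>k. \<forall>F\<in>Fs. inc v F \<longrightarrow> g F = k"
proof -
  obtain g' where g': "\<And>e. e \<in> E \<Longrightarrow> cobd co g' e = cobd co g e"
    "\<And>v. v \<in> V \<Longrightarrow> (\<forall>e\<in>E. v \<in> en e \<longrightarrow> cobd co g e = 0) \<Longrightarrow> (\<exists>k. \<forall>F\<in>Fs. inc v F \<longrightarrow> g' F = k)"
    using even_chain[of "cobd co g"] bd_cobd_zero by blast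
  obtain k1 where k1: "\<forall>F\<in>Fs. inc v F \<longrightarrow> g' F = k1" using g'(2) assms by blast
  have "{e \<in> E. cobd co (\<lambda>F. g F + g' F) e = 1} = {}" using g'(1) by (auto simp: cobd_add)
  then have "\<not> C \<subseteq> {e \<in> E. cobd co (\<lambda>F. g F + g' F) e = 1}" if "gcycle en E C U" for C U
    using gcycle_nonempty[OF that] by auto
  then obtain k2 where k2: "\<forall>F\<in>Fs. g F + g' F = k2" using acyclic_const[of "\<lambda>F. g F + g' F"] by blast
  have "g F = k1 + k2" if "F \<in> Fs" "inc v F" for F
    using k1 k2 that by (metis add.commute bit_add_left_self)
  then show ?thesis by blast
qed

lemma region:
  assumes "\<And>w. w \<in> V \<Longrightarrow> bd E en c w = 0" "v \<in> V" "\<And>e. e \<in> E \<Longrightarrow> v \<in> en e \<Longrightarrow> c e = 0"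
  shows "\<exists>g. (\<forall>e\<in>E. cobd co g e = c e) \<and> (\<forall>F\<in>Fs. inc v F \<longrightarrow> g F = 0)"
proof -
  obtain g k where g: "\<forall>e\<in>E. cobd co g e = c e" "\<forall>F\<in>Fs. inc v F \<longrightarrow> g F = k"
    using even_chain[OF assms(1)] assms(2,3) by blast
  have "\<forall>e\<in>E. cobd co (\<lambda>F. g F + k) e = c e" using g(1) by (simp add: cobd_add cobd_const)
  moreover have "\<forall>F\<in>Fs. inc v F \<longrightarrow> g F + k = 0" using g(2) by simp
  ultimately show ?thesis by (intro exI[of _ "\<lambda>F. g F + k"]) blast
qed

text \<open>Edges are added one at a time. If the ends are joined already, the cycle condition
  forces the right value; otherwise \<phi> can still be changed by 1 on the whole component of one
  end.\<close>

lemma potential: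
  assumes cyc: "\<And>C U. gcycle en E C U \<Longrightarrow> (\<Sum>e\<in>C. c e) = 0" and "A \<subseteq> E"
  shows "\<exists>\<phi>. \<forall>e\<in>A. cobd en \<phi> e = c e"
proof -
  have "finite A" using assms(2) finE finite_subset by blast
  then show ?thesis using assms(2)
  proof induction
    case (insert e A)
    then obtain \<phi> where \<phi>: "\<forall>e\<in>A. cobd en \<phi> e = c e" by blast
    have e: "e \<in> E" and A: "A \<subseteq> E" using insert.prems by auto
    obtain u w where uw: "en e = {u, w}" using en_cases[OF e] .
    show ?case
    proof (cases "joins en A u w")
      case True
      then obtain B U where B: "spath en A u B U w" using joins_imp_spath[OF True] by blast
      have "sum c B = \<phi> u + \<phi> w" using B
      proof induction
        case spath_Nil
        then show ?case by simp
      next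
        case (spath_Step B U w e w')
        have "e \<notin> B" using spath_facts(6)[OF spath_Step.hyps(1)] spath_Step.hyps by auto
        moreover have "c e = \<phi> w + \<phi> w'"
          using \<phi> spath_Step.hyps(2) cobd_pair[of en e w w' \<phi>, OF spath_Step.hyps(3)] by auto
        ultimately show ?case using spath_Step.IH spath_facts(4)[OF spath_Step.hyps(1)]
          by (simp add: ac_simps)
      qed
      moreover have "e \<notin> B" using spath_facts(1)[OF B] insert.hyps by blast
      moreover have "gcycle en E (insert e B) U"
        using gcycleI[of e E en u w B U] e uw \<open>e \<notin> B\<close> spath_mono[OF B A] by blast
      ultimately have "c e + (\<phi> u + \<phi> w) = 0"
        using cyc[of "insert e B" U] spath_facts(4)[OF B] by simp
      then have "cobd en \<phi> e = c e"
        using cobd_pair[of en e u w \<phi>, OF uw] by (simp add: bit_add_eq_0_iff)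
      then show ?thesis using \<phi> by blast
    next
      case False
      let ?\<psi> = "\<lambda>v. \<phi> v + of_bool (joins en A u v)"
      have 1: "\<forall>e\<in>A. cobd en ?\<psi> e = c e" using \<phi> cobd_joined[OF A] by (simp add: cobd_add)
      have "cobd en ?\<psi> e = cobd en \<phi> e + 1"
        using False by (simp add: cobd_pair[of en e u w, OF uw] ac_simps)
      then have "cobd en ?\<psi> e = c e \<or> cobd en \<phi> e = c e"
        by (cases "cobd en \<phi> e"; cases "c e") auto
      then show ?thesis using 1 \<phi> by (metis insert_iff)
    qed
  qed auto
qed

text \<open>A cycle is the coboundary of a face function, so by adjointness the sum of
  \<open>c\<close> over it pairs that function with the vanishing dual boundary of
  \<open>c\<close>.\<close>

lemma dual_potential:
  assumes "\<And>F. F \<in> Fs \<Longrightarrow> bd E co c F = 0"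
  shows "\<exists>\<phi>. \<forall>e\<in>E. cobd en \<phi> e = c e"
proof (rule potential)
  fix C U assume C: "gcycle en E C U"
  obtain g where g: "\<And>e. e \<in> E \<Longrightarrow> cobd co g e = of_bool (e \<in> C)"
    using cycle_chain[OF C] by blast
  have CE: "C \<subseteq> E" using gcycle_subset[OF C] .
  have "(\<Sum>e\<in>C. c e) = (\<Sum>e\<in>E. c e * cobd co g e)"
    using CE finE g by (intro sum.mono_neutral_cong_left) auto
  also have "\<dots> = 0" using cobd_bd[of Fs E co c g, OF finF co_sub] assms by simp
  finally show "(\<Sum>e\<in>C. c e) = 0" .
qed simp

text \<open>Apply \<open>bd_cobd_zero\<close> to the indicator of the single face \<open>F\<close>.
  At a vertex the edges bordering \<open>F\<close>, apart from loops and bridges, come in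
  pairs.\<close>

lemma incid_orthogonal:
  assumes "v \<in> V" "F \<in> Fs"
  shows "(\<Sum>e\<in>E. incid en v e * incid co F e) = 0"
proof -
  have "cobd co (\<lambda>F'. of_bool (F' = F)) e = incid co F e" if "e \<in> E" for e
  proof -
    have "finite (co e)" using co_card[OF that] card.infinite by fastforce
    then show ?thesis by (auto simp: cobd_def incid_def of_bool_def)
  qed
  then have "(\<Sum>e\<in>E. incid en v e * incid co F e) = bd E en (cobd co (\<lambda>F'. of_bool (F' = F))) v"
    unfolding bd_def by (intro sum.cong) auto
  then show ?thesis using bd_cobd_zero[OF assms(1)] by simp
qed

text \<open>The part of the boundary of \<open>F\<close> where \<open>\<phi>\<close> is \<open>1\<close> is a cycle, hence the coboundary of some \<open>g\<close>.
  On the faces around a vertex \<open>v\<close>, the function \<open>g\<close> corrected by \<open>\<phi> v\<close> at \<open>F\<close> is constant, and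
  the constant does not change along edges.\<close>

lemma vertices_linked:
  assumes F: "F \<in> Fs" and flat: "\<And>e. e \<in> E \<Longrightarrow> F \<in> co e \<Longrightarrow> cobd en \<phi> e = 0"
    and uw: "u \<in> V" "joins en E u w" "inc u F" "inc w F"
  shows "\<phi> u = \<phi> w"
proof -
  have eq: "\<phi> x = \<phi> y" if h: "e \<in> E" "F \<in> co e" "x \<in> en e" "y \<in> en e" for e x y
  proof -
    obtain a b where ab: "en e = {a, b}" using en_cases[OF h(1)] .
    have "\<phi> a + \<phi> b = 0" using flat[OF h(1,2)] cobd_pair[of en e a b \<phi>, OF ab] by simp
    then show ?thesis using ab h by (auto simp: bit_add_eq_0_iff)
  qed
  \<comment> \<open>On an edge bordering \<open>F\<close> both ends have the same value of \<phi>,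
    so the chosen end stands for either.\<close>
  define c where "c e = incid co F e * \<phi> (SOME v. v \<in> en e)" for e
  have c: "c e = incid co F e * \<phi> v" if "e \<in> E" "v \<in> en e" for e v
  proof (cases "F \<in> co e")
    case True
    have "(SOME v. v \<in> en e) \<in> en e" using that(2) by (rule someI)
    then show ?thesis using eq[OF that(1) True _ that(2)] by (simp add: c_def)
  next
    case False
    then show ?thesis by (simp add: c_def incid_def)
  qed
  have "bd E en c v = 0" if "v \<in> V" for v
  proof -
    have "bd E en c v = (\<Sum>e\<in>E. (incid en v e * incid co F e) * \<phi> v)"
      unfolding bd_def
    proof (rule sum.cong[OF refl])
      fix e assume "e \<in> E"
      then show "incid en v e * c e = (incid en v e * incid co F e) * \<phi> v"
        using c[of e v] by (cases "v \<in> en e") (auto simp: incid_def[of en])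
    qed
    then show ?thesis using incid_orthogonal[OF that F] by (simp flip: sum_distrib_right)
  qed
  then obtain g where g: "\<And>e. e \<in> E \<Longrightarrow> cobd co g e = c e" using even_chain by blast
  have const: "\<exists>k. \<forall>F'\<in>Fs. inc v F' \<longrightarrow> g F' + of_bool (F' = F) * \<phi> v = k" if "v \<in> V" for v
  proof (rule faces_linked[OF that])
    fix e assume e: "e \<in> E" "v \<in> en e"
    have fin: "finite (co e)" using co_card[OF e(1)] card.infinite by fastforce
    have "cobd co (\<lambda>F'. of_bool (F' = F) * \<phi> v) e = incid co F e * \<phi> v"
      using fin by (auto simp: cobd_def incid_def of_bool_def simp flip: sum_distrib_right)
    then show "cobd co (\<lambda>F'. g F' + of_bool (F' = F) * \<phi> v) e = 0"
      using g[OF e(1)] c[OF e] by (simp add: cobd_add)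
  qed
  obtain k where k: "\<forall>F'\<in>Fs. inc u F' \<longrightarrow> g F' + of_bool (F' = F) * \<phi> u = k"
    using const[OF uw(1)] by blast
  have "w \<in> V \<and> (\<forall>F'\<in>Fs. inc w F' \<longrightarrow> g F' + of_bool (F' = F) * \<phi> w = k)"
    using uw(2) unfolding joins_def
  proof (induction rule: rtrancl_induct)
    case base
    then show ?case using k uw(1) by blast
  next
    case (step x y)
    then obtain e where e: "e \<in> E" "en e = {x, y}" by auto
    have y: "y \<in> V" using en_sub[OF e(1)] e(2) by auto
    obtain k' where k': "\<forall>F'\<in>Fs. inc y F' \<longrightarrow> g F' + of_bool (F' = F) * \<phi> y = k'"
      using const[OF y] by blast
    \<comment> \<open>A face at the edge of this step compares the constants at its two ends. Only
      \<open>F\<close> itself carries a correction, and if it is the face then \<open>e\<close>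
      borders it and \<phi> agrees at both ends.\<close>
    obtain F' where F': "F' \<in> co e" using co_card[OF e(1)] by fastforce
    have "F' \<in> Fs" "inc x F'" "inc y F'" using F' co_sub[OF e(1)] inc_edge[OF e(1) _ F'] e(2) by auto
    then have "g F' + of_bool (F' = F) * \<phi> x = k" "g F' + of_bool (F' = F) * \<phi> y = k'"
      using step.IH k' by auto
    moreover have "F' = F \<Longrightarrow> \<phi> x = \<phi> y" using eq[OF e(1), of x y] F' e(2) by auto
    ultimately have "k' = k" by (cases "F' = F") auto
    then show ?case using k' y by blast
  qed
  then have "g F + \<phi> w = k" "g F + \<phi> u = k" using F uw(3,4) k by auto
  then show ?thesis by (metis add_left_cancel)
qed

text \<open>A potential is determined only up to a constant on each component of the graph, and the
  boundary of \<open>F\<close> may touch several components. Each is corrected by the value at its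
  vertices on \<open>F\<close>, which is unique by \<open>vertices_linked\<close>.\<close>

lemma dual_region:
  assumes even: "\<And>F'. F' \<in> Fs \<Longrightarrow> bd E co c F' = 0" and F: "F \<in> Fs" "\<And>e. e \<in> E \<Longrightarrow> F \<in> co e \<Longrightarrow> c e = 0"
  shows "\<exists>\<phi>. (\<forall>e\<in>E. cobd en \<phi> e = c e) \<and> (\<forall>v\<in>V. inc v F \<longrightarrow> \<phi> v = 0)"
proof -
  obtain \<phi> where \<phi>: "\<And>e. e \<in> E \<Longrightarrow> cobd en \<phi> e = c e" using dual_potential[OF even] by blast
  define \<kappa> :: "'v \<Rightarrow> bit" where "\<kappa> v = of_bool (\<exists>u\<in>V. joins en E u v \<and> inc u F \<and> \<phi> u = 1)" for v
  have "cobd en \<kappa> e = 0" if e: "e \<in> E" for e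
  proof -
    obtain x y where xy: "en e = {x, y}" using en_cases[OF e] .
    have "joins en E u x = joins en E u y" for u
      using joins_edge[of e E en x y] joins_edge[of e E en y x] e xy
        joins_trans[of en E u x y] joins_trans[of en E u y x] by auto
    then have "\<kappa> x = \<kappa> y" by (simp add: \<kappa>_def)
    then show ?thesis using cobd_pair[of en e x y \<kappa>, OF xy] by simp
  qed
  then have "\<forall>e\<in>E. cobd en (\<lambda>v. \<phi> v + \<kappa> v) e = c e" using \<phi> by (simp add: cobd_add)
  moreover have "\<phi> v + \<kappa> v = 0" if v: "v \<in> V" "inc v F" for v
  proof -
    have "\<phi> u = \<phi> v" if "u \<in> V" "joins en E u v" "inc u F" for u
      using vertices_linked[OF F(1), of \<phi> u v] \<phi> F(2) that v(2) by auto
    then have "(\<exists>u\<in>V. joins en E u v \<and> inc u F \<and> \<phi> u = 1) \<longleftrightarrow> \<phi> v = 1"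
      using v joins_refl[of en E v] by metis
    then have "\<kappa> v = \<phi> v" unfolding \<kappa>_def by (cases "\<phi> v") auto
    then show ?thesis by simp
  qed
  ultimately show ?thesis by (intro exI[of _ "\<lambda>v. \<phi> v + \<kappa> v"]) blast
qed

end

section \<open>Outerplanarity from winding data\<close>

fun walk_sum :: "('a \<Rightarrow> 'a \<Rightarrow> 'a \<Rightarrow> bit) \<Rightarrow> 'a list \<Rightarrow> 'a \<Rightarrow> bit" where
  "walk_sum f (x # y # p) v = f x y v + walk_sum f (y # p) v"
| "walk_sum f _ v = 0"

lemma walk_sum_append: "walk_sum f (xs @ y # ys) v = walk_sum f (xs @ [y]) v + walk_sum f (y # ys) v"
proof (induction xs)
  case (Cons a xs)
  then show ?case by (cases xs) (auto simp: add.assoc)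
qed auto

lemma successively_split:
  "successively P (xs @ y # ys) \<longleftrightarrow> successively P (xs @ [y]) \<and> successively P (y # ys)"
proof (induction xs)
  case (Cons a xs)
  then show ?case by (cases xs) auto
qed auto

section \<open>Noncrossing orders: rotation and gluing\<close>

definition noncrossing :: "('a \<Rightarrow> 'a \<Rightarrow> bool) \<Rightarrow> 'a set \<Rightarrow> ('a \<Rightarrow> nat) \<Rightarrow> bool" where
  "noncrossing adj U pos \<longleftrightarrow> inj_on pos U \<and>
     (\<forall>a\<in>U. \<forall>b\<in>U. \<forall>c\<in>U. \<forall>d\<in>U. pos a < pos b \<and> pos b < pos c \<and> pos c < pos d \<longrightarrow>
        \<not> (adj a c \<and> adj b d))"

text \<open>Crossing depends on the cyclic order only: adding a bound \<open>B\<close> moves the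
  vertices before \<open>v\<close> behind all others.\<close>

lemma noncrossing_rotate:
  assumes sym: "\<And>x y. adj x y \<Longrightarrow> adj y x" and U: "finite U" "v \<in> U" and nc: "noncrossing adj U pos"
  shows "\<exists>pos'. noncrossing adj U pos' \<and> (\<forall>x\<in>U. x \<noteq> v \<longrightarrow> pos' v < pos' x)"
proof -
  have inj: "inj_on pos U" using nc by (simp add: noncrossing_def)
  define B where "B = Suc (Max (pos ` U))"
  have B: "pos x < B" if "x \<in> U" for x
    using U that by (simp add: B_def less_Suc_eq_le)
  define pos' where "pos' x = (if pos x < pos v then pos x + B else pos x)" for x
  have X: "\<not> (adj a c \<and> adj b d)" if "a \<in> U" "b \<in> U" "c \<in> U" "d \<in> U" "pos a < pos b" "pos b < pos c" "pos c < pos d"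
    for a b c d using nc that unfolding noncrossing_def by blast
  have "inj_on pos' U"
  proof (rule inj_onI)
    fix x y assume xy: "x \<in> U" "y \<in> U" "pos' x = pos' y"
    then have "pos x = pos y" using B[of x] B[of y] by (auto simp: pos'_def split: if_splits)
    then show "x = y" using inj xy by (auto dest: inj_onD)
  qed
  moreover have "\<not> (adj a c \<and> adj b d)"
    if h: "a \<in> U" "b \<in> U" "c \<in> U" "d \<in> U" "pos' a < pos' b" "pos' b < pos' c" "pos' c < pos' d" for a b c d
  proof
    assume ad: "adj a c \<and> adj b d"
    have Bs: "pos a < B" "pos b < B" "pos c < B" "pos d < B" using B h by auto
    have "pos a < pos b \<and> pos b < pos c \<and> pos c < pos d \<or> pos d < pos a \<and> pos a < pos b \<and> pos b < pos c \<or>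
      pos c < pos d \<and> pos d < pos a \<and> pos a < pos b \<or> pos b < pos c \<and> pos c < pos d \<and> pos d < pos a"
      using h(5-7) Bs unfolding pos'_def by (auto split: if_splits)
    then show False
      using X[OF h(1-4)] X[OF h(4,1,2,3)] X[OF h(3,4,1,2)] X[OF h(2,3,4,1)] ad
        sym[of a c] sym[of b d] by blast
  qed
  moreover have "pos' v < pos' x" if "x \<in> U" "x \<noteq> v" for x
  proof -
    have "pos x \<noteq> pos v" using inj that U by (auto dest: inj_onD)
    then show ?thesis using B[OF U(2)] by (auto simp: pos'_def)
  qed
  ultimately show ?thesis unfolding noncrossing_def by (intro exI[of _ pos']) blast
qed

text \<open>With \<open>v\<close> rotated to the first place in both orders, list \<open>A\<close>
  and then the rest of \<open>B\<close>. Edges between the parts all leave this first vertex, and a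
  crossing with one of them would be a crossing within \<open>insert v B\<close>.\<close>

lemma noncrossing_glue:
  assumes sym: "\<And>x y. adj x y \<Longrightarrow> adj y x" and fin: "finite A" "finite B" and dis: "A \<inter> B = {}" and v: "v \<in> A"
    and sep: "\<And>x y. x \<in> A \<Longrightarrow> y \<in> B \<Longrightarrow> adj x y \<Longrightarrow> x = v"
    and nc: "noncrossing adj A p1" "noncrossing adj (insert v B) p2"
  shows "\<exists>p. noncrossing adj (A \<union> B) p"
proof -
  obtain p1 where p1: "noncrossing adj A p1" "\<And>x. x \<in> A \<Longrightarrow> x \<noteq> v \<Longrightarrow> p1 v < p1 x"
    using noncrossing_rotate[OF sym fin(1) v nc(1)] by blast
  obtain p2 where p2: "noncrossing adj (insert v B) p2" "\<And>x. x \<in> B \<Longrightarrow> p2 v < p2 x"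
  proof -
    have "finite (insert v B)" using fin(2) by simp
    from noncrossing_rotate[OF sym this insertI1 nc(2)] obtain p where
      "noncrossing adj (insert v B) p" "\<forall>x\<in>insert v B. x \<noteq> v \<longrightarrow> p v < p x" by blast
    moreover have "v \<notin> B" using v dis by blast
    ultimately show thesis using that[of p] by (metis insertI2)
  qed
  define K where "K = Suc (Max (p1 ` A))"
  have K: "p1 x < K" if "x \<in> A" for x using fin(1) that by (simp add: K_def less_Suc_eq_le)
  define p where "p x = (if x \<in> A then p1 x else p2 x + K)" for x
  have "inj_on p (A \<union> B)"
  proof (rule inj_onI)
    fix x y assume xy: "x \<in> A \<union> B" "y \<in> A \<union> B" "p x = p y"
    have i: "inj_on p1 A" "inj_on p2 (insert v B)" using p1 p2 by (auto simp: noncrossing_def)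
    show "x = y"
      using xy K[of x] K[of y] inj_onD[OF i(1), of x y] inj_onD[OF i(2), of x y]
      by (auto simp: p_def split: if_splits)
  qed
  moreover have "\<not> (adj a c \<and> adj b d)"
    if h: "a \<in> A \<union> B" "b \<in> A \<union> B" "c \<in> A \<union> B" "d \<in> A \<union> B" "p a < p b" "p b < p c" "p c < p d" for a b c d
  proof
    assume ad: "adj a c \<and> adj b d"
    have mono: "x \<in> A" if "y \<in> A" "p x < p y" for x y
      using that K[of y] by (auto simp: p_def split: if_splits)
    have vmin: "\<not> p x < p v" if "x \<in> A" for x
      using that p1(2)[of x] v by (cases "x = v") (auto simp: p_def)
    consider "d \<in> A" | "d \<in> B" "c \<in> A" | "d \<in> B" "c \<in> B" "b \<in> A" | "d \<in> B" "c \<in> B" "b \<in> B" "a \<in> A"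
      | "d \<in> B" "c \<in> B" "b \<in> B" "a \<in> B" using h(1-4) by blast
    then show False
    proof cases
      case 1
      then have "a \<in> A" "b \<in> A" "c \<in> A" using mono h(5-7) by blast+
      then show False using 1 p1(1) h(5-7) ad unfolding noncrossing_def p_def by auto
    next
      case 2
      then have "a \<in> A" "b \<in> A" using mono h(5-7) by blast+
      then have "b = v" using sep 2 ad by blast
      then show False using vmin[OF \<open>a \<in> A\<close>] h(5) by simp
    next
      case 3
      then have "a \<in> A" using mono h(5) by blast
      then have "a = v" "b = v" using sep 3 ad by blast+
      then show False using h(5) by simp
    next
      case 4
      then have "a = v" using sep ad by blast
      moreover have "b \<notin> A" "c \<notin> A" "d \<notin> A" using 4 dis by blast+
      ultimately have "p2 a < p2 b" "p2 b < p2 c" "p2 c < p2 d"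
        using p2(2)[OF 4(3)] h(6,7) by (auto simp: p_def)
      then show False using p2(1) 4 \<open>a = v\<close> ad unfolding noncrossing_def by blast
    next
      case 5
      then have "a \<notin> A" "b \<notin> A" "c \<notin> A" "d \<notin> A" using dis by blast+
      then have "p2 a < p2 b" "p2 b < p2 c" "p2 c < p2 d"
        using h(5-7) by (auto simp: p_def)
      then show False using p2(1) 5 ad unfolding noncrossing_def by blast
    qed
  qed
  ultimately show ?thesis unfolding noncrossing_def by (intro exI[of _ p]) blast
qed

lemma rtrancl_distinct_walk:
  assumes "(x, y) \<in> {(x, y). adj x y \<and> x \<in> S \<and> y \<in> S}\<^sup>*" "x \<in> S"
  shows "\<exists>p. p \<noteq> [] \<and> hd p = x \<and> last p = y \<and> distinct p \<and> successively adj p \<and> set p \<subseteq> S"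
  using assms(1)
proof (induction rule: rtrancl_induct)
  case base
  then show ?case using assms(2) by (intro exI[of _ "[x]"]) auto
next
  case (step y z)
  then obtain p where p: "p \<noteq> []" "hd p = x" "last p = y" "distinct p" "successively adj p" "set p \<subseteq> S"
    by blast
  show ?case
  proof (cases "z \<in> set p")
    case True
    from split_list[OF this] obtain a b where ab: "p = a @ z # b" by blast
    then show ?thesis using p
      by (intro exI[of _ "a @ [z]"]) (auto simp: successively_append_iff hd_append split: if_splits)
  next
    case False
    then show ?thesis using p step.hyps
      by (intro exI[of _ "p @ [z]"]) (auto simp: successively_append_iff)
  qed
qed

text \<open>\<open>nn x y v\<close> is the winding contribution of the edge from \<open>x\<close> to
  \<open>y\<close> as seen from the fixed vertex \<open>v\<close>. The right-hand side of
  \<open>square\<close> comes from exchanging the two entries: passages of the exchanged pair belong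
  to the antipodal hexagon side, and the two sides together account for every change of
  \<open>u\<close>.\<close>

locale winding_data =
  fixes V :: "'a set" and adj :: "'a \<Rightarrow> 'a \<Rightarrow> bool" and nn :: "'a \<Rightarrow> 'a \<Rightarrow> 'a \<Rightarrow> bit" and u :: "'a \<Rightarrow> 'a \<Rightarrow> bit"
  assumes finV: "finite V" and adj_sym: "adj x y \<Longrightarrow> adj y x" and adj_irrefl: "\<not> adj x x"
    and adj_V: "adj x y \<Longrightarrow> x \<in> V"
    and nn_sym: "nn x y v = nn y x v"
    and u_anti: "x \<in> V \<Longrightarrow> y \<in> V \<Longrightarrow> x \<noteq> y \<Longrightarrow> u x y + u y x = 1"
    and square: "adj x x' \<Longrightarrow> adj y y' \<Longrightarrow> {x, x'} \<inter> {y, y'} = {} \<Longrightarrow>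
      nn x x' y + nn x x' y' + nn y y' x + nn y y' x' = u y x + u y' x + u y x' + u y' x'"
    and closed: "p \<noteq> [] \<Longrightarrow> successively adj p \<Longrightarrow> hd p = last p \<Longrightarrow> v \<in> V \<Longrightarrow> v \<notin> set p \<Longrightarrow>
      walk_sum nn p v = 0"
begin

abbreviation "w \<equiv> walk_sum nn"

lemma walk_sum_rev: "w (rev p) v = w p v"
proof (induction p)
  case (Cons a p)
  then show ?case
  proof (cases p)
    case (Cons b q)
    have "w (rev p @ [a]) v = w (rev q @ [b]) v + w [b, a] v"
      using walk_sum_append[of nn "rev q" b "[a]"] Cons by simp
    also have "\<dots> = w p v + nn a b v" using Cons.IH Cons nn_sym[of a b] by simp
    finally show ?thesis using Cons by (simp add: ac_simps)
  qed auto
qed auto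

lemma walk_rev: "successively adj p \<Longrightarrow> successively adj (rev p)"
  using adj_sym by (auto simp: elim: successively_mono)

text \<open>Sum \<open>square\<close> over the edges of \<open>q\<close>; the terms at inner
  vertices occur twice and cancel. \<open>square_walks\<close> repeats this along the other
  walk.\<close>

lemma square_edge:
  assumes "adj x x'" "successively adj q" "q \<noteq> []" "x \<notin> set q" "x' \<notin> set q"
  shows "nn x x' (hd q) + nn x x' (last q) + w q x + w q x' =
    u (hd q) x + u (last q) x + u (hd q) x' + u (last q) x'"
  using assms(2-)
proof (induction q rule: induct_list012)
  case (3 y y' r)
  have 1: "nn x x' y' + nn x x' (last (y' # r)) + w (y' # r) x + w (y' # r) x' =
    u y' x + u (last (y' # r)) x + u y' x' + u (last (y' # r)) x'" using 3 by simp
  have 2: "nn x x' y + nn x x' y' + nn y y' x + nn y y' x' = u y x + u y' x + u y x' + u y' x'"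
    by (rule square[OF assms(1)]) (use 3 in auto)
  have "(nn x x' y' + nn x x' (last (y' # r)) + w (y' # r) x + w (y' # r) x') +
      (nn x x' y + nn x x' y' + nn y y' x + nn y y' x') =
    (u y' x + u (last (y' # r)) x + u y' x' + u (last (y' # r)) x') + (u y x + u y' x + u y x' + u y' x')"
    unfolding 1 2 ..
  then show ?case by (simp add: ac_simps)
qed auto

lemma square_walks:
  assumes "successively adj p" "p \<noteq> []" "successively adj q" "q \<noteq> []" "set p \<inter> set q = {}"
  shows "w p (hd q) + w p (last q) + w q (hd p) + w q (last p) =
    u (hd q) (hd p) + u (last q) (hd p) + u (hd q) (last p) + u (last q) (last p)"
  using assms(1,2,5)
proof (induction p rule: induct_list012)
  case (3 x x' r)
  let ?l = "last (x' # r)"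
  have 1: "w (x' # r) (hd q) + w (x' # r) (last q) + w q x' + w q ?l =
    u (hd q) x' + u (last q) x' + u (hd q) ?l + u (last q) ?l" using 3 by simp
  have 2: "nn x x' (hd q) + nn x x' (last q) + w q x + w q x' =
    u (hd q) x + u (last q) x + u (hd q) x' + u (last q) x'"
    by (rule square_edge) (use 3 assms in auto)
  have "(w (x' # r) (hd q) + w (x' # r) (last q) + w q x' + w q ?l) +
      (nn x x' (hd q) + nn x x' (last q) + w q x + w q x') =
    (u (hd q) x' + u (last q) x' + u (hd q) ?l + u (last q) ?l) +
      (u (hd q) x + u (last q) x + u (hd q) x' + u (last q) x')"
    unfolding 1 2 ..
  then show ?case by (simp add: ac_simps)
qed auto

lemma walk_V: "successively adj p \<Longrightarrow> length p \<ge> 2 \<Longrightarrow> set p \<subseteq> V"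
proof (induction p rule: induct_list012)
  case (3 x y zs)
  have "y \<in> V" "x \<in> V" using 3 adj_V adj_sym by auto
  then show ?case using 3 by (cases zs) auto
qed auto

text \<open>One walk followed by the reverse of the other is a closed walk that misses
  \<open>v\<close>.\<close>

lemma closed3:
  assumes "successively adj (p # X @ [q])" "successively adj (p # Y @ [q])" "v \<in> V"
    "v \<notin> set X" "v \<notin> set Y" "v \<noteq> p" "v \<noteq> q"
  shows "w (p # X @ [q]) v = w (p # Y @ [q]) v"
proof -
  have r: "successively adj (q # rev Y @ [p])" using walk_rev[OF assms(2)] by simp
  have s: "successively adj ((p # X) @ q # (rev Y @ [p]))"
    using assms(1) r successively_split[of adj "p # X" q "rev Y @ [p]"] by auto
  have "w ((p # X) @ q # (rev Y @ [p])) v = 0"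
    by (rule closed[OF _ s]) (use assms in auto)
  then have "w ((p # X) @ [q]) v + w (q # rev Y @ [p]) v = 0"
    using walk_sum_append[of nn "p # X" q "rev Y @ [p]" v] by simp
  moreover have "w (q # rev Y @ [p]) v = w (p # Y @ [q]) v"
    using walk_sum_rev[of "p # Y @ [q]" v] by simp
  ultimately show ?thesis by (simp add: bit_add_eq_0_iff)
qed

text \<open>The squares spanned by the first edge of one path and the rest of another one, together with
  the three regions, form the deleted product of a theta graph on the sphere.\<close>

lemma no_theta:
  assumes walks: "successively adj (p # X1 @ [q])" "successively adj (p # X2 @ [q])" "successively adj (p # X3 @ [q])"
    and ne: "X1 \<noteq> []" "X2 \<noteq> []" "X3 \<noteq> []"
    and dis: "set X1 \<inter> set X2 = {}" "set X1 \<inter> set X3 = {}" "set X2 \<inter> set X3 = {}"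
    and pq: "p \<noteq> q" "p \<notin> set X1 \<union> set X2 \<union> set X3" "q \<notin> set X1 \<union> set X2 \<union> set X3"
  shows False
proof -
  obtain a A b B c C where X: "X1 = a # A" "X2 = b # B" "X3 = c # C"
    using ne by (metis neq_Nil_conv)
  have V: "a \<in> V" "b \<in> V" "c \<in> V"
    using walk_V[OF walks(1)] walk_V[OF walks(2)] walk_V[OF walks(3)] X by auto
  have d: "a \<noteq> b" "a \<noteq> c" "b \<noteq> c" using dis X by auto
  have W: "successively adj (X1 @ [q])" "successively adj (X2 @ [q])" "successively adj (X3 @ [q])"
    "adj p a" "adj p b" "adj p c"
    using walks X by auto
  \<comment> \<open>The product of the first edge of one path with the rest of another, in general
    form; \<open>e1\<close> to \<open>e6\<close> are the six ordered choices of two paths.\<close>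
  have s: "nn p x y + nn p x q + w (Y @ [q]) p + w (Y @ [q]) x = u y p + u q p + u y x + u q x"
    if "adj p x" "successively adj (Y @ [q])" "Y = y # Z" "x \<noteq> q" "x \<notin> set Y" "p \<notin> set Y" for x y Y Z
    using square_edge[of p x "Y @ [q]"] that pq(1) by auto
  have e1: "nn p a b + nn p a q + w (X2 @ [q]) p + w (X2 @ [q]) a = u b p + u q p + u b a + u q a"
    and e2: "nn p a c + nn p a q + w (X3 @ [q]) p + w (X3 @ [q]) a = u c p + u q p + u c a + u q a"
    and e3: "nn p b a + nn p b q + w (X1 @ [q]) p + w (X1 @ [q]) b = u a p + u q p + u a b + u q b"
    and e4: "nn p b c + nn p b q + w (X3 @ [q]) p + w (X3 @ [q]) b = u c p + u q p + u c b + u q b"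
    and e5: "nn p c a + nn p c q + w (X1 @ [q]) p + w (X1 @ [q]) c = u a p + u q p + u a c + u q c"
    and e6: "nn p c b + nn p c q + w (X2 @ [q]) p + w (X2 @ [q]) c = u b p + u q p + u b c + u q c"
    by (rule s; use W X dis pq in auto)+
  have r1: "w (p # X2 @ [q]) a = w (p # X3 @ [q]) a"
    and r2: "w (p # X1 @ [q]) b = w (p # X3 @ [q]) b"
    and r3: "w (p # X1 @ [q]) c = w (p # X2 @ [q]) c"
    by (rule closed3; use walks X dis pq V in auto)+
  have r1': "nn p b a + w (X2 @ [q]) a + nn p c a + w (X3 @ [q]) a = 0"
    and r2': "nn p a b + w (X1 @ [q]) b + nn p c b + w (X3 @ [q]) b = 0"
    and r3': "nn p a c + w (X1 @ [q]) c + nn p b c + w (X2 @ [q]) c = 0"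
    using r1 r2 r3 X by (auto simp: add.assoc)
  have us: "u b a = u a b + 1" "u c a = u a c + 1" "u c b = u b c + 1"
    using u_anti[of a b] u_anti[of a c] u_anti[of b c] V d by (auto simp: bit_add_eq_1_iff)
  \<comment> \<open>All terms of the form \<open>u _ p\<close> or \<open>u q _\<close> occur an even
    number of times. The three pairs among \<open>a\<close>, \<open>b\<close>, \<open>c\<close>
    contribute 3 = 1, and after cancellation the left-hand sides regroup as the three region
    identities.\<close>
  have "(nn p a b + nn p a q + w (X2 @ [q]) p + w (X2 @ [q]) a) + (nn p a c + nn p a q + w (X3 @ [q]) p + w (X3 @ [q]) a)
    + (nn p b a + nn p b q + w (X1 @ [q]) p + w (X1 @ [q]) b) + (nn p b c + nn p b q + w (X3 @ [q]) p + w (X3 @ [q]) b)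
    + (nn p c a + nn p c q + w (X1 @ [q]) p + w (X1 @ [q]) c) + (nn p c b + nn p c q + w (X2 @ [q]) p + w (X2 @ [q]) c)
    = 1"
    unfolding e1 e2 e3 e4 e5 e6 us by (simp add: ac_simps)
  moreover have "(nn p b a + w (X2 @ [q]) a + nn p c a + w (X3 @ [q]) a) + (nn p a b + w (X1 @ [q]) b + nn p c b + w (X3 @ [q]) b)
    + (nn p a c + w (X1 @ [q]) c + nn p b c + w (X2 @ [q]) c) = 0"
    unfolding r1' r2' r3' by simp
  ultimately have "(0::bit) = 1" by (simp add: ac_simps)
  then show False by simp
qed

text \<open>Three squares of opposite paths and four regions, as in the deleted product of the
  tetrahedron.\<close>

lemma no_crossing_chords:
  assumes cyc: "successively adj (p # xs @ q # ys @ r # zs @ s # ws @ [p])"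
    and dist: "distinct (p # xs @ q # ys @ r # zs @ s # ws)" and ch: "adj p r" "adj q s"
  shows False
proof -
  have V: "p \<in> V" "q \<in> V" "r \<in> V" "s \<in> V" using ch adj_V adj_sym by blast+
  have W: "successively adj (p # xs @ [q])" "successively adj (q # ys @ [r])"
    "successively adj (r # zs @ [s])" "successively adj (s # ws @ [p])"
    using cyc successively_split[of adj "p # xs" q "ys @ r # zs @ s # ws @ [p]"]
      successively_split[of adj "q # ys" r "zs @ s # ws @ [p]"]
      successively_split[of adj "r # zs" s "ws @ [p]"] by auto
  let ?pq = "p # xs @ [q]" and ?qr = "q # ys @ [r]" and ?rs = "r # zs @ [s]" and ?sp = "s # ws @ [p]"
  \<comment> \<open>Two consecutive sides of the cycle and a chord make a closed walk that misses
    the remaining corner; it is used once for each corner.\<close>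
  have cl: "w (x # X @ [y]) v + w (y # Y @ [z]) v + nn z x v = 0"
    if "successively adj (x # X @ [y])" "successively adj (y # Y @ [z])" "adj z x" "v \<in> V"
      "v \<notin> set (x # X @ y # Y @ [z])" for x X y Y z v
  proof -
    have sc: "successively adj ((x # X) @ y # (Y @ [z, x]))"
      using that(1-3) successively_split[of adj "x # X" y "Y @ [z, x]"]
        successively_split[of adj "y # Y" z "[x]"] by auto
    have "w ((x # X) @ y # (Y @ [z, x])) v = 0"
      by (rule closed[OF _ sc]) (use that in auto)
    then show ?thesis
      using walk_sum_append[of nn "x # X" y "Y @ [z, x]" v] walk_sum_append[of nn "y # Y" z "[x]" v]
      by (simp add: add.assoc)
  qed
  have r1: "w ?pq s + w ?qr s + nn r p s = 0" by (rule cl) (use W ch adj_sym V dist in auto)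
  have r2: "w ?rs q + w ?sp q + nn p r q = 0" by (rule cl) (use W ch adj_sym V dist in auto)
  have r3: "w ?qr p + w ?rs p + nn s q p = 0" by (rule cl) (use W ch adj_sym V dist in auto)
  have r4: "w ?sp r + w ?pq r + nn q s r = 0" by (rule cl) (use W ch adj_sym V dist in auto)
  have s1: "w ?pq r + w ?pq s + w ?rs p + w ?rs q = u r p + u s p + u r q + u s q"
    using square_walks[OF W(1) _ W(3)] dist by auto
  have s2: "w ?qr s + w ?qr p + w ?sp q + w ?sp r = u s q + u p q + u s r + u p r"
    using square_walks[OF W(2) _ W(4)] dist by auto
  have s3: "nn p r q + nn p r s + nn q s p + nn q s r = u q p + u s p + u q r + u s r"
    by (rule square[OF ch]) (use dist in auto)
  have ns: "nn r p s = nn p r s" "nn s q p = nn q s p" using nn_sym by blast+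
  have us: "u r p = u p r + 1" "u q p = u p q + 1" "u r q = u q r + 1"
    using u_anti[of p r] u_anti[of p q] u_anti[of q r] V dist by (auto simp: bit_add_eq_1_iff)
  \<comment> \<open>Every \<open>u\<close> with \<open>s\<close> as an argument occurs twice; the
    pairs among \<open>p\<close>, \<open>q\<close>, \<open>r\<close> contribute 3 = 1. The left-hand
    sides regroup as the four region identities.\<close>
  have "(w ?pq r + w ?pq s + w ?rs p + w ?rs q) + (w ?qr s + w ?qr p + w ?sp q + w ?sp r)
    + (nn p r q + nn p r s + nn q s p + nn q s r) = 1"
    unfolding s1 s2 s3 us by (simp add: ac_simps)
  moreover have "(w ?pq s + w ?qr s + nn p r s) + (w ?rs q + w ?sp q + nn p r q)
    + (w ?qr p + w ?rs p + nn q s p) + (w ?sp r + w ?pq r + nn q s r) = 0"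
    using r1 r2 r3 r4 unfolding ns by simp
  ultimately have "(0::bit) = 1" by (simp add: ac_simps)
  then show False by simp
qed

text \<open>Length 2 is allowed: an edge walked forth and back counts as a cycle. A longest one then
  exists as soon as there is an edge, and a block consisting of one edge is no special case.\<close>

definition cyc :: "'a list \<Rightarrow> bool" where
  "cyc C \<longleftrightarrow> distinct C \<and> length C \<ge> 2 \<and> successively adj (C @ [hd C])"

lemma cyc_append_commute:
  assumes "cyc (l @ p # m)" shows "cyc (p # m @ l)"
proof (cases l)
  case Nil
  then show ?thesis using assms by simp
next
  case (Cons x l')
  have "successively adj ((x # l') @ p # (m @ [x]))" using assms by (simp add: cyc_def Cons)
  then have "successively adj (x # l' @ [p])" "successively adj (p # m @ [x])"
    using successively_split[of adj "x # l'" p "m @ [x]"] by auto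
  then have "successively adj (p # m @ x # l' @ [p])"
    using successively_split[of adj "p # m" x "l' @ [p]"] by auto
  then show ?thesis using assms unfolding cyc_def Cons by auto
qed

lemma cyc_rotate:
  assumes "cyc C" "p \<in> set C"
  shows "\<exists>D. cyc (p # D) \<and> set (p # D) = set C \<and> length (p # D) = length C"
proof -
  from split_list[OF assms(2)] obtain a b where ab: "C = a @ p # b" by blast
  then show ?thesis
    using cyc_append_commute[of a p b] assms(1) by (intro exI[of _ "b @ a"]) auto
qed

text \<open>Edges that cross in the order along \<open>C\<close> become the chords of
  \<open>no_crossing_chords\<close> once the cycle is rotated to start at the first of the four
  vertices.\<close>

lemma hamiltonian_noncrossing:
  assumes "cyc C" shows "\<exists>pos. noncrossing adj (set C) pos"
proof -
  have dC: "distinct C" using assms by (simp add: cyc_def)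
  define pos where "pos x = (THE i. i < length C \<and> C ! i = x)" for x
  have pos: "pos (C ! i) = i" if "i < length C" for i
    unfolding pos_def using that dC by (auto simp: nth_eq_iff_index_eq)
  have "inj_on pos (set C)"
  proof (rule inj_onI)
    fix x y assume "x \<in> set C" "y \<in> set C" "pos x = pos y"
    then show "x = y" using pos by (metis in_set_conv_nth)
  qed
  moreover have "\<not> (adj a c \<and> adj b d)"
    if h: "a \<in> set C" "b \<in> set C" "c \<in> set C" "d \<in> set C" "pos a < pos b" "pos b < pos c" "pos c < pos d" for a b c d
  proof
    assume ad: "adj a c \<and> adj b d"
    have nth: "C ! pos x = x \<and> pos x < length C" if "x \<in> set C" for x
      using that pos by (metis in_set_conv_nth)
    have split: "\<exists>l m. D = l @ x # m \<and> length l = i" if "i < length D" "D ! i = x" for i D and x :: 'a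
      using id_take_nth_drop[OF that(1)] that
      by (metis length_take less_imp_le_nat min.absorb2)
    obtain l m where 1: "C = l @ a # m" "length l = pos a" using split[of "pos a" C a] nth[OF h(1)] by blast
    have "pos b - pos a - 1 < length m" "m ! (pos b - pos a - 1) = b"
      using 1 nth[OF h(2)] h(5) by (auto simp: nth_append nth_Cons')
    then obtain xs m2 where 2: "m = xs @ b # m2" "length xs = pos b - pos a - 1" using split by blast
    have "pos c - pos b - 1 < length m2" "m2 ! (pos c - pos b - 1) = c"
      using 1 2 nth[OF h(3)] h(5,6) by (auto simp: nth_append nth_Cons' split: if_splits)
    then obtain ys m3 where 3: "m2 = ys @ c # m3" "length ys = pos c - pos b - 1" using split by blast
    have "pos d - pos c - 1 < length m3" "m3 ! (pos d - pos c - 1) = d"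
      using 1 2 3 nth[OF h(4)] h(5-7) by (auto simp: nth_append nth_Cons' split: if_splits)
    then obtain zs m4 where 4: "m3 = zs @ d # m4" using split by blast
    have C: "C = l @ a # xs @ b # ys @ c # zs @ d # m4" using 1 2 3 4 by simp
    have "cyc (a # (xs @ b # ys @ c # zs @ d # m4) @ l)"
      using cyc_append_commute[of l a "xs @ b # ys @ c # zs @ d # m4"] assms C by simp
    then have "successively adj (a # xs @ b # ys @ c # zs @ d # (m4 @ l) @ [a])"
      "distinct (a # xs @ b # ys @ c # zs @ d # m4 @ l)" by (auto simp: cyc_def)
    then show False
      using no_crossing_chords[of a xs b ys c zs d "m4 @ l"] ad by simp
  qed
  ultimately show ?thesis unfolding noncrossing_def by blast
qed

text \<open>A component \<open>D\<close> of the vertices outside a longest cycle \<open>C\<close>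
  attaches to \<open>C\<close> at one vertex \<open>v\<close> at most. So \<open>v\<close> separates
  \<open>D\<close> from all the rest, and orders of the smaller sets \<open>U - D\<close> and
  \<open>insert v D\<close> are glued at \<open>v\<close>.\<close>

theorem noncrossing_order:
  assumes "U \<subseteq> V" shows "\<exists>pos. noncrossing adj U pos"
proof -
  have "finite U" using assms finV finite_subset by blast
  then show ?thesis using assms
  proof (induction rule: finite_psubset_induct)
    case (psubset U)
    show ?case
    proof (cases "\<exists>x\<in>U. \<exists>y\<in>U. adj x y")
      case False
      obtain pos :: "'a \<Rightarrow> nat" where "inj_on pos U"
        using psubset.hyps finite_imp_inj_to_nat_seg by blast
      then show ?thesis using False unfolding noncrossing_def by blast
    next
      case True
      then obtain x y where xy: "x \<in> U" "y \<in> U" "adj x y" by blast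
      let ?P = "\<lambda>C. cyc C \<and> set C \<subseteq> U"
      have "?P [x, y]" using xy adj_sym adj_irrefl unfolding cyc_def by auto
      moreover have "length C < Suc (card U)" if "?P C" for C
        using that psubset.hyps card_mono[of U "set C"] distinct_card[of C] unfolding cyc_def by simp
      ultimately obtain C where C: "?P C" "\<And>C'. ?P C' \<Longrightarrow> length C' \<le> length C"
        using ex_has_greatest_nat[of ?P "[x, y]" length "Suc (card U)"] by (metis less_imp_le)
      show ?thesis
      proof (cases "set C = U")
        case True
        then show ?thesis using hamiltonian_noncrossing C(1) by metis
      next
        case False
        then obtain d0 where d0: "d0 \<in> U - set C" using C(1) by blast
        let ?S = "U - set C"
        let ?R = "{(x, y). adj x y \<and> x \<in> ?S \<and> y \<in> ?S}"
        define D where "D = {z. (d0, z) \<in> ?R\<^sup>*}"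
        have symR: "sym (?R\<^sup>*)" by (rule sym_rtrancl) (auto simp: sym_def adj_sym)
        have DS: "D \<subseteq> ?S"
        proof
          fix z assume "z \<in> D"
          then have "(d0, z) \<in> ?R\<^sup>*" by (simp add: D_def)
          then show "z \<in> ?S" by (induction rule: rtrancl_induct) (use d0 in auto)
        qed
        have d0D: "d0 \<in> D" by (simp add: D_def)
        have closedD: "y \<in> D" if "x \<in> D" "adj x y" "y \<in> ?S" for x y
        proof -
          have "(x, y) \<in> ?R" using that DS by blast
          then show ?thesis using that(1) unfolding D_def by (simp add: rtrancl.rtrancl_into_rtrancl)
        qed
        have one: "p = q" if pq: "p \<in> set C" "q \<in> set C" "d1 \<in> D" "d2 \<in> D" "adj p d1" "adj q d2" for p q d1 d2
        proof (rule ccontr)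
          assume "p \<noteq> q"
          have "(d0, d1) \<in> ?R\<^sup>*" "(d0, d2) \<in> ?R\<^sup>*" using pq(3,4) by (simp_all add: D_def)
          then have "(d1, d2) \<in> ?R\<^sup>*" using rtrancl_trans[OF symD[OF symR]] by blast
          then obtain ds where ds: "ds \<noteq> []" "hd ds = d1" "last ds = d2" "distinct ds" "successively adj ds" "set ds \<subseteq> ?S"
            using rtrancl_distinct_walk[of d1 d2 adj ?S] pq(3) DS by blast
          obtain T where T: "cyc (p # T)" "set (p # T) = set C" "length (p # T) = length C"
            using cyc_rotate[of C p] C(1) pq(1) by blast
          have "q \<in> set T" using T(2) pq(2) \<open>p \<noteq> q\<close> by auto
          from split_list[OF this] obtain xs ys where T': "T = xs @ q # ys" by blast
          have su: "successively adj (p # xs @ q # ys @ [p])" and di: "distinct (p # xs @ q # ys)"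
            using T(1) unfolding T' cyc_def by auto
          have sX: "successively adj (p # xs @ [q])" and sY: "successively adj (q # ys @ [p])"
            using su successively_split[of adj "p # xs" q "ys @ [p]"] by auto
          have sD: "successively adj (p # ds @ [q])"
            using ds pq(5,6) adj_sym by (auto simp: successively_append_iff successively_Cons)
          have dsC: "set ds \<inter> set (p # xs @ q # ys) = {}" using ds(6) T(2) T' by auto
          have sub: "set (p # xs @ q # ys) \<subseteq> U" using T(2) T' C(1) by auto
          \<comment> \<open>If \<open>p\<close> and \<open>q\<close> are neighbours on
            \<open>C\<close>, the detour \<open>ds\<close> gives a longer cycle; otherwise it forms
            a theta with the two arcs of \<open>C\<close>.\<close>
          consider "xs = []" | "ys = []" | "xs \<noteq> []" "ys \<noteq> []" by blast
          then show False
          proof cases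
            case 1
            have "successively adj ((p # ds @ q # ys) @ [p])"
              using sD sY successively_split[of adj "p # ds" q "ys @ [p]"] by auto
            then have "?P (p # ds @ q # ys)" using di ds dsC sub 1 unfolding cyc_def by auto
            from C(2)[OF this] show False using T(3) T' 1 ds(1) by (cases ds) auto
          next
            case 2
            have "successively adj (q # rev ds @ [p])" using walk_rev[OF sD] by simp
            then have "successively adj ((p # xs @ q # rev ds) @ [p])"
              using sX successively_split[of adj "p # xs" q "rev ds @ [p]"] by auto
            then have "?P (p # xs @ q # rev ds)" using di ds dsC sub 2 unfolding cyc_def by auto
            from C(2)[OF this] show False using T(3) T' 2 ds(1) by (cases ds) auto
          next
            case 3
            have "successively adj (p # rev ys @ [q])" using walk_rev[OF sY] by simp
            then show False
              using no_theta[OF sX _ sD, of "rev ys"] 3 ds(1) di dsC \<open>p \<noteq> q\<close> by auto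
          qed
        qed
        have "\<exists>v\<in>set C. \<forall>p\<in>set C. \<forall>d\<in>D. adj p d \<longrightarrow> p = v"
        proof (cases "\<exists>p\<in>set C. \<exists>d\<in>D. adj p d")
          case True
          then show ?thesis using one by blast
        next
          case False
          \<comment> \<open>When \<open>D\<close> is not attached to \<open>C\<close>, any vertex of
            \<open>C\<close> serves as the gluing point.\<close>
          have "C \<noteq> []" using C(1) by (auto simp: cyc_def)
          then show ?thesis using False hd_in_set by blast
        qed
        then obtain v where v: "v \<in> set C" "\<And>p d. p \<in> set C \<Longrightarrow> d \<in> D \<Longrightarrow> adj p d \<Longrightarrow> p = v" by blast
        have CU: "set C \<subseteq> U" and cC: "cyc C" using C(1) by auto
        have "U - D \<subset> U" using d0D DS by blast
        then obtain p1 where p1: "noncrossing adj (U - D) p1" using psubset.IH psubset.prems by blast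
        \<comment> \<open>A second vertex of \<open>C\<close> makes \<open>insert v D\<close> a
          proper subset of \<open>U\<close>, as the induction hypothesis requires.\<close>
        have "\<not> set C \<subseteq> {v}"
        proof
          assume "set C \<subseteq> {v}"
          then have "card (set C) \<le> card {v}" by (intro card_mono) auto
          then show False using cC distinct_card[of C] by (auto simp: cyc_def)
        qed
        then have "insert v D \<subset> U" using DS v(1) CU by blast
        then obtain p2 where p2: "noncrossing adj (insert v D) p2" using psubset.IH psubset.prems by (meson dual_order.trans psubset_imp_subset)
        have "\<exists>p. noncrossing adj ((U - D) \<union> D) p"
        proof (rule noncrossing_glue[OF adj_sym _ _ _ _ _ p1 p2])
          show "finite (U - D)" "finite D" using psubset.hyps DS finite_subset by auto
          show "v \<in> U - D" using v(1) CU DS by blast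
          show "x = v" if "x \<in> U - D" "y \<in> D" "adj x y" for x y
            using that closedD[OF that(2) adj_sym[OF that(3)]] v(2) by blast
        qed auto
        moreover have "(U - D) \<union> D = U" using DS by blast
        ultimately show ?thesis by simp
      qed
    qed
  qed
qed

end

section \<open>Winding data from three linear orders\<close>

text \<open>In a chain of three nonempty proper subsets of a three-element set the middle one equals
  a neighbour, since only the sizes 1 and 2 occur; the passage between equal sets is
  trivial.\<close>

lemma tau_triangle:
  fixes a1 a2 a3 b1 b2 b3 c1 c2 c3 :: bool
  assumes "a1 \<longrightarrow> b1" "a2 \<longrightarrow> b2" "a3 \<longrightarrow> b3" "b1 \<longrightarrow> c1" "b2 \<longrightarrow> c2" "b3 \<longrightarrow> c3"
    "a1 \<or> a2 \<or> a3" "\<not> (c1 \<and> c2 \<and> c3)"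
  shows "of_bool b1 * (of_bool a2 + of_bool b2) + of_bool c1 * (of_bool b2 + of_bool c2) =
    (of_bool c1 * (of_bool a2 + of_bool c2) :: bit)"
  using assms by auto

text \<open>Index 2 is gained on just two sides of the hexagon, from \<open>{1}\<close> to
  \<open>{1, 2}\<close> and from \<open>{3}\<close> to \<open>{2, 3}\<close>. They are antipodal,
  and each summand counts one of them.\<close>

lemma tau_complement:
  fixes a1 a2 a3 b1 b2 b3 :: bool
  assumes "a1 \<longrightarrow> b1" "a2 \<longrightarrow> b2" "a3 \<longrightarrow> b3" "a1 \<or> a2 \<or> a3" "\<not> (b1 \<and> b2 \<and> b3)"
  shows "of_bool b1 * (of_bool a2 + of_bool b2) + of_bool (\<not> a1) * (of_bool (\<not> b2) + of_bool (\<not> a2)) =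
    (of_bool a2 + of_bool b2 :: bit)"
  using assms by auto

text \<open>Cells enter through embeddings and orders as strict relations, so that exchanging
  \<open>cv\<close> with \<open>cf\<close> and reversing the relations yields the dual instance. The
  topology is condensed into \<open>incid_orthogonal\<close> and \<open>region\<close>.\<close>

locale realized_map =
  fixes V :: "'v set" and E :: "'e set" and Fs :: "'f set"
    and en :: "'e \<Rightarrow> 'v set" and co :: "'e \<Rightarrow> 'f set" and inc :: "'v \<Rightarrow> 'f \<Rightarrow> bool"
    and cv :: "'v \<Rightarrow> 'c" and ce :: "'e \<Rightarrow> 'c" and cf :: "'f \<Rightarrow> 'c"
    and L1 L2 L3 :: "'c \<Rightarrow> 'c \<Rightarrow> bool"
  assumes finV: "finite V" and finE: "finite E" and finF: "finite Fs"
    and en_sub: "e \<in> E \<Longrightarrow> en e \<subseteq> V"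
    and co_sub: "e \<in> E \<Longrightarrow> co e \<subseteq> Fs"
    and inc_edge: "e \<in> E \<Longrightarrow> v \<in> en e \<Longrightarrow> F \<in> co e \<Longrightarrow> inc v F"
    and incid_orthogonal: "v \<in> V \<Longrightarrow> F \<in> Fs \<Longrightarrow> (\<Sum>e\<in>E. incid en v e * incid co F e) = 0"
    and region: "(\<And>w. w \<in> V \<Longrightarrow> bd E en c w = 0) \<Longrightarrow> v \<in> V \<Longrightarrow> (\<And>e. e \<in> E \<Longrightarrow> v \<in> en e \<Longrightarrow> c e = 0) \<Longrightarrow>
      \<exists>g. (\<forall>e\<in>E. cobd co g e = c e) \<and> (\<forall>F\<in>Fs. inc v F \<longrightarrow> g F = 0)"
    and distinct_cells: "cv v \<noteq> ce e" "ce e \<noteq> cf F" "cv v \<noteq> cf F" "cv v = cv v' \<longleftrightarrow> v = v'" "ce e = ce e' \<longleftrightarrow> e = e'"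
    and trans: "L1 x y \<Longrightarrow> L1 y z \<Longrightarrow> L1 x z" "L2 x y \<Longrightarrow> L2 y z \<Longrightarrow> L2 x z" "L3 x y \<Longrightarrow> L3 y z \<Longrightarrow> L3 x z"
    and total: "x \<in> cv ` V \<union> ce ` E \<union> cf ` Fs \<Longrightarrow> y \<in> cv ` V \<union> ce ` E \<union> cf ` Fs \<Longrightarrow> x \<noteq> y \<Longrightarrow>
      (L1 x y \<longleftrightarrow> \<not> L1 y x) \<and> (L2 x y \<longleftrightarrow> \<not> L2 y x) \<and> (L3 x y \<longleftrightarrow> \<not> L3 y x)"
    and lt_ve: "v \<in> V \<Longrightarrow> e \<in> E \<Longrightarrow> L1 (cv v) (ce e) \<and> L2 (cv v) (ce e) \<and> L3 (cv v) (ce e) \<longleftrightarrow> v \<in> en e"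
    and lt_ef: "e \<in> E \<Longrightarrow> F \<in> Fs \<Longrightarrow> L1 (ce e) (cf F) \<and> L2 (ce e) (cf F) \<and> L3 (ce e) (cf F) \<longleftrightarrow> F \<in> co e"
    and lt_vf: "v \<in> V \<Longrightarrow> F \<in> Fs \<Longrightarrow> L1 (cv v) (cf F) \<and> L2 (cv v) (cf F) \<and> L3 (cv v) (cf F) \<longleftrightarrow> inc v F"
    and not_lt: "v \<in> V \<Longrightarrow> v' \<in> V \<Longrightarrow> \<not> (L1 (cv v) (cv v') \<and> L2 (cv v) (cv v') \<and> L3 (cv v) (cv v'))"
      "v \<in> V \<Longrightarrow> e \<in> E \<Longrightarrow> \<not> (L1 (ce e) (cv v) \<and> L2 (ce e) (cv v) \<and> L3 (ce e) (cv v))"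
      "e \<in> E \<Longrightarrow> e' \<in> E \<Longrightarrow> \<not> (L1 (ce e) (ce e') \<and> L2 (ce e) (ce e') \<and> L3 (ce e) (ce e'))"
      "v \<in> V \<Longrightarrow> F \<in> Fs \<Longrightarrow> \<not> (L1 (cf F) (cv v) \<and> L2 (cf F) (cv v) \<and> L3 (cf F) (cv v))"
begin

section \<open>Passages through one side of the hexagon\<close>

abbreviation "cells \<equiv> cv ` V \<union> ce ` E \<union> cf ` Fs"

definition lt where "lt x y \<longleftrightarrow> L1 x y \<and> L2 x y \<and> L3 x y"

definition le where "le x y \<longleftrightarrow> x = y \<or> lt x y"

definition incomp where
  "incomp z w \<longleftrightarrow> z \<in> cells \<and> w \<in> cells \<and> z \<noteq> w \<and> \<not> lt z w \<and> \<not> lt w z"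

text \<open>Passages from \<open>(z, w)\<close> to \<open>(z', w')\<close> through the hexagon side between \<open>{1}\<close> and \<open>{1, 2}\<close>:
  the second coordinate changes only on this side and on the antipodal one, where \<open>1\<close> is absent.\<close>

definition pass :: "'c \<Rightarrow> 'c \<Rightarrow> 'c \<Rightarrow> 'c \<Rightarrow> bit" where
  "pass z w z' w' = of_bool (L1 w' z') * (of_bool (L2 w z) + of_bool (L2 w' z'))"

lemma L_mono:
  assumes "le z z'" "le w' w"
  shows "L1 w z \<longrightarrow> L1 w' z'" "L2 w z \<longrightarrow> L2 w' z'" "L3 w z \<longrightarrow> L3 w' z'"
  using assms unfolding le_def lt_def by (metis trans)+

lemma incomp_nonempty: "incomp z w \<Longrightarrow> L1 w z \<or> L2 w z \<or> L3 w z"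
  using total[of z w] unfolding incomp_def lt_def by blast

lemma pass_triangle:
  assumes "le z z'" "le w' w" "le z' z''" "le w'' w'" "incomp z w" "incomp z'' w''"
  shows "pass z w z' w' + pass z' w' z'' w'' = pass z w z'' w''"
  unfolding pass_def
  by (rule tau_triangle[OF L_mono[OF assms(1,2)] L_mono[OF assms(3,4)] incomp_nonempty[OF assms(5)]])
    (use assms(6) in \<open>auto simp: incomp_def lt_def\<close>)

lemma pass_complement:
  assumes "le z z'" "le w' w" "incomp z w" "incomp z' w'"
  shows "pass z w z' w' + pass w' z' w z = of_bool (L2 w z) + of_bool (L2 w' z')"
proof -
  have "L1 z w = (\<not> L1 w z)" "L2 z w = (\<not> L2 w z)" "L2 z' w' = (\<not> L2 w' z')"
    using total[of z w] total[of z' w'] assms(3,4) unfolding incomp_def by blast+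
  then show ?thesis
    unfolding pass_def using tau_complement[OF L_mono[OF assms(1,2)] incomp_nonempty[OF assms(3)]] assms(4)
    by (simp add: incomp_def lt_def)
qed

text \<open>An edge is traversed by climbing from one end to \<open>e\<close> and descending to the
  other; modulo 2 a descent counts like a climb.\<close>

definition wind :: "'e \<Rightarrow> 'v \<Rightarrow> bit" where
  "wind e v = (\<Sum>x\<in>V. incid en x e * pass (cv x) (cv v) (ce e) (cv v))"

lemma wind_pair:
  assumes "e \<in> E" "en e = {x, y}" "x \<noteq> y"
  shows "wind e v = pass (cv x) (cv v) (ce e) (cv v) + pass (cv y) (cv v) (ce e) (cv v)"
proof -
  have "wind e v = cobd en (\<lambda>x. pass (cv x) (cv v) (ce e) (cv v)) e"
    unfolding wind_def using cobd_incid[of V en e] finV en_sub[OF assms(1)] by simp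
  then show ?thesis using cobd_pair[of en e x y, OF assms(2)] by simp
qed

lemma incomp_vv: "x \<in> V \<Longrightarrow> y \<in> V \<Longrightarrow> x \<noteq> y \<Longrightarrow> incomp (cv x) (cv y)"
  using not_lt(1) distinct_cells unfolding incomp_def lt_def by auto

lemma incomp_ev: "x \<in> V \<Longrightarrow> e \<in> E \<Longrightarrow> x \<notin> en e \<Longrightarrow> incomp (ce e) (cv x) \<and> incomp (cv x) (ce e)"
  using not_lt(2) lt_ve distinct_cells(1)[of x e] unfolding incomp_def lt_def by auto

lemma incomp_ee: "e \<in> E \<Longrightarrow> f \<in> E \<Longrightarrow> e \<noteq> f \<Longrightarrow> incomp (ce e) (ce f)"
  using not_lt(3) distinct_cells unfolding incomp_def lt_def by auto

lemma incomp_fv: "x \<in> V \<Longrightarrow> F \<in> Fs \<Longrightarrow> \<not> inc x F \<Longrightarrow> incomp (cf F) (cv x)"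
  using not_lt(4) lt_vf distinct_cells(3)[of x F] unfolding incomp_def lt_def by auto

lemma le_ve: "e \<in> E \<Longrightarrow> x \<in> en e \<Longrightarrow> le (cv x) (ce e)"
  using lt_ve en_sub unfolding le_def lt_def by blast

lemma le_refl [simp]: "le x x"
  by (simp add: le_def)

abbreviation "u x y \<equiv> of_bool (L2 (cv y) (cv x)) :: bit"

text \<open>The two ways from \<open>(x, f)\<close> to \<open>(e, y)\<close>, over
  \<open>(x, y)\<close> and over \<open>(e, f)\<close>, have equally many passages modulo 2.
  \<open>pass_complement\<close> turns the leg from \<open>(x, f)\<close> to \<open>(x, y)\<close>
  into the passage of the exchanged pair.\<close>

lemma corner:
  assumes e: "e \<in> E" "x \<in> en e" and f: "f \<in> E" "y \<in> en f" and dis: "en e \<inter> en f = {}"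
  shows "pass (cv x) (cv y) (ce e) (cv y) + pass (cv y) (cv x) (ce f) (cv x) +
    pass (cv x) (ce f) (ce e) (ce f) + pass (ce e) (ce f) (ce e) (cv y) = of_bool (L2 (ce f) (cv x)) + u x y"
proof -
  have V: "x \<in> V" "y \<in> V" using e f en_sub by auto
  have ne: "e \<noteq> f" "x \<noteq> y" "x \<notin> en f" "y \<notin> en e" using e f dis by auto
  note i = incomp_vv[OF V ne(2)] incomp_ev[OF V(1) f(1) ne(3)] incomp_ev[OF V(2) e(1) ne(4)] incomp_ee[OF e(1) f(1) ne(1)]
  note l = le_ve[OF e] le_ve[OF f]
  have 1: "pass (cv x) (ce f) (cv x) (cv y) + pass (cv x) (cv y) (ce e) (cv y) = pass (cv x) (ce f) (ce e) (cv y)"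
    by (rule pass_triangle) (use i l in auto)
  have 2: "pass (cv x) (ce f) (ce e) (ce f) + pass (ce e) (ce f) (ce e) (cv y) = pass (cv x) (ce f) (ce e) (cv y)"
    by (rule pass_triangle) (use i l in auto)
  have 3: "pass (cv x) (ce f) (cv x) (cv y) + pass (cv y) (cv x) (ce f) (cv x) = of_bool (L2 (ce f) (cv x)) + u x y"
    by (rule pass_complement) (use i l in auto)
  from 1 2 have "pass (cv x) (cv y) (ce e) (cv y) + pass (cv x) (ce f) (ce e) (ce f) + pass (ce e) (ce f) (ce e) (cv y)
    = pass (cv x) (ce f) (cv x) (cv y)"
    by (metis add.assoc add.commute bit_add_left_self)
  then show ?thesis unfolding 3[symmetric] by (simp add: ac_simps)
qed

lemma square_identity:
  assumes e: "e \<in> E" "en e = {x, x'}" "x \<noteq> x'" and f: "f \<in> E" "en f = {y, y'}" "y \<noteq> y'"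
    and dis: "{x, x'} \<inter> {y, y'} = {}"
  shows "wind e y + wind e y' + wind f x + wind f x' = u y x + u y' x + u y x' + u y' x'"
proof -
  have V: "x \<in> V" "x' \<in> V" "y \<in> V" "y' \<in> V" using e f en_sub by auto
  have flip: "u a b = u b a + 1" if "a \<in> V" "b \<in> V" "a \<noteq> b" for a b
    using total[of "cv a" "cv b"] that distinct_cells(4) by auto
  have us: "u y x = u x y + 1" "u y' x = u x y' + 1" "u y x' = u x' y + 1" "u y' x' = u x' y' + 1"
    using flip V dis by blast+
  have c: "pass (cv a) (cv b) (ce e) (cv b) + pass (cv b) (cv a) (ce f) (cv a) +
    pass (cv a) (ce f) (ce e) (ce f) + pass (ce e) (ce f) (ce e) (cv b) = of_bool (L2 (ce f) (cv a)) + u a b"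
    if "a \<in> en e" "b \<in> en f" for a b using corner[OF e(1) that(1) f(1) that(2)] e(2) f(2) dis by simp
  have mem: "x \<in> en e" "x' \<in> en e" "y \<in> en f" "y' \<in> en f" using e f by auto
  note c4 = c[OF mem(1) mem(3)] c[OF mem(1) mem(4)] c[OF mem(2) mem(3)] c[OF mem(2) mem(4)]
  \<comment> \<open>The legs at \<open>(e, f)\<close> and the terms comparing \<open>f\<close> with
    an end of \<open>e\<close> are each shared by two corners and cancel. Replacing the four
    \<open>u x y\<close> by \<open>u y x\<close> adds 4 = 0.\<close>
  have "(pass (cv x) (cv y) (ce e) (cv y) + pass (cv y) (cv x) (ce f) (cv x) +
    pass (cv x) (ce f) (ce e) (ce f) + pass (ce e) (ce f) (ce e) (cv y)) +
    (pass (cv x) (cv y') (ce e) (cv y') + pass (cv y') (cv x) (ce f) (cv x) +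
    pass (cv x) (ce f) (ce e) (ce f) + pass (ce e) (ce f) (ce e) (cv y')) +
    (pass (cv x') (cv y) (ce e) (cv y) + pass (cv y) (cv x') (ce f) (cv x') +
    pass (cv x') (ce f) (ce e) (ce f) + pass (ce e) (ce f) (ce e) (cv y)) +
    (pass (cv x') (cv y') (ce e) (cv y') + pass (cv y') (cv x') (ce f) (cv x') +
    pass (cv x') (ce f) (ce e) (ce f) + pass (ce e) (ce f) (ce e) (cv y')) =
    (of_bool (L2 (ce f) (cv x)) + u x y) + (of_bool (L2 (ce f) (cv x)) + u x y') +
    (of_bool (L2 (ce f) (cv x')) + u x' y) + (of_bool (L2 (ce f) (cv x')) + u x' y')"
    unfolding c4 ..
  then show ?thesis
    unfolding us wind_pair[OF e] wind_pair[OF f] by (simp only: ac_simps bit_add_self bit_add_left_self add_0_left add_0_right)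
qed

text \<open>By adjointness the sum runs over the faces of a region away from \<open>v\<close>, and
  each contributes 0: climbing on from \<open>e\<close> to \<open>F\<close> replaces a passage by
  one term depending on the end and \<open>F\<close> and one depending on \<open>e\<close> and
  \<open>F\<close>. The former cancel because the edges of \<open>F\<close> at a vertex come in
  pairs, the latter because an edge has two ends.\<close>

lemma region_sum:
  assumes c: "\<And>w. w \<in> V \<Longrightarrow> bd E en c w = 0" and v: "v \<in> V" "\<And>e. e \<in> E \<Longrightarrow> v \<in> en e \<Longrightarrow> c e = 0"
  shows "(\<Sum>e\<in>E. c e * wind e v) = 0"
proof -
  obtain g where g: "\<And>e. e \<in> E \<Longrightarrow> cobd co g e = c e" "\<And>F. F \<in> Fs \<Longrightarrow> inc v F \<Longrightarrow> g F = 0"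
    using region[of c v, OF c v] by blast
  have zero: "g F * bd E co (\<lambda>e. wind e v) F = 0" if F: "F \<in> Fs" for F
  proof (cases "inc v F")
    case True
    then show ?thesis using g(2)[OF F] by simp
  next
    case False
    let ?t = "\<lambda>x. pass (cv x) (cv v) (cf F) (cv v)"
    have "incid co F e * wind e v = incid co F e * (\<Sum>x\<in>V. incid en x e * ?t x)" if e: "e \<in> E" for e
    proof (cases "F \<in> co e")
      case True
      have nv: "v \<notin> en e" using False inc_edge[OF e _ True] by blast
      have le: "le (ce e) (cf F)" using lt_ef[OF e F] True by (simp add: le_def lt_def)
      have "incid en x e * pass (cv x) (cv v) (ce e) (cv v) =
        incid en x e * ?t x + incid en x e * pass (ce e) (cv v) (cf F) (cv v)" if x: "x \<in> V" for x
      proof (cases "x \<in> en e")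
        case True
        have "pass (cv x) (cv v) (ce e) (cv v) + pass (ce e) (cv v) (cf F) (cv v) = ?t x"
        proof (rule pass_triangle)
          show "incomp (cv x) (cv v)" using incomp_vv[OF x v(1)] True nv by blast
          show "incomp (cf F) (cv v)" using incomp_fv[OF v(1) F False] .
        qed (use le le_ve[OF e True] in auto)
        then have "pass (cv x) (cv v) (ce e) (cv v) = ?t x + pass (ce e) (cv v) (cf F) (cv v)"
          by (metis add.commute bit_add_left_self)
        then show ?thesis by (simp add: distrib_left)
      next
        case False
        then show ?thesis by (simp add: incid_def)
      qed
      then have "wind e v = (\<Sum>x\<in>V. incid en x e * ?t x) + (\<Sum>x\<in>V. incid en x e * pass (ce e) (cv v) (cf F) (cv v))"
        unfolding wind_def by (simp add: sum.distrib cong: sum.cong)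
      moreover have "(\<Sum>x\<in>V. incid en x e * pass (ce e) (cv v) (cf F) (cv v)) = 0"
        using cobd_incid[of V en e "\<lambda>_. pass (ce e) (cv v) (cf F) (cv v)"] finV en_sub[OF e] by (simp add: cobd_const)
      ultimately show ?thesis by simp
    next
      case False
      then show ?thesis by (simp add: incid_def)
    qed
    then have "bd E co (\<lambda>e. wind e v) F = (\<Sum>e\<in>E. \<Sum>x\<in>V. incid co F e * (incid en x e * ?t x))"
      unfolding bd_def by (simp add: sum_distrib_left cong: sum.cong)
    also have "\<dots> = (\<Sum>x\<in>V. \<Sum>e\<in>E. incid co F e * (incid en x e * ?t x))" by (rule sum.swap)
    also have "\<dots> = (\<Sum>x\<in>V. (\<Sum>e\<in>E. incid en x e * incid co F e) * ?t x)"
      by (intro sum.cong refl) (simp add: sum_distrib_left mult_ac)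
    also have "\<dots> = 0" using incid_orthogonal[OF _ F] by simp
    finally show ?thesis by simp
  qed
  have "(\<Sum>e\<in>E. c e * wind e v) = (\<Sum>e\<in>E. wind e v * cobd co g e)"
    using g(1) by (intro sum.cong refl) (simp add: mult.commute)
  also have "\<dots> = (\<Sum>F\<in>Fs. g F * bd E co (\<lambda>e. wind e v) F)" by (rule cobd_bd[OF finF co_sub])
  also have "\<dots> = 0" by (intro sum.neutral ballI zero)
  finally show ?thesis .
qed

section \<open>Winding along walks\<close>

definition adj :: "'v \<Rightarrow> 'v \<Rightarrow> bool" where
  "adj x y \<longleftrightarrow> x \<noteq> y \<and> (\<exists>e\<in>E. en e = {x, y})"

text \<open>One of several parallel edges is fixed; choosing by the unordered pair makes the choice
  symmetric, as \<open>nn_sym\<close> demands.\<close>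

definition ed :: "'v \<Rightarrow> 'v \<Rightarrow> 'e" where
  "ed x y = (SOME e. e \<in> E \<and> en e = {x, y})"

lemma ed: "adj x y \<Longrightarrow> ed x y \<in> E \<and> en (ed x y) = {x, y}"
  unfolding adj_def ed_def by (rule someI_ex) blast

lemma ed_sym: "ed x y = ed y x"
  by (simp add: ed_def insert_commute)

text \<open>An edge walked twice cancels, so even a closed walk that repeats edges becomes an even
  chain, to which \<open>region_sum\<close> applies.\<close>

fun wchain :: "'v list \<Rightarrow> 'e \<Rightarrow> bit" where
  "wchain (x # y # p) e = of_bool (e = ed x y) + wchain (y # p) e"
| "wchain _ e = 0"

lemma bd_wchain:
  "successively adj p \<Longrightarrow> p \<noteq> [] \<Longrightarrow> bd E en (wchain p) v = of_bool (v = hd p) + of_bool (v = last p)"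
proof (induction p rule: induct_list012)
  case (3 x y zs)
  have e: "ed x y \<in> E" "en (ed x y) = {x, y}" using ed[of x y] 3 by auto
  have "bd E en (wchain (x # y # zs)) v = bd E en (\<lambda>e. of_bool (e = ed x y) + wchain (y # zs) e) v"
    by (rule bd_cong) simp
  also have "\<dots> = incid en v (ed x y) + bd E en (wchain (y # zs)) v"
    by (simp add: bd_add bd_single[OF finE e(1)])
  also have "incid en v (ed x y) = of_bool (v = x) + of_bool (v = y)"
    by (rule incid_pair[of en "ed x y" x y, OF e(2)])
  also have "bd E en (wchain (y # zs)) v = of_bool (v = y) + of_bool (v = last (y # zs))"
    using 3 by simp
  finally show ?case by (simp add: ac_simps)
qed (auto simp: bd_def)

lemma sum_wchain:
  "successively adj p \<Longrightarrow> (\<Sum>e\<in>E. wchain p e * wind e v) = walk_sum (\<lambda>x y. wind (ed x y)) p v"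
proof (induction p rule: induct_list012)
  case (3 x y zs)
  have e: "ed x y \<in> E" using ed[of x y] 3 by auto
  have "(\<Sum>e\<in>E. of_bool (e = ed x y) * wind e v) = (\<Sum>e\<in>E. if e = ed x y then wind e v else 0)"
    by (intro sum.cong) auto
  also have "\<dots> = wind (ed x y) v" using e finE by simp
  finally show ?case using 3 by (simp add: distrib_right sum.distrib)
qed auto

lemma wchain_zero:
  "successively adj p \<Longrightarrow> v \<notin> set p \<Longrightarrow> v \<in> en e \<Longrightarrow> wchain p e = 0"
proof (induction p rule: induct_list012)
  case (3 x y zs)
  have "e \<noteq> ed x y" using ed[of x y] 3 by auto
  then show ?case using 3 by simp
qed auto

lemma closed_walk_zero:
  assumes "p \<noteq> []" "successively adj p" "hd p = last p" "v \<in> V" "v \<notin> set p"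
  shows "walk_sum (\<lambda>x y. wind (ed x y)) p v = 0"
proof -
  have "(\<Sum>e\<in>E. wchain p e * wind e v) = 0"
    by (rule region_sum) (use assms bd_wchain[OF assms(2,1)] wchain_zero[OF assms(2,5)] in auto)
  then show ?thesis using sum_wchain[OF assms(2)] by simp
qed

lemma winding: "winding_data V adj (\<lambda>x y. wind (ed x y)) u"
proof
  show "finite V" by (rule finV)
  show "adj x y \<Longrightarrow> adj y x" for x y by (auto simp: adj_def insert_commute)
  show "\<not> adj x x" for x by (simp add: adj_def)
  show "adj x y \<Longrightarrow> x \<in> V" for x y using en_sub unfolding adj_def by blast
  show "wind (ed x y) v = wind (ed y x) v" for x y v by (simp add: ed_sym)
  show "u x y + u y x = 1" if "x \<in> V" "y \<in> V" "x \<noteq> y" for x y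
    using total[of "cv x" "cv y"] that distinct_cells(4) by auto
  show "wind (ed x x') y + wind (ed x x') y' + wind (ed y y') x + wind (ed y y') x' = u y x + u y' x + u y x' + u y' x'"
    if h: "adj x x'" "adj y y'" "{x, x'} \<inter> {y, y'} = {}" for x x' y y'
    by (rule square_identity) (use ed[OF h(1)] ed[OF h(2)] h in \<open>auto simp: adj_def\<close>)
  show "walk_sum (\<lambda>x y. wind (ed x y)) p v = 0"
    if "p \<noteq> []" "successively adj p" "hd p = last p" "v \<in> V" "v \<notin> set p" for p v
    using closed_walk_zero[OF that] .
qed

lemma noncrossing_exists: "\<exists>pos. noncrossing (\<lambda>x y. x \<noteq> y \<and> (\<exists>e\<in>E. en e = {x, y})) V pos"
  using winding_data.noncrossing_order[OF winding order_refl] unfolding adj_def .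

end

section \<open>Drawing a noncrossing order\<close>

lemma of_nat_eq_if_close:
  assumes "\<bar>real m - real n\<bar> < 1" shows "m = n"
proof -
  have "real m < real (Suc n)" "real n < real (Suc m)" using assms by auto
  then show ?thesis unfolding of_nat_less_iff by simp
qed

text \<open>Vertices sit on the imaginary axis at the heights \<open>pos\<close>, loops are circles
  touching the axis from the left, and the other edges are parabolic arcs on the right. The outer
  face reaches each vertex from the left, between the loops.\<close>

lemma noncrossing_imp_outerplanar:
  fixes G :: "('v, 'e) multigraph"
  assumes G: "finite_multigraph G"
    and nc: "noncrossing (\<lambda>x y. x \<noteq> y \<and> (\<exists>e\<in>edges G. ends G e = {x, y})) (verts G) pos"
  shows "outerplanar G"
proof -
  let ?V = "verts G" and ?E = "edges G" and ?en = "ends G"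
  have fin: "finite ?V" "finite ?E" using G by (auto simp: finite_multigraph_def)
  have inj: "inj_on pos ?V" using nc by (simp add: noncrossing_def)
  obtain idx :: "'e \<Rightarrow> nat" where idx: "inj_on idx ?E" using finite_imp_inj_to_nat_seg[OF fin(2)] by blast
  \<comment> \<open>A number private to each edge tells parallel edges and loops at one vertex
    apart. Being below 1/2, it cannot outweigh an integer difference of lengths in \<open>h\<close>,
    and circles at different vertices stay disjoint.\<close>
  define \<rho> where "\<rho> e = 1 / (real (idx e) + 3)" for e
  have \<rho>: "0 < \<rho> e" "\<rho> e < 1/2" for e by (auto simp: \<rho>_def field_simps)
  have \<rho>_inj: "\<rho> e = \<rho> f \<Longrightarrow> e = f" if "e \<in> ?E" "f \<in> ?E" for e f
    using idx that by (auto simp: \<rho>_def inj_on_def)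
  define lo where "lo e = Min (pos ` ?en e)" for e
  define hi where "hi e = Max (pos ` ?en e)" for e
  \<comment> \<open>A longer chord gets a larger factor, so that of two nested chords the inner one
    stays strictly closer to the axis.\<close>
  define h where "h e = real (hi e - lo e) + \<rho> e" for e
  define cu where "cu e = (if lo e < hi e
     then (\<lambda>t. Complex (h e * (t * (real (hi e) - real (lo e))) * ((1 - t) * (real (hi e) - real (lo e))))
                       (real (lo e) + t * (real (hi e) - real (lo e))))
     else circlepath (Complex (- \<rho> e) (real (lo e))) (\<rho> e))" for e
  define pt where "pt v = Complex 0 (real (pos v))" for v
  define Dr where "Dr = \<lparr>point = pt, curve = cu\<rparr>"
  have ends: "?en e \<subseteq> ?V" "card (?en e) = 1 \<or> card (?en e) = 2" if "e \<in> ?E" for e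
    using G that by (auto simp: finite_multigraph_def)
  have loop: "\<exists>a\<in>?V. ?en e = {a} \<and> pos a = lo e \<and> hi e = lo e" if e: "e \<in> ?E" "\<not> lo e < hi e" for e
  proof -
    obtain a b where ab: "?en e = {a, b}"
      using ends(2)[OF e(1)] by (metis card_1_singletonE card_2_iff insert_absorb2)
    have "pos a = pos b" using e(2) by (auto simp: lo_def hi_def ab min_def max_def split: if_splits)
    then have "a = b" using inj ends(1)[OF e(1)] ab by (auto dest: inj_onD)
    then show ?thesis using ab ends(1)[OF e(1)] by (auto simp: lo_def hi_def)
  qed
  have chord: "\<exists>a\<in>?V. \<exists>b\<in>?V. a \<noteq> b \<and> ?en e = {a, b} \<and> pos a = lo e \<and> pos b = hi e"
    if e: "e \<in> ?E" "lo e < hi e" for e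
  proof -
    obtain a b where ab: "?en e = {a, b}"
      using ends(2)[OF e(1)] by (metis card_1_singletonE card_2_iff insert_absorb2)
    have V: "a \<in> ?V" "b \<in> ?V" using ends(1)[OF e(1)] ab by auto
    have mm: "lo e = min (pos a) (pos b)" "hi e = max (pos a) (pos b)" by (simp_all add: lo_def hi_def ab)
    show ?thesis
    proof (cases "pos a \<le> pos b")
      case True
      then have "a \<noteq> b \<and> ?en e = {a, b} \<and> pos a = lo e \<and> pos b = hi e" using mm ab e(2) by auto
      then show ?thesis using V by blast
    next
      case False
      then have "b \<noteq> a \<and> ?en e = {b, a} \<and> pos b = lo e \<and> pos a = hi e" using mm ab by auto
      then show ?thesis using V by blast
    qed
  qed
  have im_chord: "Re z = h e * (Im z - real (lo e)) * (real (hi e) - Im z) \<and> real (lo e) \<le> Im z \<and> Im z \<le> real (hi e)"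
    if h: "lo e < hi e" "z \<in> path_image (cu e)" for e z
  proof -
    obtain t where t: "0 \<le> t" "t \<le> 1" "z = cu e t" using h(2) by (auto simp: path_image_def)
    define d where "d = real (hi e) - real (lo e)"
    have "Re z = h e * (t * d) * ((1 - t) * d)" "Im z = real (lo e) + t * d"
      using t(3) h(1) by (simp_all add: cu_def d_def)
    moreover have "real (hi e) - Im z = (1 - t) * d"
      unfolding calculation(2) by (simp add: d_def algebra_simps)
    moreover have "0 \<le> t * d" "0 \<le> (1 - t) * d" using t h(1) by (auto simp: d_def)
    ultimately show ?thesis by simp
  qed
  have im_loop: "(Re z)\<^sup>2 + 2 * \<rho> e * Re z + (Im z - real (lo e))\<^sup>2 = 0"
    if "\<not> lo e < hi e" "z \<in> path_image (cu e)" for e z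
  proof -
    have "z \<in> sphere (Complex (- \<rho> e) (real (lo e))) (\<rho> e)"
      using that \<rho>(1)[of e] by (simp add: cu_def)
    then have "cmod (z - Complex (- \<rho> e) (real (lo e))) = \<rho> e" by (simp add: dist_norm norm_minus_commute)
    then have "(cmod (z - Complex (- \<rho> e) (real (lo e))))\<^sup>2 = (\<rho> e)\<^sup>2" by simp
    then have "(Re z + \<rho> e)\<^sup>2 + (Im z - real (lo e))\<^sup>2 = (\<rho> e)\<^sup>2" by (simp add: cmod_power2)
    then show ?thesis by (simp add: power2_eq_square algebra_simps)
  qed
  have loop_Re: "Re z \<le> 0" "\<bar>Im z - real (lo e)\<bar> \<le> \<rho> e" "Re z \<ge> -1"
    if "\<not> lo e < hi e" "z \<in> path_image (cu e)" for e z
  proof -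
    note eq = im_loop[OF that]
    have "Re z * (Re z + 2 * \<rho> e) \<le> 0" using eq zero_le_power2[of "Im z - real (lo e)"]
      by (simp add: power2_eq_square algebra_simps)
    then show "Re z \<le> 0" "Re z \<ge> -1" using \<rho>[of e] by (auto simp: mult_le_0_iff)
    have "(Im z - real (lo e))\<^sup>2 + (Re z + \<rho> e)\<^sup>2 = (\<rho> e)\<^sup>2"
      using eq by (simp add: power2_eq_square algebra_simps)
    then have "(Im z - real (lo e))\<^sup>2 \<le> (\<rho> e)\<^sup>2" using zero_le_power2[of "Re z + \<rho> e"] by linarith
    then show "\<bar>Im z - real (lo e)\<bar> \<le> \<rho> e" using \<rho>(1)[of e] abs_le_square_iff[of "Im z - real (lo e)" "\<rho> e"] by simp
  qed
  have hpos: "h e > 0" for e using \<rho>(1)[of e] by (simp add: h_def add_nonneg_pos)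
  have chord_Re: "Re z \<ge> 0" if "lo e < hi e" "z \<in> path_image (cu e)" for e z
    using im_chord[OF that] hpos[of e] by simp
  have Re0: "z \<in> pt ` ?en e" if e: "e \<in> ?E" and z: "z \<in> path_image (cu e)" "Re z = 0" for e z
  proof (cases "lo e < hi e")
    case True
    from chord[OF e True] obtain a b where ab: "?en e = {a, b}" "pos a = lo e" "pos b = hi e" by blast
    have "Im z = real (lo e) \<or> Im z = real (hi e)"
      using im_chord[OF True z(1)] z(2) hpos[of e] by auto
    then have "z = pt a \<or> z = pt b" using ab z(2) by (auto simp: pt_def complex_eq_iff)
    then show ?thesis using ab by auto
  next
    case False
    from loop[OF e False] obtain a where a: "?en e = {a}" "pos a = lo e" by blast
    have "Im z = real (lo e)" using im_loop[OF False z(1)] z(2) by simp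
    then have "z = pt a" using a z(2) by (auto simp: pt_def complex_eq_iff)
    then show ?thesis using a by auto
  qed
  have sp: "simple_path (cu e)" for e
  proof (cases "lo e < hi e")
    case True
    have "arc (cu e)"
      unfolding arc_def
    proof
      have "continuous_on {0..1} (\<lambda>t. Complex (h e * (t * (real (hi e) - real (lo e))) * ((1 - t) * (real (hi e) - real (lo e))))
                       (real (lo e) + t * (real (hi e) - real (lo e))))"
        unfolding Complex_eq by (intro continuous_intros)
      then show "path (cu e)" using True by (simp add: path_def cu_def)
      show "inj_on (cu e) {0..1}" using True by (auto simp: inj_on_def cu_def)
    qed
    then show ?thesis by (rule arc_imp_simple_path)
  next
    case False
    then show ?thesis using \<rho>(1)[of e] by (simp add: cu_def simple_path_circlepath)
  qed
  have sf: "{pathstart (cu e), pathfinish (cu e)} = pt ` ?en e" if e: "e \<in> ?E" for e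
  proof (cases "lo e < hi e")
    case True
    from chord[OF e True] obtain a b where ab: "?en e = {a, b}" "pos a = lo e" "pos b = hi e" by blast
    then show ?thesis using True by (simp add: pathstart_def pathfinish_def cu_def pt_def)
  next
    case False
    from loop[OF e False] obtain a where a: "?en e = {a}" "pos a = lo e" by blast
    have "Complex (- \<rho> e) (real (lo e)) + complex_of_real (\<rho> e) = Complex 0 (real (lo e))"
      by (simp add: complex_eq_iff)
    then show ?thesis using False a by (simp add: cu_def pt_def)
  qed
  have iV: "path_image (cu e) \<inter> pt ` ?V = pt ` ?en e" if e: "e \<in> ?E" for e
  proof
    show "path_image (cu e) \<inter> pt ` ?V \<subseteq> pt ` ?en e" using Re0[OF e] by (auto simp: pt_def)
    have "pt ` ?en e \<subseteq> path_image (cu e)" unfolding sf[OF e, symmetric]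
      using pathstart_in_path_image[of "cu e"] pathfinish_in_path_image[of "cu e"] by simp
    then show "pt ` ?en e \<subseteq> path_image (cu e) \<inter> pt ` ?V" using ends(1)[OF e] by blast
  qed
  \<comment> \<open>The smaller factor means that \<open>f\<close> is not longer than
    \<open>e\<close>. The spans overlap without crossing, so that of \<open>f\<close> is nested in
    that of \<open>e\<close>, and at the common height the product for \<open>f\<close> is strictly
    smaller.\<close>
  have crossing: False if e: "e \<in> ?E" "lo e < hi e" and f: "f \<in> ?E" "lo f < hi f" and hh: "h f < h e"
    and z: "z \<in> path_image (cu e)" "z \<in> path_image (cu f)" "Re z \<noteq> 0" for e f z
  proof -
    from chord[OF e] obtain a b where ab: "a \<in> ?V" "b \<in> ?V" "a \<noteq> b" "?en e = {a, b}" "pos a = lo e" "pos b = hi e" by blast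
    from chord[OF f] obtain c d where cd: "c \<in> ?V" "d \<in> ?V" "c \<noteq> d" "?en f = {c, d}" "pos c = lo f" "pos d = hi f" by blast
    let ?y = "Im z"
    have ee: "Re z = h e * (?y - real (lo e)) * (real (hi e) - ?y)" "real (lo e) < ?y" "?y < real (hi e)"
      using im_chord[OF e(2) z(1)] z(3) by (auto simp: less_le)
    have ff: "Re z = h f * (?y - real (lo f)) * (real (hi f) - ?y)" "real (lo f) < ?y" "?y < real (hi f)"
      using im_chord[OF f(2) z(2)] z(3) by (auto simp: less_le)
    have ov: "lo e < hi f" "lo f < hi e" using ee ff by linarith+
    have x1: "\<not> (lo e < lo f \<and> hi e < hi f)"
      using nc ab cd e(1) f(1) ov unfolding noncrossing_def by metis
    have x2: "\<not> (lo f < lo e \<and> hi f < hi e)"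
      using nc ab cd e(1) f(1) ov unfolding noncrossing_def by metis
    have "real (hi f - lo f) < real (hi e - lo e) + 1" using hh \<rho>[of e] \<rho>[of f] by (simp add: h_def)
    then have len: "hi f - lo f \<le> hi e - lo e" by linarith
    have nest: "lo e \<le> lo f" "hi f \<le> hi e" using x1 x2 len e(2) f(2) by linarith+
    have "h f * (?y - real (lo f)) * (real (hi f) - ?y) < h e * (?y - real (lo e)) * (real (hi e) - ?y)"
    proof (rule mult_less_le_imp_less)
      show "h f * (?y - real (lo f)) < h e * (?y - real (lo e))"
        by (rule mult_less_le_imp_less) (use hh nest ff hpos[of f] in auto)
    qed (use nest ff hpos[of f] in auto)
    then show False using ee(1) ff(1) by simp
  qed
  have int: "path_image (cu e) \<inter> path_image (cu f) \<subseteq> pt ` ?V" if ef: "e \<in> ?E" "f \<in> ?E" "e \<noteq> f" for e f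
  proof
    fix z assume z: "z \<in> path_image (cu e) \<inter> path_image (cu f)"
    then have z1: "z \<in> path_image (cu e)" and z2: "z \<in> path_image (cu f)" by auto
    show "z \<in> pt ` ?V"
    proof (cases "Re z = 0")
      case True
      then show ?thesis using Re0[OF ef(1) z1] ends(1)[OF ef(1)] by blast
    next
      case False
      consider "lo e < hi e" "lo f < hi f" | "lo e < hi e" "\<not> lo f < hi f" | "\<not> lo e < hi e" "lo f < hi f"
        | "\<not> lo e < hi e" "\<not> lo f < hi f" by blast
      then show ?thesis
      proof cases
        case 1
        have "h e \<noteq> h f"
        proof
          assume eq: "h e = h f"
          then have "\<bar>real (hi e - lo e) - real (hi f - lo f)\<bar> < 1"
            using \<rho>[of e] \<rho>[of f] by (simp add: h_def)
          then have "hi e - lo e = hi f - lo f" by (rule of_nat_eq_if_close)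
          then have "\<rho> e = \<rho> f" using eq by (simp add: h_def)
          then show False using \<rho>_inj ef by blast
        qed
        then have "h f < h e \<or> h e < h f" by linarith
        then show ?thesis
          using crossing[OF ef(1) 1(1) ef(2) 1(2) _ z1 z2 False] crossing[OF ef(2) 1(2) ef(1) 1(1) _ z2 z1 False]
          by blast
      next
        case 2
        then show ?thesis using chord_Re[OF 2(1) z1] loop_Re(1)[OF 2(2) z2] False by linarith
      next
        case 3
        then show ?thesis using chord_Re[OF 3(2) z2] loop_Re(1)[OF 3(1) z1] False by linarith
      next
        case 4
        have "\<bar>real (lo e) - real (lo f)\<bar> < 1"
          using loop_Re(2)[OF 4(1) z1] loop_Re(2)[OF 4(2) z2] \<rho>(2)[of e] \<rho>(2)[of f] by linarith
        then have eq: "real (lo e) = real (lo f)" using of_nat_eq_if_close[of "lo e" "lo f"] by simp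
        have "2 * \<rho> e * Re z = 2 * \<rho> f * Re z"
          using im_loop[OF 4(1) z1] im_loop[OF 4(2) z2] unfolding eq by linarith
        then have "\<rho> e = \<rho> f" using False by simp
        then show ?thesis using \<rho>_inj ef by blast
      qed
    qed
  qed
  have inj_pt: "inj_on pt ?V" using inj by (auto simp: inj_on_def pt_def)
  have pm: "planar_map (G, Dr)"
    unfolding planar_map_def plane_drawing_def using G inj_pt sp sf iV int by (simp add: Dr_def)
  define S where "S = skeleton (G, Dr)"
  have S: "S = pt ` ?V \<union> (\<Union>e\<in>?E. path_image (cu e))" by (simp add: S_def skeleton_def Dr_def)
  \<comment> \<open>\<open>H\<close> lies to the left of all loops, whose diameters are below 1.
    From it the ray \<open>T1 v\<close> at a half-integer height passes between the loops to the
    axis, and \<open>T2 v\<close> descends along the axis towards the vertex.\<close>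
  define H where "H = {z. Re z < -1}"
  define T1 where "T1 v = {z. Re z \<le> 0} \<inter> ({z. Im z \<le> real (pos v) + 1/2} \<inter> {z. Im z \<ge> real (pos v) + 1/2})" for v
  define T2 where "T2 v = ({z. Re z \<le> 0} \<inter> {z. Re z \<ge> 0}) \<inter> ({z. Im z > real (pos v)} \<inter> {z. Im z \<le> real (pos v) + 1/2})" for v
  have S_half: "z \<notin> S" if "Re z \<le> 0" "Im z = real k + 1/2" for z k
  proof
    have nat: "Im z \<noteq> real m" for m
    proof
      assume "Im z = real m"
      then have "real (2 * m) = real (2 * k + 1)" using that(2) by simp
      then have "2 * m = 2 * k + 1" using of_nat_eq_iff by blast
      then show False by presburger
    qed
    then have npt: "z \<noteq> pt w" for w by (metis complex.sel(2) pt_def)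
    assume "z \<in> S"
    then obtain e where e: "e \<in> ?E" "z \<in> path_image (cu e)" using npt by (auto simp: S)
    show False
    proof (cases "lo e < hi e")
      case True
      then have "Re z = 0" using chord_Re[OF True e(2)] that(1) by simp
      then show False using Re0[OF e] npt by blast
    next
      case False
      have "\<bar>real k + 1/2 - real (lo e)\<bar> < 1/2"
        using loop_Re(2)[OF False e(2)] \<rho>(2)[of e] that(2) by simp
      then have "real k < real (lo e)" "real (lo e) < real (Suc k)" by linarith+
      then show False unfolding of_nat_less_iff by simp
    qed
  qed
  have S_axis: "z \<in> pt ` ?V" if "Re z = 0" "z \<in> S" for z
    using that Re0 ends(1) unfolding S by blast
  have S_H: "H \<inter> S = {}"
  proof -
    have "Re z \<ge> -1" if zS: "z \<in> S" for z
    proof (cases "z \<in> pt ` ?V")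
      case True
      then show ?thesis by (auto simp: pt_def)
    next
      case False
      then obtain e where e: "e \<in> ?E" "z \<in> path_image (cu e)" using zS by (auto simp: S)
      then show ?thesis using chord_Re[of e z] loop_Re(3)[of e z] by fastforce
    qed
    then show ?thesis unfolding H_def by fastforce
  qed
  define F where "F = connected_component_set (- S) (-2)"
  have m2: "-2 \<in> H" by (simp add: H_def)
  have conH: "connected H" unfolding H_def by (intro convex_connected convex_halfspace_Re_lt)
  have HF: "H \<subseteq> F" unfolding F_def
    by (rule connected_component_maximal[OF m2 conH]) (use S_H in blast)
  have TF: "T2 v \<subseteq> F" if "v \<in> ?V" for v
  proof -
    have c1: "connected (T1 v)" unfolding T1_def
      by (intro convex_connected convex_Int convex_halfspace_Re_le convex_halfspace_Im_le convex_halfspace_Im_ge)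
    have c2: "connected (T2 v)" unfolding T2_def
      by (intro convex_connected convex_Int convex_halfspace_Re_le convex_halfspace_Re_ge
          convex_halfspace_Im_le convex_halfspace_Im_gt)
    have "Complex (-2) (real (pos v) + 1/2) \<in> H \<inter> T1 v" by (simp add: H_def T1_def)
    then have c3: "connected (H \<union> T1 v)" using connected_Un[OF conH c1] by blast
    have "Complex 0 (real (pos v) + 1/2) \<in> (H \<union> T1 v) \<inter> T2 v" by (simp add: T1_def T2_def)
    then have c4: "connected ((H \<union> T1 v) \<union> T2 v)" using connected_Un[OF c3 c2] by blast
    have "T1 v \<inter> S = {}" using S_half[of _ "pos v"] by (auto simp: T1_def)
    moreover have "T2 v \<inter> S = {}"
    proof -
      have False if z: "z \<in> T2 v" "z \<in> S" for z
      proof -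
        have "Re z = 0" using z by (simp add: T2_def)
        from S_axis[OF this z(2)] obtain w where "z = pt w" by blast
        then have "real (pos v) < real (pos w)" "real (pos w) < real (Suc (pos v))"
          using z(1) by (auto simp: T2_def pt_def)
        then show False unfolding of_nat_less_iff by simp
      qed
      then show ?thesis by blast
    qed
    ultimately have "(H \<union> T1 v) \<union> T2 v \<subseteq> - S" using S_H by blast
    then have "(H \<union> T1 v) \<union> T2 v \<subseteq> F" unfolding F_def
      using connected_component_maximal[OF _ c4, of "-2" "- S"] m2 by blast
    then show ?thesis by blast
  qed
  have "F \<in> faces (G, Dr)"
    unfolding faces_def F_def S_def[symmetric] using S_H m2 by (auto simp: components_def)
  moreover have "\<not> bounded F"
  proof
    assume "bounded F"
    then obtain B where B: "\<And>z. z \<in> F \<Longrightarrow> cmod z \<le> B" unfolding bounded_iff by blast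
    have "complex_of_real (- \<bar>B\<bar> - 2) \<in> H" by (simp add: H_def)
    then have "cmod (complex_of_real (- \<bar>B\<bar> - 2)) \<le> B" using B HF by blast
    then show False by (simp only: norm_of_real)
  qed
  moreover have "vertex_on_face (G, Dr) v F" if v: "v \<in> ?V" for v
  proof -
    have "pt v \<in> closure F"
      unfolding closure_approachable
    proof (intro allI impI)
      fix \<epsilon> :: real assume "\<epsilon> > 0"
      define \<delta> where "\<delta> = min (\<epsilon>/2) (1/2)"
      have \<delta>: "0 < \<delta>" "\<delta> < \<epsilon>" "\<delta> \<le> 1/2" using \<open>\<epsilon> > 0\<close> by (auto simp: \<delta>_def min_def)
      have "Complex 0 (real (pos v) + \<delta>) \<in> F" using TF[OF v] \<delta> by (auto simp: T2_def)
      moreover have "dist (Complex 0 (real (pos v) + \<delta>)) (pt v) < \<epsilon>"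
        using \<delta> by (simp add: pt_def dist_complex_def cmod_def)
      ultimately show "\<exists>y\<in>F. dist y (pt v) < \<epsilon>" by blast
    qed
    moreover have "pt v \<notin> F"
    proof
      assume "pt v \<in> F"
      then have "pt v \<in> - S" unfolding F_def using connected_component_subset by blast
      then show False using v by (simp add: S)
    qed
    ultimately have "pt v \<in> frontier F" using interior_subset[of F] by (auto simp: frontier_def)
    then show ?thesis by (simp add: vertex_on_face_def Dr_def)
  qed
  ultimately show ?thesis unfolding outerplanar_def using pm by blast
qed

section \<open>Realizers of the vertex-edge-face poset\<close>

context plane_map
begin

lemma sphere_map: "sphere_map V E (faces M) en co (vertex_on_face M)"
proof
  show "finite V" "finite E" "finite (faces M)" by (rule finV finE finite_faces)+
  show "en e \<subseteq> V" "card (en e) = 1 \<or> card (en e) = 2" "card (co e) = 1 \<or> card (co e) = 2" if "e \<in> E" for e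
    using en_sub en_card co_card that by auto
  show "co e \<subseteq> faces M" for e by (auto simp: co_def)
  show "vertex_on_face M v F" if "e \<in> E" "v \<in> en e" "F \<in> co e" for e v F
    using that pt_end_img[of e v] by (auto simp: co_def edge_on_face_def vertex_on_face_def)
  show "\<exists>g. (\<forall>e\<in>E. cobd co g e = of_bool (e \<in> C)) \<and>
      (\<forall>v\<in>V - U. \<exists>k. \<forall>F\<in>faces M. vertex_on_face M v F \<longrightarrow> g F = k)" if "gcycle en E C U" for C U
    using cycle_chain[OF that] .
  show "\<exists>k. \<forall>F\<in>faces M. g F = k" if "\<And>C U. gcycle en E C U \<Longrightarrow> \<not> C \<subseteq> {e \<in> E. cobd co g e = 1}" for g
    using acyclic_chain_const[OF that] .
qed

lemma dual_graph_eq: "dual_graph M = \<lparr>verts = faces M, edges = E, ends = co\<rparr>"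
  by (auto simp: dual_graph_def co_def)

lemma finite_dual: "finite_multigraph (dual_graph M)"
  unfolding dual_graph_eq finite_multigraph_def using finE finite_faces co_card
  by (auto simp: co_def)

end

text \<open>If every realizer had at least four members, so would the infimum; hence one has at most
  three. A smaller realizer is padded by repetition.\<close>

lemma order_dim_le_3:
  assumes "order_dim A r \<le> 3"
  obtains l1 l2 l3 where "linear_order_on A l1" "linear_order_on A l2" "linear_order_on A l3" "l1 \<inter> l2 \<inter> l3 = r"
proof -
  let ?S = "{L. finite L \<and> L \<noteq> {} \<and> (\<forall>l\<in>L. linear_order_on A l) \<and> \<Inter>L = r}"
  have "\<exists>L\<in>?S. enat (card L) \<le> 3"
  proof (rule ccontr)
    assume n: "\<not> (\<exists>L\<in>?S. enat (card L) \<le> 3)"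
    have "enat 4 \<le> enat (card L)" if L: "L \<in> ?S" for L
    proof -
      have "\<not> enat (card L) \<le> 3" using n L by blast
      then show ?thesis by (simp add: numeral_eq_enat)
    qed
    then have "enat 4 \<le> order_dim A r" unfolding order_dim_def by (intro INF_greatest)
    then have "enat 4 \<le> 3" using assms by (rule order_trans)
    then show False by (simp add: numeral_eq_enat)
  qed
  then obtain L where L: "finite L" "L \<noteq> {}" "\<forall>l\<in>L. linear_order_on A l" "\<Inter>L = r" "card L \<le> 3"
    by (auto simp: numeral_eq_enat)
  have "\<exists>a b c. L = {a, b, c}"
  proof -
    have "card L \<noteq> 0" using L by simp
    then consider "card L = 1" | "card L = 2" | "card L = 3" using L(5) by linarith
    then show ?thesis
      by cases (auto simp: card_1_singleton_iff card_2_iff card_3_iff)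
  qed
  then obtain a b c where "L = {a, b, c}" by blast
  then show thesis using that[of a b c] L by auto
qed

lemma linear_order_strict:
  assumes "linear_order_on A l"
  shows "x \<noteq> y \<and> (x, y) \<in> l \<Longrightarrow> y \<noteq> z \<and> (y, z) \<in> l \<Longrightarrow> x \<noteq> z \<and> (x, z) \<in> l"
    and "x \<in> A \<Longrightarrow> y \<in> A \<Longrightarrow> x \<noteq> y \<Longrightarrow> (x \<noteq> y \<and> (x, y) \<in> l) = (\<not> (y \<noteq> x \<and> (y, x) \<in> l))"
  using assms unfolding linear_order_on_def partial_order_on_def preorder_on_def total_on_def
    antisym_def trans_def by metis+

theorem theorem2p4:
  fixes M :: "('v, 'e) map"
  assumes "planar_map M"
    and "order_dim (vef_cells M) (vef_order M) \<le> 3"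
  shows "weakly_outerplanar M \<and> outerplanar (dual_graph M)"
proof -
  interpret plane_map M by unfold_locales (rule assms(1))
  interpret sphere_map V E "faces M" en co "vertex_on_face M" by (rule sphere_map)
  obtain l1 l2 l3 where l: "linear_order_on (vef_cells M) l1" "linear_order_on (vef_cells M) l2"
    "linear_order_on (vef_cells M) l3" "l1 \<inter> l2 \<inter> l3 = vef_order M"
    using assms(2) by (rule order_dim_le_3)
  define K where "K l x y \<longleftrightarrow> x \<noteq> y \<and> (x, y) \<in> l" for l :: "(('v, 'e) cell \<times> ('v, 'e) cell) set" and x y
  have tr: "K l x y \<Longrightarrow> K l y z \<Longrightarrow> K l x z" if "linear_order_on (vef_cells M) l" for l x y z
    unfolding K_def by (rule linear_order_strict(1)[OF that])
  have tot: "K l x y \<longleftrightarrow> \<not> K l y x"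
    if "linear_order_on (vef_cells M) l" "x \<in> vef_cells M" "y \<in> vef_cells M" "x \<noteq> y" for l x y
    unfolding K_def by (rule linear_order_strict(2)[OF that])
  have cells: "vef_cells M = Vertex ` V \<union> Edge ` E \<union> Face ` faces M" by (simp add: vef_cells_def)
  have K3: "K l1 x y \<and> K l2 x y \<and> K l3 x y \<longleftrightarrow> x \<noteq> y \<and> (x, y) \<in> vef_order M" for x y
    unfolding K_def l(4)[symmetric] by blast
  have "realized_map V E (faces M) en co (vertex_on_face M) Vertex Edge Face (K l1) (K l2) (K l3)"
  proof
    show "\<exists>g. (\<forall>e\<in>E. cobd co g e = c e) \<and> (\<forall>F\<in>faces M. vertex_on_face M v F \<longrightarrow> g F = 0)"
      if "\<And>w. w \<in> V \<Longrightarrow> bd E en c w = 0" "v \<in> V" "\<And>e. e \<in> E \<Longrightarrow> v \<in> en e \<Longrightarrow> c e = 0" for c v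
      using region[OF that] .
    show "K l1 x y \<Longrightarrow> K l1 y z \<Longrightarrow> K l1 x z" "K l2 x y \<Longrightarrow> K l2 y z \<Longrightarrow> K l2 x z"
      "K l3 x y \<Longrightarrow> K l3 y z \<Longrightarrow> K l3 x z" for x y z
      by (fact tr[OF l(1)] tr[OF l(2)] tr[OF l(3)])+
    show "(K l1 x y \<longleftrightarrow> \<not> K l1 y x) \<and> (K l2 x y \<longleftrightarrow> \<not> K l2 y x) \<and> (K l3 x y \<longleftrightarrow> \<not> K l3 y x)"
      if "x \<in> Vertex ` V \<union> Edge ` E \<union> Face ` faces M" "y \<in> Vertex ` V \<union> Edge ` E \<union> Face ` faces M" "x \<noteq> y" for x y
      using tot[OF l(1) that[folded cells]] tot[OF l(2) that[folded cells]] tot[OF l(3) that[folded cells]] by simp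
  qed (simp_all add: K3 vef_order_def Id_on_iff co_def finV finE finF en_sub co_sub inc_edge incid_orthogonal)
  then have "\<exists>pos. noncrossing (\<lambda>x y. x \<noteq> y \<and> (\<exists>e\<in>E. en e = {x, y})) V pos"
    by (rule realized_map.noncrossing_exists)
  then have 1: "outerplanar (fst M)"
    using noncrossing_imp_outerplanar[of "fst M"] assms(1) unfolding planar_map_def by blast
  \<comment> \<open>Vertices and faces change places and the three orders are read backwards, which
    reverses the poset. \<open>dual_region\<close> now plays the part of
    \<open>region\<close>.\<close>
  have "realized_map (faces M) E V co en (\<lambda>F v. vertex_on_face M v F) Face Edge Vertex
    (\<lambda>x y. K l1 y x) (\<lambda>x y. K l2 y x) (\<lambda>x y. K l3 y x)"
  proof
    show "\<exists>g. (\<forall>e\<in>E. cobd en g e = c e) \<and> (\<forall>v\<in>V. vertex_on_face M v F \<longrightarrow> g v = 0)"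
      if "\<And>w. w \<in> faces M \<Longrightarrow> bd E co c w = 0" "F \<in> faces M" "\<And>e. e \<in> E \<Longrightarrow> F \<in> co e \<Longrightarrow> c e = 0" for c F
      using dual_region[OF that] .
    show "(\<Sum>e\<in>E. incid co v e * incid en F e) = 0" if "v \<in> faces M" "F \<in> V" for v F
      using incid_orthogonal[OF that(2,1)] by (simp add: mult.commute)
    show "K l1 y x \<Longrightarrow> K l1 z y \<Longrightarrow> K l1 z x" "K l2 y x \<Longrightarrow> K l2 z y \<Longrightarrow> K l2 z x"
      "K l3 y x \<Longrightarrow> K l3 z y \<Longrightarrow> K l3 z x" for x y z
      using tr[OF l(1), of z y x] tr[OF l(2), of z y x] tr[OF l(3), of z y x] by simp_all
    show "(K l1 y x \<longleftrightarrow> \<not> K l1 x y) \<and> (K l2 y x \<longleftrightarrow> \<not> K l2 x y) \<and> (K l3 y x \<longleftrightarrow> \<not> K l3 x y)"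
      if "x \<in> Face ` faces M \<union> Edge ` E \<union> Vertex ` V" "y \<in> Face ` faces M \<union> Edge ` E \<union> Vertex ` V" "x \<noteq> y" for x y
    proof -
      have xy: "y \<in> vef_cells M" "x \<in> vef_cells M" "y \<noteq> x" using that unfolding cells by auto
      show ?thesis using tot[OF l(1) xy] tot[OF l(2) xy] tot[OF l(3) xy] by simp
    qed
  qed (simp_all add: K3 vef_order_def Id_on_iff co_def finV finE finF en_sub co_sub inc_edge)
  then have "\<exists>pos. noncrossing (\<lambda>x y. x \<noteq> y \<and> (\<exists>e\<in>E. co e = {x, y})) (faces M) pos"
    by (rule realized_map.noncrossing_exists)
  \<comment> \<open>Outerplanarity concerns the abstract graph, so the drawing made from the
    noncrossing order of the faces suffices.\<close>
  then have 2: "outerplanar (dual_graph M)"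
    using noncrossing_imp_outerplanar[of "dual_graph M"] finite_dual unfolding dual_graph_eq by auto
  show ?thesis using 1 2 by (simp add: weakly_outerplanar_def)
qed

end
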